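(* Let $\mathcal G$ be a finite bipartite graph with positive edge weights, embedded in the plane, with $2n$ distinguished vertices (nodes) on its outer face, numbered $1,\dots,2n$ in counterclockwise order. Suppose that the nodes are contiguously colored red, green, and blue, i.e. the nodes of each color form a contiguous interval in the cyclic order (a color may occur zero times), and that $\sigma$ is the (unique) planar pairing of the nodes in which like colors are not paired together. Let $\sigma_i$ denote the node that $\sigma$ pairs with node $i$. Then $$\widehat{\Pr}(\sigma)=\det\left[\mathbf 1_{\{i,\,j\text{ colored differently}\}}\,X_{i,j}\right]^{i=1,3,\dots,2n-1}_{j=\sigma_1,\sigma_3,\dots,\sigma_{2n-1}},$$ where rows are indexed by $i=1,3,\dots,2n-1$ and columns by $j=\sigma_1,\sigma_3,\dots,\sigma_{2n-1}$, in these orders.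
   Context: Bipartite: the vertices are colored black and white so that adjacent vertices have different colors (this black/white coloring is unrelated to the red/green/blue coloring of the nodes). Double-dimer configuration: a multiset of edges of $\mathcal G$ such that every vertex other than a node is an endpoint of exactly two edges (with multiplicity) and every node is an endpoint of exactly one edge. Such a configuration consists of paths connecting the nodes in pairs, doubled edges, and loops (cycles; doubled edges do not count as loops). Its weight is the product of the weights of its edges (doubled edges counted twice) times $2^\ell$, where $\ell$ is the number of loops. The probability of a configuration is proportional to its weight. $\Pr(\sigma)$ is the probability that a random double-dimer configuration connects the nodes according to the pairing $\sigma$. Dimer cover (perfect matching) of a graph: a set of edges whose endpoints cover every vertex exactly once; its weight is the product of its edge weights. $\mathcal G^{\mathsf{BW}}$ is the subgraph of $\mathcal G$ obtained by deleting all nodes except those that are black and odd-numbered or white and even-numbered. $\mathcal G^{\mathsf{BW}}_{i,j}$ is defined in the same way, but with each of the nodes $i$ and $j$ included in $\mathcal G^{\mathsf{BW}}_{i,j}$ if and only if it was not included in $\mathcal G^{\mathsf{BW}}$. $\mathcal G^{\mathsf{WB}}$ is defined like $\mathcal G^{\mathsf{BW}}$ with the roles of black and white reversed. $Z^{\mathsf{BW}}$, $Z^{\mathsf{BW}}_{i,j}$, $Z^{\mathsf{WB}}$ are the weighted sums of dimer covers of $\mathcal G^{\mathsf{BW}}$, $\mathcal G^{\mathsf{BW}}_{i,j}$, $\mathcal G^{\mathsf{WB}}$ respectively. It is assumed that $\mathcal G$ has at least one double-dimer configuration (the total weight of double-dimer configurations equals $Z^{\mathsf{BW}}Z^{\mathsf{WB}}$,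 so both factors are nonzero). Set $$X_{i,j}=\frac{Z^{\mathsf{BW}}_{i,j}}{Z^{\mathsf{BW}}},\qquad \widehat{\Pr}(\sigma)=\Pr(\sigma)\,\frac{Z^{\mathsf{WB}}}{Z^{\mathsf{BW}}}.$$ A pairing is planar if there are no $a<b<c<d$ with $a$ paired with $c$ and $b$ paired with $d$. *)

theory Defs
  imports "HOL-Complex_Analysis.Complex_Analysis" "Jordan_Normal_Form.Determinant"
begin

section \<open>Weighted bipartite graphs with numbered nodes\<close>

text \<open>Edges are abstract and carry their set of endpoints, so parallel edges are allowed; simple
  graphs are the case where \<open>ends\<close> is injective on the edges. Only the values of \<open>node\<close> on
  \<open>1, \<dots>, 2n\<close> matter.\<close>

record ('v, 'e) noded_graph =
  verts :: "'v set"
  edges :: "'e set"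
  ends  :: "'e \<Rightarrow> 'v set"
  wt    :: "'e \<Rightarrow> real"
  black :: "'v \<Rightarrow> bool"
  node  :: "nat \<Rightarrow> 'v"

definition nodes :: "nat \<Rightarrow> ('v, 'e) noded_graph \<Rightarrow> 'v set" where
  "nodes n G = node G ` {1..2*n}"

definition noded_bipartite_graph :: "nat \<Rightarrow> ('v, 'e) noded_graph \<Rightarrow> bool" where
  "noded_bipartite_graph n G \<longleftrightarrow>
     finite (verts G) \<and> finite (edges G) \<and>
     (\<forall>e\<in>edges G. \<exists>b\<in>verts G. \<exists>w\<in>verts G. ends G e = {b, w} \<and> black G b \<and> \<not> black G w) \<and>
     (\<forall>e\<in>edges G. wt G e > 0) \<and>
     nodes n G \<subseteq> verts G \<and> inj_on (node G) {1..2*n}"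


section \<open>Plane embeddings with nodes on the outer face\<close>

definition plane_embedding ::
    "('v, 'e) noded_graph \<Rightarrow> ('v \<Rightarrow> complex) \<Rightarrow> ('e \<Rightarrow> real \<Rightarrow> complex) \<Rightarrow> bool" where
  "plane_embedding G pos crv \<longleftrightarrow>
     inj_on pos (verts G) \<and>
     (\<forall>e\<in>edges G. arc (crv e) \<and>
        {pathstart (crv e), pathfinish (crv e)} = pos ` ends G e \<and>
        path_image (crv e) \<inter> pos ` verts G = pos ` ends G e) \<and>
     (\<forall>e\<in>edges G. \<forall>f\<in>edges G. e \<noteq> f \<longrightarrow>
        path_image (crv e) \<inter> path_image (crv f) = pos ` (ends G e \<inter> ends G f))"

definition drawing ::
    "('v, 'e) noded_graph \<Rightarrow> ('v \<Rightarrow> complex) \<Rightarrow> ('e \<Rightarrow> real \<Rightarrow> complex) \<Rightarrow> complex set" where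
  "drawing G pos crv = pos ` verts G \<union> (\<Union>e\<in>edges G. path_image (crv e))"

text \<open>The outer face is the unbounded component \<open>outside (drawing G pos crv)\<close> of the complement.\<close>

definition nodes_on_outer_face ::
    "nat \<Rightarrow> ('v, 'e) noded_graph \<Rightarrow> ('v \<Rightarrow> complex) \<Rightarrow> ('e \<Rightarrow> real \<Rightarrow> complex) \<Rightarrow> bool" where
  "nodes_on_outer_face n G pos crv \<longleftrightarrow>
     pos ` nodes n G \<subseteq> frontier (outside (drawing G pos crv))"

text \<open>The boundary of the outer face need not be a simple closed curve (the graph may have cut
  vertices or be disconnected). The cyclic order is therefore read off a Jordan curve \<open>g\<close> that
  surrounds the drawing, touches it exactly at the nodes, and runs counterclockwise, i.e. has
  winding number 1 about the points it encloses. If a node occurs several times on the boundary of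
  the outer face, any of its occurrences may be used.\<close>

definition nodes_counterclockwise ::
    "nat \<Rightarrow> ('v, 'e) noded_graph \<Rightarrow> ('v \<Rightarrow> complex) \<Rightarrow> ('e \<Rightarrow> real \<Rightarrow> complex) \<Rightarrow> bool" where
  "nodes_counterclockwise n G pos crv \<longleftrightarrow>
     (\<exists>(g :: real \<Rightarrow> complex) (t :: nat \<Rightarrow> real).
        simple_path g \<and> pathfinish g = pathstart g \<and>
        (\<forall>z\<in>inside (path_image g). winding_number g z = 1) \<and>
        drawing G pos crv \<subseteq> path_image g \<union> inside (path_image g) \<and>
        drawing G pos crv \<inter> path_image g = pos ` nodes n G \<and>
        strict_mono_on {1..2*n} t \<and>
        (\<forall>i\<in>{1..2*n}. 0 \<le> t i \<and> t i < 1 \<and> g (t i) = pos (node G i)))"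


section \<open>Double-dimer configurations\<close>

definition double_dimer_configs :: "nat \<Rightarrow> ('v, 'e) noded_graph \<Rightarrow> 'e multiset set" where
  "double_dimer_configs n G =
     {M. set_mset M \<subseteq> edges G \<and>
         (\<forall>v\<in>verts G. size {#e \<in># M. v \<in> ends G e#} = (if v \<in> nodes n G then 1 else 2))}"

text \<open>Cycles are given by their edge sets. The edges of a cycle are distinct, so a doubled edge is
  not a cycle, whereas two different parallel edges form a cycle of length 2.\<close>

definition is_cycle :: "('v, 'e) noded_graph \<Rightarrow> 'e set \<Rightarrow> bool" where
  "is_cycle G C \<longleftrightarrow>
     C \<subseteq> edges G \<and>
     (\<exists>vs es. length vs = length es \<and> length es \<ge> 2 \<and> distinct vs \<and> distinct es \<and> set es = C \<and>
        (\<forall>k<length es. ends G (es ! k) = {vs ! k, vs ! (Suc k mod length es)}))"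

definition loops :: "('v, 'e) noded_graph \<Rightarrow> 'e multiset \<Rightarrow> 'e set set" where
  "loops G M = {C. is_cycle G C \<and> C \<subseteq> set_mset M}"

definition config_weight :: "('v, 'e) noded_graph \<Rightarrow> 'e multiset \<Rightarrow> real" where
  "config_weight G M = prod_mset (image_mset (wt G) M) * 2 ^ card (loops G M)"

definition joined :: "('v, 'e) noded_graph \<Rightarrow> 'e multiset \<Rightarrow> 'v \<Rightarrow> 'v \<Rightarrow> bool" where
  "joined G M u v \<longleftrightarrow> (u, v) \<in> {(x, y). \<exists>e\<in>#M. ends G e = {x, y}}\<^sup>*"

definition connects_as :: "nat \<Rightarrow> ('v, 'e) noded_graph \<Rightarrow> (nat \<Rightarrow> nat) \<Rightarrow> 'e multiset \<Rightarrow> bool" where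
  "connects_as n G \<sigma> M \<longleftrightarrow> (\<forall>i\<in>{1..2*n}. joined G M (node G i) (node G (\<sigma> i)))"

definition Pr :: "nat \<Rightarrow> ('v, 'e) noded_graph \<Rightarrow> (nat \<Rightarrow> nat) \<Rightarrow> real" where
  "Pr n G \<sigma> =
     (\<Sum>M\<in>{M \<in> double_dimer_configs n G. connects_as n G \<sigma> M}. config_weight G M) /
     (\<Sum>M\<in>double_dimer_configs n G. config_weight G M)"


section \<open>Dimer covers\<close>

definition dimer_covers :: "('v, 'e) noded_graph \<Rightarrow> 'v set \<Rightarrow> 'e set set" where
  "dimer_covers G U =
     {D. D \<subseteq> edges G \<and> (\<forall>e\<in>D. ends G e \<subseteq> U) \<and> (\<forall>v\<in>U. \<exists>!e. e \<in> D \<and> v \<in> ends G e)}"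

definition Z :: "('v, 'e) noded_graph \<Rightarrow> 'v set \<Rightarrow> real" where
  "Z G U = (\<Sum>D\<in>dimer_covers G U. \<Prod>e\<in>D. wt G e)"

text \<open>The graphs $\mathcal G^{BW}$, $\mathcal G^{WB}$, $\mathcal G^{BW}_{i,j}$ are induced
  subgraphs and are represented by their vertex sets.\<close>

definition BW :: "nat \<Rightarrow> ('v, 'e) noded_graph \<Rightarrow> 'v set" where
  "BW n G = verts G - node G ` {i \<in> {1..2*n}. \<not> (black G (node G i) \<and> odd i \<or>
                                                  \<not> black G (node G i) \<and> even i)}"

definition WB :: "nat \<Rightarrow> ('v, 'e) noded_graph \<Rightarrow> 'v set" where
  "WB n G = verts G - node G ` {i \<in> {1..2*n}. \<not> (\<not> black G (node G i) \<and> odd i \<or>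
                                                  black G (node G i) \<and> even i)}"

definition BW_toggle :: "nat \<Rightarrow> ('v, 'e) noded_graph \<Rightarrow> nat \<Rightarrow> nat \<Rightarrow> 'v set" where
  "BW_toggle n G i j = sym_diff (BW n G) {node G i, node G j}"

definition X :: "nat \<Rightarrow> ('v, 'e) noded_graph \<Rightarrow> nat \<Rightarrow> nat \<Rightarrow> real" where
  "X n G i j = Z G (BW_toggle n G i j) / Z G (BW n G)"

definition Pr_hat :: "nat \<Rightarrow> ('v, 'e) noded_graph \<Rightarrow> (nat \<Rightarrow> nat) \<Rightarrow> real" where
  "Pr_hat n G \<sigma> = Pr n G \<sigma> * (Z G (WB n G) / Z G (BW n G))"


section \<open>Pairings and colorings of the nodes\<close>

definition is_pairing :: "nat \<Rightarrow> (nat \<Rightarrow> nat) \<Rightarrow> bool" where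
  "is_pairing n \<sigma> \<longleftrightarrow> (\<forall>i\<in>{1..2*n}. \<sigma> i \<in> {1..2*n} \<and> \<sigma> i \<noteq> i \<and> \<sigma> (\<sigma> i) = i)"

definition planar_pairing :: "nat \<Rightarrow> (nat \<Rightarrow> nat) \<Rightarrow> bool" where
  "planar_pairing n \<sigma> \<longleftrightarrow> is_pairing n \<sigma> \<and>
     \<not> (\<exists>a\<in>{1..2*n}. \<exists>b\<in>{1..2*n}. \<exists>c\<in>{1..2*n}. \<exists>d\<in>{1..2*n}.
          a < b \<and> b < c \<and> c < d \<and> \<sigma> a = c \<and> \<sigma> b = d)"

datatype rgb = Red | Green | Blue

text \<open>Cyclic intervals of \<open>1, \<dots>, N\<close>, including the empty one.\<close>

definition cyclic_interval :: "nat \<Rightarrow> nat set \<Rightarrow> bool" where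
  "cyclic_interval N S \<longleftrightarrow> (\<exists>a len. S = (\<lambda>k. (a + k) mod N + 1) ` {..<len})"

definition contiguously_colored :: "nat \<Rightarrow> (nat \<Rightarrow> rgb) \<Rightarrow> bool" where
  "contiguously_colored n color \<longleftrightarrow> (\<forall>x. cyclic_interval (2*n) {i \<in> {1..2*n}. color i = x})"

end

theory Submission
  imports Defs "HOL-Combinatorics.Cycles"
begin

text \<open>Write \<open>z(A)\<close> for the weighted count of dimer covers of the graph obtained from \<open>BW\<close> by
  toggling the nodes in \<open>A\<close>. For \<open>A \<subseteq> S\<close>, superposing covers shows that \<open>z(A) z(S - A)\<close> is the total
  weight of the double-dimer configurations with node set \<open>S\<close> whose pairing is compatible with \<open>A\<close>;
  each loop can be split in two ways and each path in at most one. As the pairings are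
  planar, letting \<open>A\<close> range over pairs \<open>{i, j}\<close> yields a condensation recursion, and by it \<open>z(A)/z({})\<close> is the
  Pfaffian-like sum of \<open>(-1)^crossings\<close> times products of the \<open>X(i, j)\<close>. When \<open>S\<close> consists of all nodes,
  chords inside \<open>A\<close> cross chords outside \<open>A\<close> an even number of times, so
  \<open>z(A) z(S - A)/z({})^2\<close> is the sum of \<open>(-1)^crossings\<close> times monomials over all odd-even
  pairings that preserve \<open>A\<close>, and also the sum of the normalized configuration weights over all planar
  pairings that preserve \<open>A\<close>. The two sums therefore agree after inserting any factor
  \<open>\<Prod> (a r * b s + c r * d s)\<close> over the chords. Choosing plane vectors for the three colours whose
  brackets \<open>[v i, v j]\<close> with \<open>i < j\<close> are 1 for different and 0 for equal colours turns the first sum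
  into the determinant, up to a sign, and leaves only the pairing \<open>\<sigma>\<close> in the second.\<close>

section \<open>Superposed matchings\<close>

text \<open>Planarity enters through a single fact: two connections between nodes whose ends
  interlace must merge into one component. Everything after it is combinatorial. The identities for
  \<open>z(A) z(S - A)\<close> do not isolate single pairings; they only sort pairings by the sets
  \<open>A\<close> that they preserve. This is why the inserted factor is a sum of two products: in
  the expansion, a term is fixed by the set \<open>I\<close> of rows that take
  \<open>a r * b s\<close> and by the image \<open>J\<close> of \<open>I\<close> in the columns, and
  \<open>(I, J)\<close> is exactly such a set \<open>A\<close>. The obstacle is that the indicator
  of different colours has rank three in general, not two. Its antisymmetric version has rank two,
  at the price of a factor \<open>-1\<close> for every chord whose even node comes first. The
  product of these factors turns out to be the sign of the permutation times its crossing sign, and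
  so the crossing signs of the expansion become the signs of a determinant. On planar pairings the
  crossing sign is 1; the sign of \<sigma> that is left over is cancelled by the order of the
  columns.\<close>

lemma joined_refl: "joined G M u u" by (simp add: joined_def)

lemma joined_trans: "joined G M u v \<Longrightarrow> joined G M v w \<Longrightarrow> joined G M u w"
  by (auto simp: joined_def)

lemma joined_sym: "joined G M u v \<Longrightarrow> joined G M v u"
proof -
  have "sym {(x, y). \<exists>e\<in>#M. ends G e = {x, y}}" by (auto simp: sym_def insert_commute)
  then show "joined G M u v \<Longrightarrow> joined G M v u"
    unfolding joined_def by (meson sym_rtrancl symD)
qed

definition deg :: "('v, 'e) noded_graph \<Rightarrow> 'e multiset \<Rightarrow> 'v \<Rightarrow> nat" where
  "deg G M v = size {#e \<in># M. v \<in> ends G e#}"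

definition matching :: "('v, 'e) noded_graph \<Rightarrow> 'e set \<Rightarrow> bool" where
  "matching G D \<longleftrightarrow> D \<subseteq> edges G \<and> (\<forall>e\<in>D. \<forall>f\<in>D. ends G e \<inter> ends G f \<noteq> {} \<longrightarrow> e = f)"

definition covered :: "('v, 'e) noded_graph \<Rightarrow> 'e set \<Rightarrow> 'v set" where
  "covered G D = (\<Union>e\<in>D. ends G e)"

text \<open>Orients every edge of \<open>D\<close> from black to white and every edge of
  \<open>E\<close> from white to black. Each vertex then has at most one outgoing and one incoming
  arrow, so the components of the superposition become directed paths and cycles; a doubled edge
  becomes a 2-cycle.\<close>

definition alt_step :: "('v, 'e) noded_graph \<Rightarrow> 'e set \<Rightarrow> 'e set \<Rightarrow> ('v \<times> 'v) set" where
  "alt_step G D E = {(x, y). (\<exists>e\<in>D. ends G e = {x, y} \<and> black G x \<and> \<not> black G y) \<or>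
                             (\<exists>e\<in>E. ends G e = {x, y} \<and> \<not> black G x \<and> black G y)}"

definition flip :: "('v, 'e) noded_graph \<Rightarrow> 'v set \<Rightarrow> 'e set \<Rightarrow> 'e set \<Rightarrow> 'e set" where
  "flip G C D E = {e\<in>D. ends G e \<inter> C = {}} \<union> {e\<in>E. ends G e \<subseteq> C}"

lemma dimer_covers_eq: "dimer_covers G U = {D. matching G D \<and> covered G D = U}"
proof (intro equalityI subsetI)
  fix D assume "D \<in> dimer_covers G U"
  then show "D \<in> {D. matching G D \<and> covered G D = U}"
    unfolding dimer_covers_def matching_def covered_def by blast
next
  fix D assume "D \<in> {D. matching G D \<and> covered G D = U}"
  then show "D \<in> dimer_covers G U"
    unfolding dimer_covers_def matching_def covered_def by blast
qed

locale bipartite_graph =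
  fixes G :: "('v, 'e) noded_graph"
  assumes finE: "finite (edges G)" and finV: "finite (verts G)"
    and bip: "e \<in> edges G \<Longrightarrow>
      \<exists>b\<in>verts G. \<exists>w\<in>verts G. ends G e = {b, w} \<and> black G b \<and> \<not> black G w"
begin

lemma edgeE:
  assumes "e \<in> edges G"
  obtains b w where "ends G e = {b, w}" "black G b" "\<not> black G w" "b \<in> verts G" "w \<in> verts G"
  using bip[OF assms] by blast

lemma finite_matching: "matching G D \<Longrightarrow> finite D"
  using finE finite_subset unfolding matching_def by blast

lemma matching_edges: "matching G D \<Longrightarrow> e \<in> D \<Longrightarrow> e \<in> edges G"
  unfolding matching_def by blast

lemma matching_unique:
  "matching G D \<Longrightarrow> e \<in> D \<Longrightarrow> f \<in> D \<Longrightarrow> v \<in> ends G e \<Longrightarrow> v \<in> ends G f \<Longrightarrow> e = f"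
  unfolding matching_def by blast

lemma covered_verts: "matching G D \<Longrightarrow> covered G D \<subseteq> verts G"
  unfolding covered_def by (auto dest!: matching_edges elim!: edgeE)

lemma deg_matching:
  assumes "matching G D"
  shows "deg G (mset_set D) v = of_bool (v \<in> covered G D)"
proof (cases "v \<in> covered G D")
  case True
  then obtain e where e: "e \<in> D" "v \<in> ends G e" by (auto simp: covered_def)
  then have "{f \<in> D. v \<in> ends G f} = {e}" using matching_unique[OF assms] by blast
  then show ?thesis using True assms by (simp add: deg_def finite_matching)
next
  case False
  then have *: "{f \<in> D. v \<in> ends G f} = {}" by (auto simp: covered_def)
  show ?thesis unfolding deg_def using False assms * by (simp add: finite_matching)
qed

lemma deg_plus: "deg G (M + N) v = deg G M v + deg G N v"
  by (simp add: deg_def)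

lemma deg_two_matchings:
  assumes "matching G D" "matching G E"
  shows "deg G (mset_set D + mset_set E) v = of_bool (v \<in> covered G D) + of_bool (v \<in> covered G E)"
  using assms by (simp add: deg_plus deg_matching)

text \<open>Exchanging the matchings reverses all arrows, which turns each statement about outgoing
  arrows into one about incoming arrows.\<close>

lemma alt_step_converse: "alt_step G E D = (alt_step G D E)\<inverse>"
  unfolding alt_step_def by (auto simp: insert_commute)

lemma alt_step_functional:
  assumes "matching G D" "matching G E" "(x, y) \<in> alt_step G D E" "(x, z) \<in> alt_step G D E"
  shows "y = z"
proof -
  have *: "y = z" if "matching G F" "e \<in> F" "f \<in> F" "ends G e = {x, y}" "ends G f = {x, z}" for F e f
  proof -
    have "e = f" using that matching_unique[of F e f x] by auto
    then show ?thesis using that by (auto simp: doubleton_eq_iff)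
  qed
  show ?thesis using assms(3,4) *[OF assms(1)] *[OF assms(2)] unfolding alt_step_def by blast
qed

lemma alt_step_injective:
  assumes "matching G D" "matching G E" "(y, x) \<in> alt_step G D E" "(z, x) \<in> alt_step G D E"
  shows "y = z"
  using alt_step_functional[OF assms(2,1), of x y z] assms(3,4) alt_step_converse[of E D] by simp

lemma Domain_alt_step:
  assumes "matching G D" "matching G E"
  shows "x \<in> Domain (alt_step G D E) \<longleftrightarrow> (if black G x then x \<in> covered G D else x \<in> covered G E)"
proof -
  have *: "(\<exists>y. ends G e = {x, y} \<and> black G x \<noteq> black G y) \<longleftrightarrow> x \<in> ends G e" if "e \<in> edges G" for e
    using that by (elim edgeE) (auto simp: doubleton_eq_iff)
  have "x \<in> Domain (alt_step G D E) \<longleftrightarrow>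
      (\<exists>e\<in>D. \<exists>y. ends G e = {x, y} \<and> black G x \<noteq> black G y) \<and> black G x \<or>
      (\<exists>e\<in>E. \<exists>y. ends G e = {x, y} \<and> black G x \<noteq> black G y) \<and> \<not> black G x"
    unfolding alt_step_def by auto
  then show ?thesis
    using *[OF matching_edges[OF assms(1)]] *[OF matching_edges[OF assms(2)]]
    unfolding covered_def by auto
qed

lemma Range_alt_step:
  assumes "matching G D" "matching G E"
  shows "x \<in> Range (alt_step G D E) \<longleftrightarrow> (if black G x then x \<in> covered G E else x \<in> covered G D)"
  using Domain_alt_step[OF assms(2,1), of x] alt_step_converse[of E D] by simp

lemma joined_alt_step:
  assumes "matching G D" "matching G E"
  shows "joined G (mset_set D + mset_set E) x y \<longleftrightarrow> (x, y) \<in> (alt_step G D E \<union> (alt_step G D E)\<inverse>)\<^sup>*"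
proof -
  have fin: "finite D" "finite E" using assms finite_matching by auto
  have *: "black G x \<noteq> black G y" if "e \<in> D \<union> E" "ends G e = {x, y}" for e x y
  proof -
    have "e \<in> edges G" using that assms matching_edges by blast
    then show ?thesis using that by (elim edgeE) (auto simp: doubleton_eq_iff)
  qed
  have "{(x, y). \<exists>e\<in>#mset_set D + mset_set E. ends G e = {x, y}} = alt_step G D E \<union> (alt_step G D E)\<inverse>"
    (is "?L = ?R")
  proof (intro equalityI subrelI)
    fix x y assume "(x, y) \<in> ?L"
    then obtain e where e: "e \<in> D \<union> E" "ends G e = {x, y}" using fin by auto
    then show "(x, y) \<in> ?R" using *[OF e] unfolding alt_step_def by (auto simp: insert_commute)
  next
    fix x y assume "(x, y) \<in> ?R"
    then show "(x, y) \<in> ?L" using fin unfolding alt_step_def by (auto simp: insert_commute)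
  qed
  then show ?thesis by (simp add: joined_def)
qed

text \<open>Such a \<open>C\<close> is a union of components of \<open>D\<close>, up to vertices
  that \<open>D\<close> misses, so matchings can be exchanged inside it without a clash at its
  border.\<close>

definition edge_closed :: "'e set \<Rightarrow> 'v set \<Rightarrow> bool" where
  "edge_closed D C \<longleftrightarrow> (\<forall>e\<in>D. ends G e \<subseteq> C \<or> ends G e \<inter> C = {})"

lemma ends_nonempty: "e \<in> edges G \<Longrightarrow> ends G e \<noteq> {}"
  by (elim edgeE) auto

lemma flip:
  assumes D: "matching G D" and E: "matching G E" and C: "edge_closed (D \<union> E) C"
  shows matching_flip: "matching G (flip G C D E)"
    and covered_flip: "covered G (flip G C D E) = (covered G D - C) \<union> (covered G E \<inter> C)"
    and mset_flip: "mset_set (flip G C D E) + mset_set (flip G C E D) = mset_set D + mset_set E"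
proof -
  have cl: "ends G e \<subseteq> C \<or> ends G e \<inter> C = {}" if "e \<in> D \<union> E" for e
    using C that unfolding edge_closed_def by blast
  have ne: "ends G e \<noteq> {}" if "e \<in> D \<union> E" for e
    using that D E matching_edges ends_nonempty by blast
  show "matching G (flip G C D E)"
    unfolding matching_def
  proof (intro conjI ballI impI)
    show "flip G C D E \<subseteq> edges G"
      using matching_edges[OF D] matching_edges[OF E] unfolding flip_def by auto
    fix e f assume ef: "e \<in> flip G C D E" "f \<in> flip G C D E" "ends G e \<inter> ends G f \<noteq> {}"
    obtain v where v: "v \<in> ends G e" "v \<in> ends G f" using ef(3) by blast
    then have "e \<in> D \<and> f \<in> D \<or> e \<in> E \<and> f \<in> E"
      using ef(1,2) unfolding flip_def by (cases "v \<in> C") auto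
    then show "e = f" using v matching_unique[OF D] matching_unique[OF E] by metis
  qed
  show "covered G (flip G C D E) = (covered G D - C) \<union> (covered G E \<inter> C)"
    using cl unfolding covered_def flip_def by blast
  have fin: "finite D" "finite E" using D E finite_matching by auto
  then have fin': "finite (flip G C D E)" "finite (flip G C E D)" unfolding flip_def by auto
  show "mset_set (flip G C D E) + mset_set (flip G C E D) = mset_set D + mset_set E"
  proof (rule multiset_eqI)
    fix e
    show "count (mset_set (flip G C D E) + mset_set (flip G C E D)) e = count (mset_set D + mset_set E) e"
      using fin fin' cl[of e] ne[of e] unfolding flip_def by (auto simp: count_mset_set')
  qed
qed

text \<open>The forward orbit of a source is closed backwards as well: predecessors are unique, and
  the source has none. So the orbit is a whole component.\<close>

lemma alt_orbit_closed:
  assumes "matching G D" "matching G E" "t \<notin> Range (alt_step G D E)" "(x, y) \<in> alt_step G D E"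
  shows "(t, x) \<in> (alt_step G D E)\<^sup>* \<longleftrightarrow> (t, y) \<in> (alt_step G D E)\<^sup>*"
proof
  show "(t, x) \<in> (alt_step G D E)\<^sup>* \<Longrightarrow> (t, y) \<in> (alt_step G D E)\<^sup>*"
    using assms(4) by (rule rtrancl_into_rtrancl[rotated])
next
  assume "(t, y) \<in> (alt_step G D E)\<^sup>*"
  then show "(t, x) \<in> (alt_step G D E)\<^sup>*"
  proof (cases rule: rtranclE)
    case base
    then show ?thesis using assms(3,4) by auto
  next
    case (step z)
    then show ?thesis using alt_step_injective[OF assms(1,2,4)] by blast
  qed
qed

lemma alt_orbit_edge_closed:
  assumes "matching G D" "matching G E" "t \<notin> Range (alt_step G D E)"
  shows "edge_closed (D \<union> E) ((alt_step G D E)\<^sup>* `` {t})"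
  unfolding edge_closed_def
proof
  fix e assume e: "e \<in> D \<union> E"
  then have "e \<in> edges G" using assms matching_edges by blast
  then obtain b w where bw: "ends G e = {b, w}" "black G b" "\<not> black G w" by (elim edgeE)
  then have "(b, w) \<in> alt_step G D E \<or> (w, b) \<in> alt_step G D E"
    using e unfolding alt_step_def by (auto simp: insert_commute)
  then show "ends G e \<subseteq> (alt_step G D E)\<^sup>* `` {t} \<or> ends G e \<inter> (alt_step G D E)\<^sup>* `` {t} = {}"
    using alt_orbit_closed[OF assms] bw by auto
qed

text \<open>Both \<open>b\<close> and \<open>w\<close> are sources of the orientation, so the orbit
  of \<open>b\<close> never enters \<open>w\<close>. Exchanging the matchings along it frees
  \<open>b\<close> in the first matching and leaves \<open>w\<close> free there.\<close>

lemma kempe: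
  assumes D: "matching G D" and E: "matching G E"
    and b: "black G b" "b \<notin> covered G E" and w: "\<not> black G w" "w \<notin> covered G D"
  shows "\<exists>D' E'. matching G D' \<and> matching G E' \<and> mset_set D' + mset_set E' = mset_set D + mset_set E \<and>
    b \<notin> covered G D' \<and> w \<notin> covered G D'"
proof -
  define C where "C = (alt_step G D E)\<^sup>* `` {b}"
  have bR: "b \<notin> Range (alt_step G D E)" and wR: "w \<notin> Range (alt_step G D E)"
    using b w Range_alt_step[OF D E] by auto
  have cl: "edge_closed (D \<union> E) C" unfolding C_def by (rule alt_orbit_edge_closed[OF D E bR])
  then have cl': "edge_closed (E \<union> D) C" by (simp add: Un_commute)
  have bC: "b \<in> C" by (simp add: C_def)
  have wC: "w \<notin> C"
  proof
    assume "w \<in> C"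
    then have "(b, w) \<in> (alt_step G D E)\<^sup>*" by (simp add: C_def)
    then show False by (cases rule: rtranclE) (use b w wR in auto)
  qed
  have "b \<notin> covered G (flip G C D E)" "w \<notin> covered G (flip G C D E)"
    using covered_flip[OF D E cl] bC wC b w by auto
  then show ?thesis
    using matching_flip[OF D E cl] matching_flip[OF E D cl'] mset_flip[OF D E cl] by blast
qed

lemma matching_insert:
  assumes D: "matching G D" and e: "e \<in> edges G" "ends G e = {b, w}" and "b \<notin> covered G D" "w \<notin> covered G D"
  shows "matching G (insert e D)" "mset_set (insert e D) = add_mset e (mset_set D)"
proof -
  have d: "ends G e \<inter> ends G f = {}" if "f \<in> D" for f
    using assms that unfolding covered_def by auto
  then show "matching G (insert e D)" using D e unfolding matching_def by blast
  have "e \<notin> D" using d[of e] e by auto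
  then show "mset_set (insert e D) = add_mset e (mset_set D)"
    using finite_matching[OF D] by simp
qed

text \<open>Koenig's edge colouring theorem for degree at most two, with multiplicities. Edges are
  inserted one at a time; when the two ends of the new edge miss different matchings,
  \<open>kempe\<close> makes them miss the same one.\<close>

lemma two_edge_colouring:
  assumes "set_mset M \<subseteq> edges G" "\<And>v. deg G M v \<le> 2"
  shows "\<exists>D E. matching G D \<and> matching G E \<and> mset_set D + mset_set E = M"
  using assms
proof (induction M)
  case empty
  show ?case by (intro exI[of _ "{}"]) (simp add: matching_def)
next
  case (add e M)
  have "deg G M v \<le> 2" for v using add.prems(2)[of v] by (simp add: deg_def split: if_splits)
  then obtain D E where DE: "matching G D" "matching G E" "mset_set D + mset_set E = M"
    using add.IH add.prems(1) by auto
  have eE: "e \<in> edges G" using add.prems(1) by auto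
  then obtain b w where bw: "ends G e = {b, w}" "black G b" "\<not> black G w" by (elim edgeE)
  have one: "v \<notin> covered G D \<or> v \<notin> covered G E" if "v \<in> ends G e" for v
  proof -
    have "deg G M v + 1 \<le> 2" using add.prems(2)[of v] that by (simp add: deg_def)
    then show ?thesis using deg_two_matchings[OF DE(1,2), of v] DE(3) by auto
  qed
  have fin: "\<exists>D E. matching G D \<and> matching G E \<and> mset_set D + mset_set E = add_mset e M"
    if "matching G D'" "matching G E'" "mset_set D' + mset_set E' = M"
      "b \<notin> covered G D'" "w \<notin> covered G D'" for D' E'
    using that matching_insert[OF that(1) eE bw(1) that(4,5)] by (metis union_mset_add_mset_left)
  have DE3: "mset_set E + mset_set D = M" using DE(3) by (simp add: add.commute)
  consider "b \<notin> covered G D" "w \<notin> covered G D" | "b \<notin> covered G E" "w \<notin> covered G E"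
    | "b \<notin> covered G E" "w \<notin> covered G D" | "b \<notin> covered G D" "w \<notin> covered G E"
    using one[of b] one[of w] bw by auto
  then show ?case
  proof cases
    case 1
    then show ?thesis using fin DE by blast
  next
    case 2
    then show ?thesis using fin DE(1,2) DE3 by blast
  next
    case 3
    then show ?thesis using kempe[OF DE(1,2) bw(2) _ bw(3)] fin DE(3) by metis
  next
    case 4
    then show ?thesis using kempe[OF DE(2,1) bw(2) _ bw(3)] fin DE3 by metis
  qed
qed

text \<open>If every vertex of the orbit had a successor, the injective successor map would send the
  finite orbit into itself minus \<open>t\<close>; so the path ends. The end is unique because the
  orientation is deterministic: of two orbit vertices, one is reachable from the other.\<close>

lemma source_partner:
  assumes D: "matching G D" and E: "matching G E" and t: "t \<in> Domain (alt_step G D E)" "t \<notin> Range (alt_step G D E)"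
  defines "J \<equiv> joined G (mset_set D + mset_set E) t"
  shows "\<exists>u. u \<noteq> t \<and> J u \<and> u \<in> Range (alt_step G D E) \<and> u \<notin> Domain (alt_step G D E) \<and>
    (\<forall>x. J x \<longrightarrow> x \<noteq> t \<longrightarrow> x \<in> Range (alt_step G D E) \<and> (x \<notin> Domain (alt_step G D E) \<longrightarrow> x = u))"
proof -
  let ?r = "alt_step G D E"
  define C where "C = ?r\<^sup>* `` {t}"
  have JC: "J x \<longleftrightarrow> x \<in> C" for x
  proof
    assume "J x"
    then have "(t, x) \<in> (?r \<union> ?r\<inverse>)\<^sup>*" unfolding J_def joined_alt_step[OF D E] .
    then show "x \<in> C"
    proof (induction rule: rtrancl_induct)
      case base
      show ?case by (simp add: C_def)
    next
      case (step y z)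
      then show ?case using alt_orbit_closed[OF D E t(2)] unfolding C_def by blast
    qed
  next
    assume "x \<in> C"
    then have "(t, x) \<in> ?r\<^sup>*" by (simp add: C_def)
    then show "J x" unfolding J_def joined_alt_step[OF D E] using in_rtrancl_UnI by metis
  qed
  have rng: "x \<in> Range ?r" if "x \<in> C" "x \<noteq> t" for x
    using that unfolding C_def by (auto elim: rtranclE)
  have finC: "finite C"
  proof (rule finite_subset)
    show "C \<subseteq> insert t (covered G D \<union> covered G E)"
    proof
      fix x assume "x \<in> C"
      then show "x \<in> insert t (covered G D \<union> covered G E)"
        using rng[of x] Range_alt_step[OF D E, of x] by (cases "black G x") auto
    qed
    show "finite (insert t (covered G D \<union> covered G E))"
      using finite_subset[OF covered_verts finV] D E by simp
  qed
  have "\<not> C \<subseteq> Domain ?r"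
  proof
    assume CD: "C \<subseteq> Domain ?r"
    then have "\<forall>x\<in>C. \<exists>y. (x, y) \<in> ?r" by blast
    then obtain f where f: "\<And>x. x \<in> C \<Longrightarrow> (x, f x) \<in> ?r" by metis
    have "f ` C \<subseteq> C - {t}" using f t(2) alt_orbit_closed[OF D E t(2)] unfolding C_def by blast
    moreover have "inj_on f C" using f alt_step_injective[OF D E] by (metis inj_onI)
    moreover have "t \<in> C" by (simp add: C_def)
    ultimately show False using finC
      by (metis card_image card_mono card_Diff1_less finite_Diff not_le)
  qed
  then obtain u where u: "u \<in> C" "u \<notin> Domain ?r" by blast
  have un: "x = u" if "x \<in> C" "x \<notin> Domain ?r" for x
  proof -
    have sv: "single_valued ?r" using alt_step_functional[OF D E] by (auto simp: single_valued_def)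
    have "(x, u) \<in> ?r\<^sup>* \<or> (u, x) \<in> ?r\<^sup>*"
      using single_valued_confluent[OF sv] that u unfolding C_def by blast
    then show ?thesis using that u Not_Domain_rtrancl[of x ?r u] Not_Domain_rtrancl[of u ?r x] by auto
  qed
  show ?thesis
    using u t un rng JC by (intro exI[of _ u]) blast
qed

text \<open>A vertex covered exactly once is a source if
  \<open>black G t \<longleftrightarrow> t \<in> covered G D\<close> and a sink otherwise, and a
  path leads from a source to a sink. The sink case is the source case with the matchings
  exchanged.\<close>

lemma terminal_partner:
  assumes D: "matching G D" and E: "matching G E" and t: "(t \<in> covered G D) \<noteq> (t \<in> covered G E)"
  defines "J \<equiv> joined G (mset_set D + mset_set E) t"
  shows "\<exists>u. u \<noteq> t \<and> J u \<and> (u \<in> covered G D) \<noteq> (u \<in> covered G E) \<and>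
    (black G u \<longleftrightarrow> u \<in> covered G D) \<noteq> (black G t \<longleftrightarrow> t \<in> covered G D) \<and>
    (\<forall>x. J x \<longrightarrow> x \<noteq> t \<longrightarrow> (x \<in> covered G D) \<noteq> (x \<in> covered G E) \<longrightarrow> x = u)"
proof (cases "black G t \<longleftrightarrow> t \<in> covered G D")
  case True
  then have "t \<in> Domain (alt_step G D E)" "t \<notin> Range (alt_step G D E)"
    using t by (auto simp: Range_alt_step[OF D E] Domain_alt_step[OF D E])
  note sp = source_partner[OF D E this]
  from sp obtain u where u: "u \<noteq> t" "J u"
      "u \<in> Range (alt_step G D E)" "u \<notin> Domain (alt_step G D E)"
      "\<And>x. J x \<Longrightarrow> x \<noteq> t \<Longrightarrow> x \<in> Range (alt_step G D E) \<and> (x \<notin> Domain (alt_step G D E) \<longrightarrow> x = u)"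
    unfolding J_def by blast
  have "x = u" if "J x" "x \<noteq> t" "(x \<in> covered G D) \<noteq> (x \<in> covered G E)" for x
    using u(5)[OF that(1,2)] that(3) by (auto simp: Range_alt_step[OF D E] Domain_alt_step[OF D E] split: if_splits)
  moreover have "(u \<in> covered G D) \<noteq> (u \<in> covered G E)" "(black G u \<longleftrightarrow> u \<in> covered G D) = False"
    using u(3,4) by (auto simp: Range_alt_step[OF D E] Domain_alt_step[OF D E] split: if_splits)
  ultimately show ?thesis using u(1,2) True by blast
next
  case False
  then have "t \<in> Domain (alt_step G E D)" "t \<notin> Range (alt_step G E D)"
    using t by (auto simp: Range_alt_step[OF E D] Domain_alt_step[OF E D])
  note sp = source_partner[OF E D this, unfolded add.commute[of "mset_set E"]]
  from sp obtain u where u: "u \<noteq> t" "J u"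
      "u \<in> Range (alt_step G E D)" "u \<notin> Domain (alt_step G E D)"
      "\<And>x. J x \<Longrightarrow> x \<noteq> t \<Longrightarrow> x \<in> Range (alt_step G E D) \<and> (x \<notin> Domain (alt_step G E D) \<longrightarrow> x = u)"
    unfolding J_def by blast
  have "x = u" if "J x" "x \<noteq> t" "(x \<in> covered G D) \<noteq> (x \<in> covered G E)" for x
    using u(5)[OF that(1,2)] that(3) by (auto simp: Range_alt_step[OF E D] Domain_alt_step[OF E D] split: if_splits)
  moreover have "(u \<in> covered G D) \<noteq> (u \<in> covered G E)" "(black G u \<longleftrightarrow> u \<in> covered G D) = True"
    using u(3,4) by (auto simp: Range_alt_step[OF E D] Domain_alt_step[OF E D] split: if_splits)
  ultimately show ?thesis using u(1,2) False by blast
qed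

end

lemma noded_bipartite_graph_imp: "noded_bipartite_graph n G \<Longrightarrow> bipartite_graph G"
  by (simp add: noded_bipartite_graph_def bipartite_graph_def)


section \<open>Planarity of the node pairings\<close>

lemma closed_Un_inside:
  fixes S :: "complex set"
  assumes "closed S" shows "closed (S \<union> inside S)"
  using assms by (simp add: union_with_inside closed_def open_outside)

text \<open>The chord splits the closed disc into two closed regions that meet only along the chord,
  so a connected set avoiding it cannot touch both boundary arcs. Starting the curve at an end of
  the chord makes these arcs the images of \<open>{0..v}\<close> and \<open>{v..1}\<close>.\<close>

lemma based_chord_separates:
  fixes g :: "real \<Rightarrow> complex"
  assumes g: "simple_path g" "pathfinish g = pathstart g"
    and v: "0 < v" "v < 1"
    and c: "arc c" "pathstart c = g 0" "pathfinish c = g v"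
      "path_image c \<inter> path_image g = {g 0, g v}"
      "path_image c \<subseteq> path_image g \<union> inside (path_image g)"
    and K: "connected K" "closed K" "K \<subseteq> path_image g \<union> inside (path_image g)"
      "K \<inter> path_image c = {}"
    and w: "0 < w" "w < v" "g w \<in> K" and w': "v < w'" "w' < 1" "g w' \<in> K"
  shows False
proof -
  define c1 c2 where "c1 = subpath 0 v g" and "c2 = subpath 1 v g"
  have g01: "g 1 = g 0" using g(2) by (simp add: pathfinish_def pathstart_def)
  have inj: "x = y \<or> x = 0 \<and> y = 1 \<or> x = 1 \<and> y = 0"
    if "g x = g y" "x \<in> {0..1}" "y \<in> {0..1}" for x y
    using g(1) that by (auto simp: simple_path_def loop_free_def)
  have im1: "path_image c1 = g ` {0..v}" and im2: "path_image c2 = g ` {v..1}"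
    using v by (auto simp: c1_def c2_def path_image_subpath)
  have ne: "g 0 \<noteq> g v" using inj[of 0 v] v by auto
  have s1: "simple_path c1" unfolding c1_def
    by (rule simple_path_subpath) (use g v in auto)
  have s2: "simple_path c2" unfolding c2_def
    by (rule simple_path_subpath) (use g v in auto)
  have un: "path_image c1 \<union> path_image c2 = path_image g"
    unfolding im1 im2 image_Un[symmetric] unfolding path_image_def
    by (rule arg_cong[where f = "image g"]) (use v in auto)
  have i12: "path_image c1 \<inter> path_image c2 = {g 0, g v}"
  proof (intro equalityI subsetI)
    fix x assume "x \<in> path_image c1 \<inter> path_image c2"
    then obtain a b where ab: "a \<in> {0..v}" "b \<in> {v..1}" "x = g a" "x = g b"
      unfolding im1 im2 by blast
    then have "a = b \<or> a = 0 \<and> b = 1 \<or> a = 1 \<and> b = 0" using inj[of a b] v by auto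
    then show "x \<in> {g 0, g v}" using ab v by auto
  next
    fix x assume "x \<in> {g 0, g v}"
    moreover have "g 0 \<in> g ` {0..v}" "g v \<in> g ` {0..v}" "g v \<in> g ` {v..1}" using v by auto
    moreover have "g 0 \<in> g ` {v..1}" using v by (subst g01[symmetric]) auto
    ultimately show "x \<in> path_image c1 \<inter> path_image c2" unfolding im1 im2 by auto
  qed
  have ends: "g 0 \<in> path_image c" "g v \<in> path_image c" using c(4) by auto
  have e1: "path_image c1 \<inter> path_image c = {g 0, g v}" and e2: "path_image c2 \<inter> path_image c = {g 0, g v}"
    using i12 c(4) un by auto
  have injc: "inj_on c {0..1}" using c(1) by (simp add: arc_def)
  \<comment> \<open>Any interior parameter would do: this point shows that the chord really enters
    the disc, as the splitting theorem for theta curves requires.\<close>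
  have "c (1/2) \<noteq> c 0" "c (1/2) \<noteq> c 1"
    by (simp_all add: inj_on_eq_iff[OF injc])
  then have "c (1/2) \<notin> {g 0, g v}" using c(2,3) unfolding pathstart_def pathfinish_def by simp
  moreover have "c (1/2) \<in> path_image c" by (auto simp: path_image_def)
  ultimately have ne12: "path_image c \<inter> inside (path_image c1 \<union> path_image c2) \<noteq> {}"
    unfolding un using c(4,5) by blast
  let ?I1 = "inside (path_image c1 \<union> path_image c)" and ?I2 = "inside (path_image c2 \<union> path_image c)"
  have I: "?I1 \<inter> ?I2 = {}" "?I1 \<union> ?I2 \<union> (path_image c - {g 0, g v}) = inside (path_image g)"
    using split_inside_simple_closed_curve[OF s1 _ _ s2 _ _ arc_imp_simple_path[OF c(1)] c(2,3) ne i12 e1 e2 ne12]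
    unfolding un by (auto simp: c1_def c2_def g01)
  define C1 C2 where "C1 = (path_image c1 \<union> path_image c) \<union> ?I1"
    and "C2 = (path_image c2 \<union> path_image c) \<union> ?I2"
  have cl: "closed C1" "closed C2" unfolding C1_def C2_def
    using s1 s2 c(1) by (auto intro!: closed_Un_inside closed_Un closed_path_image
        dest: simple_path_imp_path arc_imp_path)
  have no: "inside (path_image g) \<inter> path_image g = {}" by (rule inside_no_overlap)
  have d: "C1 \<inter> C2 \<inter> K = {}"
  proof (rule ccontr)
    assume "C1 \<inter> C2 \<inter> K \<noteq> {}"
    then obtain x where x: "x \<in> C1" "x \<in> C2" "x \<in> K" by blast
    have xc: "x \<notin> path_image c" using x(3) K(4) by blast
    have sub: "?I1 \<subseteq> inside (path_image g)" "?I2 \<subseteq> inside (path_image g)" using I(2) by auto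
    have x1: "x \<in> path_image c1 \<or> x \<in> ?I1" and x2: "x \<in> path_image c2 \<or> x \<in> ?I2"
      using x xc unfolding C1_def C2_def by auto
    show False
    proof (cases "x \<in> path_image g")
      case True
      then have "x \<notin> ?I1" "x \<notin> ?I2" using no sub by blast+
      then have "x \<in> {g 0, g v}" using x1 x2 i12 by blast
      then show False using ends xc by auto
    next
      case False
      then show False using x1 x2 un I(1) by auto
    qed
  qed
  have cov: "K \<subseteq> C1 \<union> C2"
    using K(3) I(2) un unfolding C1_def C2_def by blast
  have "g w \<in> C1 \<inter> K" "g w' \<in> C2 \<inter> K"
    using w w' v unfolding C1_def C2_def im1 im2 by auto
  then show False
    using connected_closedD[OF K(1) d cov cl] by blast
qed

lemma chord_separates:
  fixes g :: "real \<Rightarrow> complex"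
  assumes g: "simple_path g" "pathfinish g = pathstart g"
    and uv: "0 \<le> u" "u < v" "v < 1"
    and c: "arc c" "pathstart c = g u" "pathfinish c = g v"
      "path_image c \<inter> path_image g = {g u, g v}"
      "path_image c \<subseteq> path_image g \<union> inside (path_image g)"
    and K: "connected K" "closed K" "K \<subseteq> path_image g \<union> inside (path_image g)"
      "K \<inter> path_image c = {}"
    and w: "u < w" "w < v" "g w \<in> K" and w': "0 \<le> w'" "w' < u \<or> v < w'" "w' < 1" "g w' \<in> K"
  shows False
proof -
  define h where "h = shiftpath u g"
  have im: "path_image h = path_image g"
    unfolding h_def using g uv by (intro path_image_shiftpath) auto
  have g01: "g 1 = g 0" using g(2) by (simp add: pathfinish_def pathstart_def)
  \<comment> \<open>Shifting by \<open>u\<close> wraps around for points before \<open>u\<close>;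
    \<open>z\<close> is the parameter of \<open>g w'\<close> on the rotated curve.\<close>
  define z where "z = (if v < w' then w' - u else w' + 1 - u)"
  have h0: "h 0 = g u" "h (v - u) = g v" "h (w - u) = g w" 
    using uv w unfolding h_def shiftpath_def by auto
  have hz: "h z = g w'" "v - u < z" "z < 1"
    using uv w' g01 unfolding h_def shiftpath_def z_def by auto
  show False
  proof (rule based_chord_separates[of h "v - u" c K "w - u" z])
    show "simple_path h" "pathfinish h = pathstart h"
      unfolding h_def using g uv by (auto intro!: simple_path_shiftpath simp: pathfinish_shiftpath pathstart_shiftpath)
  qed (use c K w h0 hz uv w' im in auto)
qed

text \<open>A path inside \<open>K\<close> may touch the boundary curve many times and need not be a
  chord. If \<open>K\<close> missed \<open>L\<close>, a piece of the path between the two boundary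
  arcs from \<open>g tb\<close> to \<open>g td\<close>, shortest in parameter length, would yield a
  chord that avoids \<open>L\<close> and separates these two points.\<close>

lemma interlaced_connected_sets_meet:
  fixes g :: "real \<Rightarrow> complex"
  assumes g: "simple_path g" "pathfinish g = pathstart g"
    and t: "0 \<le> ta" "ta < tb" "tb < tc" "tc < td" "td < 1"
    and K: "path_connected K" "K \<subseteq> path_image g \<union> inside (path_image g)" "g ta \<in> K" "g tc \<in> K"
    and L: "connected L" "closed L" "L \<subseteq> path_image g \<union> inside (path_image g)" "g tb \<in> L" "g td \<in> L"
  shows "K \<inter> L \<noteq> {}"
proof
  assume dis: "K \<inter> L = {}"
  have g01: "g 1 = g 0" using g(2) by (simp add: pathfinish_def pathstart_def)
  have inj: "x = y \<or> x = 0 \<and> y = 1 \<or> x = 1 \<and> y = 0"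
    if "g x = g y" "x \<in> {0..1}" "y \<in> {0..1}" for x y
    using g(1) that by (auto simp: simple_path_def loop_free_def)
  obtain p where p: "path p" "path_image p \<subseteq> K" "pathstart p = g ta" "pathfinish p = g tc"
    using K(1,3,4) unfolding path_connected_def by blast
  \<comment> \<open>The two closed boundary arcs between \<open>g tb\<close> and
    \<open>g td\<close>; \<open>A\<close> contains \<open>g ta\<close> and \<open>C\<close> contains
    \<open>g tc\<close>. They share only points of \<open>L\<close>.\<close>
  define A C where "A = g ` ({0..tb} \<union> {td..1})" and "C = g ` {tb..td}"
  have contg: "continuous_on {0..1} g" using g(1) simple_path_imp_path path_def by blast
  have clA: "closed A" "closed C" unfolding A_def C_def
    by (intro compact_imp_closed compact_continuous_image continuous_on_subset[OF contg] compact_Un compact_Icc; use t in auto)+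
  have imAC: "path_image g = A \<union> C" unfolding A_def C_def path_image_def image_Un[symmetric]
    by (rule arg_cong[where f = "image g"]) (use t in auto)
  have AC: "A \<inter> C \<subseteq> L"
  proof
    fix x assume "x \<in> A \<inter> C"
    then obtain a b where "a \<in> {0..tb} \<union> {td..1}" "b \<in> {tb..td}" "x = g a" "x = g b"
      unfolding A_def C_def by blast
    then show "x \<in> L" using inj[of a b] t L by auto
  qed
  have contp: "continuous_on {0..1} p" using p(1) path_def by blast
  define P where "P = ({0..1} \<inter> p -` A) \<times> ({0..1} \<inter> p -` C)"
  have cpt: "compact ({0..1} \<inter> p -` S)" if "closed S" for S
    using continuous_closed_preimage[OF contp closed_atLeastAtMost that]
      bounded_subset[OF bounded_closed_interval[of 0 "1::real"], of "{0..1} \<inter> p -` S"]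
    by (simp add: compact_eq_bounded_closed)
  have "compact P" unfolding P_def by (intro compact_Times cpt clA)
  moreover have "(0, 1) \<in> P"
    using p(3,4) t unfolding P_def A_def C_def by (auto simp: pathstart_def pathfinish_def)
  moreover have "continuous_on P (\<lambda>x. dist (fst x) (snd x))"
    by (intro continuous_intros)
  \<comment> \<open>By minimality no parameter strictly between \<open>s\<close> and
    \<open>r\<close> reaches the boundary curve: it would land on \<open>A\<close> or
    \<open>C\<close> and give a closer pair.\<close>
  ultimately obtain s r where sr: "(s, r) \<in> P" "\<And>y. y \<in> P \<Longrightarrow> dist s r \<le> dist (fst y) (snd y)"
    using continuous_attains_inf[of P "\<lambda>x. dist (fst x) (snd x)"] by (metis empty_iff prod.collapse)
  have inK: "p x \<in> K" if "x \<in> {0..1}" for x using p(2) that by (auto simp: path_image_def)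
  have s: "s \<in> {0..1}" "p s \<in> A" "p s \<in> K" and r: "r \<in> {0..1}" "p r \<in> C" "p r \<in> K"
    using sr(1) inK unfolding P_def by auto
  have ne: "p s \<noteq> p r" using AC dis s r by auto
  have "path (subpath s r p)" using p(1) s r by simp
  then obtain c where c: "arc c" "path_image c \<subseteq> path_image (subpath s r p)" "pathstart c = p s" "pathfinish c = p r"
    using path_contains_arc[of "subpath s r p" "p s" "p r"] ne by auto
  have cK: "path_image c \<subseteq> K"
    using c(2) path_image_subpath_subset[of s r p] s r p by auto
  have cg: "path_image c \<inter> path_image g = {p s, p r}"
  proof (intro equalityI subsetI)
    fix x assume x: "x \<in> path_image c \<inter> path_image g"
    then obtain q where q: "q \<in> closed_segment s r" "x = p q"
      using c(2) by (auto simp: path_image_subpath_gen)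
    have q01: "q \<in> {0..1}" using q(1) s r by (auto simp: closed_segment_eq_real_ivl split: if_splits)
    consider "x \<in> A" | "x \<in> C" using x imAC by auto
    then show "x \<in> {p s, p r}"
    proof cases
      case 1
      then have "(q, r) \<in> P" using q q01 r unfolding P_def by auto
      then have "q = s" using sr(2)[of "(q, r)"] q(1)
        by (auto simp: closed_segment_eq_real_ivl dist_real_def split: if_splits)
      then show ?thesis using q by simp
    next
      case 2
      then have "(s, q) \<in> P" using q q01 s unfolding P_def by auto
      then have "q = r" using sr(2)[of "(s, q)"] q(1)
        by (auto simp: closed_segment_eq_real_ivl dist_real_def split: if_splits)
      then show ?thesis using q by simp
    qed
  next
    fix x assume "x \<in> {p s, p r}"
    then show "x \<in> path_image c \<inter> path_image g"
      using c(3,4) s r imAC pathstart_in_path_image[of c] pathfinish_in_path_image[of c] by auto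
  qed
  have Lc: "L \<inter> path_image c = {}" using dis cK by blast
  have cin: "path_image c \<subseteq> path_image g \<union> inside (path_image g)" using cK K(2) by blast
  obtain v where v: "v \<in> {tb..td}" "p r = g v" using r unfolding C_def by auto
  have v': "tb < v" "v < td" using v r L dis by (auto simp: order.order_iff_strict)
  from s(2)[unfolded A_def] obtain u0 where u0: "p s = g u0" "u0 \<in> {0..tb} \<union> {td..1}"
    by (rule imageE)
  \<comment> \<open>The end of the curve is renamed to its start, since chords are described by
    parameters below 1.\<close>
  define u where "u = (if u0 = 1 then 0 else u0)"
  have u: "u \<in> {0..tb} \<union> {td..<1}" "p s = g u" using u0 g01 t unfolding u_def by auto
  have ne2: "u \<noteq> tb" "u \<noteq> td" using u s L dis by auto
  consider "0 \<le> u" "u < tb" | "td < u" "u < 1" using u ne2 by auto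
  then show False
  proof cases
    case 1
    show False
      by (rule chord_separates[OF g _ _ _ c(1) _ _ _ cin L(1,2,3) Lc, of u v tb td])
        (use 1 v v' u t c cg L in auto)
  next
    case 2
    show False
      by (rule chord_separates[OF g, of v u "reversepath c" L td tb])
        (use 2 v v' u t c cg L cin Lc in \<open>auto simp: arc_reversepath\<close>)
  qed
qed

text \<open>The drawing of a component of \<open>M\<close> is closed and path connected, and
  different components have disjoint drawings. If the pairs \<open>a, c\<close> and
  \<open>b, d\<close> lay in different components, this would contradict
  \<open>interlaced_connected_sets_meet\<close>.\<close>

lemma joined_noncrossing:
  assumes G: "noded_bipartite_graph n G" and pe: "plane_embedding G pos crv"
    and cc: "nodes_counterclockwise n G pos crv"
    and M: "set_mset M \<subseteq> edges G"
    and abcd: "1 \<le> a" "a < b" "b < c" "c < d" "d \<le> 2*n"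
    and ac: "joined G M (node G a) (node G c)" and bd: "joined G M (node G b) (node G d)"
  shows "joined G M (node G a) (node G b)"
proof (rule ccontr)
  assume nj: "\<not> ?thesis"
  interpret bipartite_graph G using G by (rule noded_bipartite_graph_imp)
  obtain g t where g: "simple_path g" "pathfinish g = pathstart g"
    and dr: "drawing G pos crv \<subseteq> path_image g \<union> inside (path_image g)"
    and st: "strict_mono_on {1..2*n} t"
    and t: "\<forall>i\<in>{1..2*n}. 0 \<le> t i \<and> t i < 1 \<and> g (t i) = pos (node G i)"
    using cc unfolding nodes_counterclockwise_def by blast
  have nv: "node G i \<in> verts G" if "i \<in> {1..2*n}" for i
    using G that by (auto simp: noded_bipartite_graph_def nodes_def)
  define Ed where "Ed u = {e. e \<in># M \<and> (\<exists>v\<in>ends G e. joined G M u v)}" for u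
  \<comment> \<open>The point \<open>pos u\<close> is added because a vertex that no edge of
    \<open>M\<close> meets is still a component.\<close>
  define K where "K u = {pos u} \<union> (\<Union>e\<in>Ed u. path_image (crv e))" for u
  have finE: "finite (Ed u)" for u unfolding Ed_def by auto
  have EdE: "Ed u \<subseteq> edges G" for u using M by (auto simp: Ed_def)
  have arc: "arc (crv e)" if "e \<in> edges G" for e using pe that by (auto simp: plane_embedding_def)
  have cl: "closed (K u)" for u unfolding K_def
    using finE EdE arc by (intro closed_Un closed_UN) (auto intro!: closed_path_image arc_imp_path)
  have img: "pos ` ends G e \<subseteq> path_image (crv e)" if "e \<in> edges G" for e
    using pe that unfolding plane_embedding_def by blast
  have edge_pc: "path_connected (path_image (crv e))" if "e \<in> edges G" for e
    using arc[OF that] by (simp add: arc_imp_path path_connected_path_image)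
  have edge_joined: "joined G M x y" if "e \<in># M" "x \<in> ends G e" "y \<in> ends G e" for e x y
  proof -
    have "e \<in> edges G" using that M by auto
    then obtain p q where "ends G e = {p, q}" by (elim edgeE)
    then have "(x, y) \<in> {(x, y). \<exists>e\<in>#M. ends G e = {x, y}} \<or> x = y"
      using that by (auto simp: insert_commute)
    then show ?thesis unfolding joined_def by auto
  qed
  have reach: "path_component (K u) (pos u) (pos v)" if "joined G M u v" for u v
    using that unfolding joined_def
  proof (induction rule: rtrancl_induct)
    case base
    then show ?case by (simp add: K_def path_component_refl)
  next
    case (step y z)
    then obtain e where e: "e \<in># M" "ends G e = {y, z}" by auto
    have eE: "e \<in> edges G" using e M by auto
    have "e \<in> Ed u" using e step(1) unfolding Ed_def joined_def by auto
    then have sub: "path_image (crv e) \<subseteq> K u" unfolding K_def by auto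
    have "path_component (path_image (crv e)) (pos y) (pos z)"
      using edge_pc[OF eE] img[OF eE] e(2) by (auto simp: path_connected_component)
    then have "path_component (K u) (pos y) (pos z)" using sub path_component_of_subset by blast
    with step.IH show ?case by (rule path_component_trans)
  qed
  have pc: "path_connected (K u)" for u
  proof -
    have *: "path_component (K u) (pos u) x" if "x \<in> K u" for x
    proof (cases "x = pos u")
      case True
      then show ?thesis by (simp add: K_def path_component_refl)
    next
      case False
      then obtain e where e: "e \<in> Ed u" "x \<in> path_image (crv e)" using \<open>x \<in> K u\<close> False unfolding K_def by blast
      then obtain v where v: "v \<in> ends G e" "joined G M u v" by (auto simp: Ed_def)
      have eE: "e \<in> edges G" using e EdE by auto
      have sub: "path_image (crv e) \<subseteq> K u" using e unfolding K_def by auto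
      have "path_component (path_image (crv e)) (pos v) x"
        using edge_pc[OF eE] img[OF eE] v e by (auto simp: path_connected_component)
      then have "path_component (K u) (pos v) x" using sub path_component_of_subset by blast
      with reach[OF v(2)] show ?thesis by (rule path_component_trans)
    qed
    then show ?thesis unfolding path_connected_component by (meson path_component_sym path_component_trans)
  qed
  have Kd: "K u \<subseteq> drawing G pos crv" if "u \<in> verts G" for u
    using that EdE unfolding K_def drawing_def by blast
  have Kdis: "K u \<inter> K v = {}" if uv: "u \<in> verts G" "v \<in> verts G" "\<not> joined G M u v" for u v
  proof (rule ccontr)
    have inj: "inj_on pos (verts G)" using pe by (simp add: plane_embedding_def)
    have endsV: "ends G e \<subseteq> verts G" if "e \<in> edges G" for e
      using that by (elim edgeE) auto
    have pv: "w \<in> ends G e" if "e \<in> edges G" "w \<in> verts G" "pos w \<in> path_image (crv e)" for e w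
    proof -
      have "path_image (crv e) \<inter> pos ` verts G = pos ` ends G e"
        using pe that(1) unfolding plane_embedding_def by blast
      then have "pos w \<in> pos ` ends G e" using that by auto
      then show ?thesis using inj endsV[OF that(1)] that(2) by (meson inj_on_image_mem_iff)
    qed
    have Ed_joined: "joined G M u x" if "e \<in> Ed u" "x \<in> ends G e" for u e x
      using that edge_joined unfolding Ed_def by (blast intro: joined_trans)
    assume "K u \<inter> K v \<noteq> {}"
    then obtain x where "x \<in> K u \<inter> K v" by (elim ex_in_conv[THEN iffD2, THEN exE])
    then have x: "x = pos u \<or> (\<exists>e\<in>Ed u. x \<in> path_image (crv e))"
      "x = pos v \<or> (\<exists>e\<in>Ed v. x \<in> path_image (crv e))"
      unfolding K_def by auto
    consider "x = pos u" "x = pos v" | e where "x = pos u" "e \<in> Ed v" "x \<in> path_image (crv e)"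
      | e where "x = pos v" "e \<in> Ed u" "x \<in> path_image (crv e)"
      | e f where "e \<in> Ed u" "f \<in> Ed v" "x \<in> path_image (crv e)" "x \<in> path_image (crv f)"
      using x by metis
    then show False
    proof cases
      case 1
      then have "u = v" using inj uv by (auto dest: inj_onD)
      then show ?thesis using uv joined_refl by metis
    next
      case 2
      then have "u \<in> ends G e" using pv uv EdE by blast
      then show ?thesis using Ed_joined[OF 2(2)] uv joined_sym by metis
    next
      case 3
      then have "v \<in> ends G e" using pv uv EdE by blast
      then show ?thesis using Ed_joined[OF 3(2)] uv by metis
    next
      case 4
      have "\<exists>w. w \<in> ends G e \<and> w \<in> ends G f"
      proof (cases "e = f")
        case True
        obtain w where "w \<in> ends G e" using 4(1) Ed_def by auto
        then show ?thesis using True by auto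
      next
        case False
        have "path_image (crv e) \<inter> path_image (crv f) = pos ` (ends G e \<inter> ends G f)"
          using pe 4 EdE False unfolding plane_embedding_def by blast
        then show ?thesis using 4 by blast
      qed
      then show ?thesis using Ed_joined[OF 4(1)] Ed_joined[OF 4(2)] uv joined_sym joined_trans by metis
    qed
  qed
  have gK: "g (t c) \<in> K (node G a)" "g (t d) \<in> K (node G b)"
    using reach[OF ac] reach[OF bd] t abcd by (auto dest: path_component_mem)
  have gK': "g (t a) \<in> K (node G a)" "g (t b) \<in> K (node G b)"
    using t abcd by (auto simp: K_def)
  have va: "node G a \<in> verts G" "node G b \<in> verts G" using nv abcd by auto
  have con: "connected (K u)" for u using pc path_connected_imp_connected by blast
  have "K (node G a) \<inter> K (node G b) \<noteq> {}"
    by (rule interlaced_connected_sets_meet[OF g, of "t a" "t b" "t c" "t d"])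
      (use t abcd strict_mono_onD[OF st] pc con cl gK gK' Kd[OF va(1)] Kd[OF va(2)] dr in \<open>auto intro: order.trans\<close>)
  then show False using Kdis va nj by blast
qed


section \<open>Loops and the number of decompositions\<close>

text \<open>A vertex of a cycle lies on the edge at its own index and on the cyclically preceding
  one; these differ because a cycle has at least two edges, all distinct.\<close>

lemma cycle_edge_neighbour:
  assumes "is_cycle G C" "e \<in> C" "v \<in> ends G e"
  shows "\<exists>f\<in>C. f \<noteq> e \<and> v \<in> ends G f"
proof -
  obtain vs es where c: "length vs = length es" "length es \<ge> 2" "distinct es" "set es = C"
      "\<And>k. k < length es \<Longrightarrow> ends G (es ! k) = {vs ! k, vs ! (Suc k mod length es)}"
    using assms(1) unfolding is_cycle_def by blast
  obtain k where k: "k < length es" "e = es ! k" using assms(2) c(4) by (metis in_set_conv_nth)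
  have "v = vs ! k \<or> v = vs ! (Suc k mod length es)" using assms(3) c(5)[OF k(1)] k(2) by auto
  then show ?thesis
  proof
    assume v: "v = vs ! k"
    define j where "j = (if k = 0 then length es - 1 else k - 1)"
    have j: "j < length es" "j \<noteq> k" "Suc j mod length es = k"
      using k c(2) by (auto simp: j_def mod_Suc)
    then have "es ! j \<noteq> e" "v \<in> ends G (es ! j)" using k c(3) c(5)[OF j(1)] v by (auto simp: nth_eq_iff_index_eq)
    then show ?thesis using j(1) c(4) by (metis nth_mem)
  next
    assume v: "v = vs ! (Suc k mod length es)"
    define j where "j = Suc k mod length es"
    have j: "j < length es" "j \<noteq> k"
      using k c(2) by (auto simp: j_def mod_Suc)
    then have "es ! j \<noteq> e" "v \<in> ends G (es ! j)" using k c(3) c(5)[OF j(1)] v by (auto simp: nth_eq_iff_index_eq j_def)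
    then show ?thesis using j(1) c(4) by (metis nth_mem)
  qed
qed

text \<open>Two different edges at \<open>v\<close> already use up its degree, so nothing else fits
  there, not even a second copy of one of them.\<close>

lemma deg_two_exhausted:
  assumes "deg G M v \<le> 2" "e \<in># M" "f \<in># M" "e \<noteq> f" "v \<in> ends G e" "v \<in> ends G f"
  shows "count M e = 1" "g \<in># M \<Longrightarrow> v \<in> ends G g \<Longrightarrow> g = e \<or> g = f"
proof -
  define N where "N = {#x \<in># M. v \<in> ends G x#}"
  have "count {#e, f#} x \<le> count N x" for x
  proof -
    have "count N e \<ge> 1" "count N f \<ge> 1" using assms unfolding N_def by (auto simp: Suc_le_eq)
    then show ?thesis using assms(4) by auto
  qed
  then have "{#e, f#} \<subseteq># N" by (simp add: subseteq_mset_def)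
  moreover have "size N \<le> 2" using assms(1) by (simp add: N_def deg_def)
  ultimately have N: "N = {#e, f#}"
    using mset_subset_size[of "{#e, f#}" N] by (cases "N = {#e, f#}") (auto simp: subset_mset_def)
  have "count M e = count N e" using assms(5) by (simp add: N_def)
  then show "count M e = 1" using N assms(4) by simp
  show "g \<in># M \<Longrightarrow> v \<in> ends G g \<Longrightarrow> g = e \<or> g = f"
  proof -
    assume "g \<in># M" "v \<in> ends G g"
    then have "g \<in># N" by (simp add: N_def)
    then show ?thesis using N by auto
  qed
qed

text \<open>With degrees at most two a loop is an entire component of \<open>M\<close>, made of
  simple edges. This is what lets each loop be split independently of the rest.\<close>

lemma loop_closed:
  assumes "C \<in> loops G M" "\<And>v. deg G M v \<le> 2" "e \<in> C" "v \<in> ends G e"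
  shows "g \<in># M \<Longrightarrow> v \<in> ends G g \<Longrightarrow> g \<in> C" "count M e = 1" "\<exists>f\<in>C. f \<noteq> e \<and> v \<in> ends G f"
proof -
  have c: "is_cycle G C" "C \<subseteq> set_mset M" using assms(1) by (auto simp: loops_def)
  show "\<exists>f\<in>C. f \<noteq> e \<and> v \<in> ends G f" using cycle_edge_neighbour[OF c(1) assms(3,4)] .
  then obtain f where f: "f \<in> C" "f \<noteq> e" "v \<in> ends G f" by blast
  show "count M e = 1"
    by (rule deg_two_exhausted(1)[OF assms(2), of e f v]) (use f c assms in auto)
  show "g \<in># M \<Longrightarrow> v \<in> ends G g \<Longrightarrow> g \<in> C"
    using deg_two_exhausted(2)[OF assms(2)[of v], of e f g] f c assms by blast
qed

text \<open>Walking along \<open>C\<close> from the common edge, each next edge shares a vertex with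
  an edge already in \<open>C'\<close>, and \<open>loop_closed\<close> pulls it into
  \<open>C'\<close>.\<close>

lemma loop_subset:
  assumes "C \<in> loops G M" "C' \<in> loops G M" "\<And>v. deg G M v \<le> 2" "e \<in> C" "e \<in> C'"
  shows "C \<subseteq> C'"
proof -
  have CM: "C \<subseteq> set_mset M" using assms(1) by (simp add: loops_def)
  obtain vs es where c: "length es \<ge> 2" "set es = C"
      "\<And>k. k < length es \<Longrightarrow> ends G (es ! k) = {vs ! k, vs ! (Suc k mod length es)}"
    using assms(1) unfolding is_cycle_def loops_def by blast
  define m where "m = length es"
  have m: "m > 0" using c(1) by (auto simp: m_def)
  obtain k where k: "k < m" "e = es ! k" using assms(4) c(2) by (metis in_set_conv_nth m_def)
  have *: "es ! ((k + i) mod m) \<in> C'" for i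
  proof (induction i)
    case 0
    then show ?case using k assms(5) by simp
  next
    case (Suc i)
    define a where "a = (k + i) mod m"
    have a: "a < m" "(k + Suc i) mod m = Suc a mod m" "Suc a mod m < m"
      using m by (auto simp: a_def mod_Suc_eq)
    have "vs ! (Suc a mod m) \<in> ends G (es ! a)" "vs ! (Suc a mod m) \<in> ends G (es ! (Suc a mod m))"
      using c(3)[of a] c(3)[of "Suc a mod m"] a unfolding m_def by auto
    moreover have "es ! (Suc a mod m) \<in># M" using CM c(2) a(3) unfolding m_def by (meson nth_mem subsetD)
    moreover have "es ! a \<in> C'" using Suc by (simp add: a_def)
    ultimately have "es ! (Suc a mod m) \<in> C'" using loop_closed(1)[OF assms(2,3)] by blast
    then show ?case using a(2) by simp
  qed
  show ?thesis
  proof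
    fix x assume "x \<in> C"
    then obtain j where j: "j < m" "x = es ! j" using c(2) by (metis in_set_conv_nth m_def)
    \<comment> \<open>Adding a full turn \<open>m\<close> keeps the offset nonnegative when
      \<open>j < k\<close>.\<close>
    have "(k + (j + m - k)) mod m = j" using j k by simp
    then show "x \<in> C'" using *[of "j + m - k"] j by simp
  qed
qed

lemma loop_eq:
  assumes "C \<in> loops G M" "C' \<in> loops G M" "\<And>v. deg G M v \<le> 2" "e \<in> C" "e \<in> C'"
  shows "C = C'"
  using loop_subset[OF assms] loop_subset[OF assms(2,1,3,5,4)] by blast

lemma finite_loops: "finite (loops G M)"
  by (rule finite_subset[of _ "Pow (set_mset M)"]) (auto simp: loops_def)

lemma loop_nonempty: "C \<in> loops G M \<Longrightarrow> C \<noteq> {}"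
  by (auto simp: loops_def is_cycle_def)

section \<open>Counting the decompositions of a configuration into two matchings\<close>

context bipartite_graph begin

text \<open>Leaving black vertices along \<open>A\<close> and white vertices along \<open>B\<close>
  permutes the finite set of covered vertices, because arrows are injective. The orbit of a suitable
  end of \<open>e\<close> under this permutation is the cycle.\<close>

lemma alternating_cycle:
  assumes A: "matching G A" and B: "matching G B" and dis: "A \<inter> B = {}"
    and cov: "covered G A = covered G B" and e: "e \<in> A \<union> B"
  shows "\<exists>C. is_cycle G C \<and> e \<in> C \<and> C \<subseteq> A \<union> B"
proof -
  define V where "V = covered G A"
  have finV: "finite V" unfolding V_def using finite_subset[OF covered_verts[OF A] finV] .
  have V2: "ends G f \<subseteq> V" if "f \<in> A \<union> B" for f using that cov unfolding V_def covered_def by blast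
  have "\<exists>f w. f \<in> (if black G v then A else B) \<and> ends G f = {v, w} \<and> black G w \<noteq> black G v \<and> w \<in> V"
    if "v \<in> V" for v
  proof -
    have "v \<in> covered G (if black G v then A else B)" using that cov V_def by simp
    then obtain f where f: "f \<in> (if black G v then A else B)" "v \<in> ends G f" by (auto simp: covered_def)
    then have fE: "f \<in> A \<union> B" by (auto split: if_splits)
    then have "f \<in> edges G" using A B matching_edges by blast
    then obtain w where "ends G f = {v, w}" "black G w \<noteq> black G v"
      using f(2) by (elim edgeE) (auto simp: insert_commute)
    then show ?thesis using f V2[OF fE] by blast
  qed
  then obtain ed nx where en: "\<And>v. v \<in> V \<Longrightarrow> ed v \<in> (if black G v then A else B)"
      "\<And>v. v \<in> V \<Longrightarrow> ends G (ed v) = {v, nx v}" "\<And>v. v \<in> V \<Longrightarrow> black G (nx v) \<noteq> black G v"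
      "\<And>v. v \<in> V \<Longrightarrow> nx v \<in> V"
    by metis
  have edAB: "ed v \<in> A \<union> B" if "v \<in> V" for v using en(1)[OF that] by (auto split: if_splits)
  have step: "(v, nx v) \<in> alt_step G A B" if "v \<in> V" for v
    using en[OF that] unfolding alt_step_def by (auto split: if_splits)
  have inj: "inj_on nx V"
    using alt_step_injective[OF A B step] step by (metis inj_onI)
  have bij: "bij_betw nx V V"
    using inj endo_inj_surj[OF finV image_subsetI[OF en(4)] inj] by (simp add: bij_betw_def)
  define p where "p v = (if v \<in> V then nx v else v)" for v
  have "p permutes V"
    by (rule bij_imp_permutes) (use bij in \<open>auto simp: p_def cong: bij_betw_cong\<close>)
  then have perm: "permutation p" using finV permutation_permutes by blast
  obtain v0 where v0: "v0 \<in> V" "ed v0 = e"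
  proof -
    have "e \<in> edges G" using e A B matching_edges by blast
    then obtain b w where bw: "ends G e = {b, w}" "black G b" "\<not> black G w" by (elim edgeE)
    \<comment> \<open>The end from which \<open>e\<close> is the outgoing edge.\<close>
    define v where "v = (if e \<in> A then b else w)"
    have v: "v \<in> V" "v \<in> ends G e" "black G v \<longleftrightarrow> e \<in> A" using bw V2[OF e] by (auto simp: v_def)
    have "v \<in> ends G (ed v)" using en(2)[OF v(1)] by auto
    then have "ed v = e" using en(1)[OF v(1)] v e matching_unique[OF A] matching_unique[OF B]
      by (metis UnE)
    then show ?thesis using that v(1) by blast
  qed
  define m where "m = least_power p v0"
  have m: "(p ^^ m) v0 = v0" unfolding m_def using least_power_of_permutation(1)[OF perm] .
  \<comment> \<open>A vertex and its successor have different colours, so the permutation has no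
    fixed point on \<open>V\<close>.\<close>
  have m2: "m \<ge> 2"
    using least_power_gt_one[OF perm, of v0] v0 en(3)[OF v0(1)] by (fastforce simp: m_def p_def)
  define vs where "vs = support p v0"
  define es where "es = map ed vs"
  have inV: "(p ^^ i) v0 \<in> V" for i by (induction i) (use v0 en(4) in \<open>auto simp: p_def\<close>)
  have dvs: "distinct vs" unfolding vs_def using cycle_of_permutation[OF perm] .
  have len: "length vs = m" "length es = m" by (auto simp: vs_def es_def m_def)
  have nthv: "vs ! k = (p ^^ k) v0" if "k < m" for k using that by (simp add: vs_def m_def)
  have svs: "set vs \<subseteq> V" using inV by (auto simp: vs_def)
  \<comment> \<open>As \<open>A\<close> and \<open>B\<close> are disjoint, an edge is never the
    outgoing edge of both its ends.\<close>
  have "inj_on ed V"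
  proof (rule inj_onI)
    fix x y assume xy: "x \<in> V" "y \<in> V" "ed x = ed y"
    have "black G x = black G y" using en(1)[OF xy(1)] en(1)[OF xy(2)] xy(3) dis by (auto split: if_splits)
    then show "x = y" using en(2,3)[OF xy(1)] en(2,3)[OF xy(2)] xy(3) by (auto simp: doubleton_eq_iff)
  qed
  then have des: "distinct es" unfolding es_def using dvs svs by (simp add: distinct_map inj_on_subset)
  have "ends G (es ! k) = {vs ! k, vs ! (Suc k mod m)}" if k: "k < m" for k
  proof -
    have "vs ! (Suc k mod m) = (p ^^ Suc k) v0"
    proof (cases "Suc k = m")
      case True
      then have "vs ! (Suc k mod m) = vs ! 0" by simp
      also have "\<dots> = (p ^^ m) v0" using nthv[of 0] m2 m by simp
      finally show ?thesis using True by simp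
    next
      case False
      then show ?thesis using nthv[of "Suc k"] k by simp
    qed
    also have "\<dots> = nx (vs ! k)" using inV[of k] nthv[OF k] by (simp add: p_def)
    finally show ?thesis using en(2)[OF inV[of k]] nthv[OF k] len k by (simp add: es_def)
  qed
  moreover have "set es \<subseteq> edges G"
    using edAB svs matching_edges[OF A] matching_edges[OF B] unfolding es_def by auto
  ultimately have "is_cycle G (set es)"
    unfolding is_cycle_def using len m2 dvs des by (intro conjI exI[of _ vs] exI[of _ es]) auto
  moreover have "v0 \<in> set vs" using nthv[of 0] m2 len by (metis funpow_0 nth_mem not_numeral_le_zero not_gr_zero)
  then have "e \<in> set es" using v0 by (auto simp: es_def)
  moreover have "set es \<subseteq> A \<union> B" using edAB svs by (auto simp: es_def)
  ultimately show ?thesis by blast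
qed

lemma matching_subset: "matching G D \<Longrightarrow> A \<subseteq> D \<Longrightarrow> matching G A"
  unfolding matching_def by (meson subset_iff)

lemma mset_matchings_mem:
  "matching G D \<Longrightarrow> matching G E \<Longrightarrow> e \<in># mset_set D + mset_set E \<longleftrightarrow> e \<in> D \<union> E"
  using finite_matching by auto

text \<open>The decompositions correspond to the sets of loops. Two first matchings that cover the
  same vertices differ by alternating cycles, which are loops of \<open>M\<close>. Conversely,
  exchanging the matchings on any set of loops keeps the covered sets, since both matchings cover
  every vertex of a loop. Paths and doubled edges admit no change.\<close>

lemma card_decompositions:
  assumes D: "matching G D" and E: "matching G E"
  defines "M \<equiv> mset_set D + mset_set E"
  shows "card {(D', E'). matching G D' \<and> matching G E' \<and> covered G D' = covered G D \<and>
      covered G E' = covered G E \<and> mset_set D' + mset_set E' = M} = 2 ^ card (loops G M)"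
    (is "card ?P = _")
proof -
  have fin: "finite D" "finite E" using D E finite_matching by auto
  have deg2: "deg G M v \<le> 2" for v unfolding M_def by (simp add: deg_two_matchings[OF D E])
  have memM: "e \<in># M \<longleftrightarrow> e \<in> D \<union> E" for e unfolding M_def using mset_matchings_mem[OF D E] .
  have loopsD: "e \<in> D \<union> E" if "C \<in> loops G M" "e \<in> C" for C e
    using that memM by (auto simp: loops_def)
  define f where "f L = (sym_diff D (\<Union>L), sym_diff E (\<Union>L))" for L
  have flips: "flip G (covered G (\<Union>L)) D E = sym_diff D (\<Union>L)"
      "flip G (covered G (\<Union>L)) E D = sym_diff E (\<Union>L)"
      "edge_closed (D \<union> E) (covered G (\<Union>L))"
      "covered G (\<Union>L) \<subseteq> covered G D" "covered G (\<Union>L) \<subseteq> covered G E"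
    if L: "L \<subseteq> loops G M" for L
  proof -
    let ?F = "\<Union>L" and ?C = "covered G (\<Union>L)"
    have cl: "g \<in> ?F" if "g \<in> D \<union> E" "v \<in> ends G g" "v \<in> ?C" for g v
      using that L loop_closed(1)[OF _ deg2] memM unfolding covered_def by blast
    have FC: "ends G g \<subseteq> ?C" if "g \<in> ?F" for g using that unfolding covered_def by blast
    have FDE: "?F \<subseteq> D \<union> E" using L loopsD by blast
    have ne: "ends G g \<noteq> {}" if "g \<in> D \<union> E" for g using that D E matching_edges ends_nonempty by blast
    show ec: "edge_closed (D \<union> E) ?C" unfolding edge_closed_def using cl FC by blast
    have sub: "ends G g \<subseteq> ?C \<longleftrightarrow> g \<in> ?F" "ends G g \<inter> ?C = {} \<longleftrightarrow> g \<notin> ?F" if "g \<in> D \<union> E" for g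
      using cl FC ne[OF that] that by blast+
    \<comment> \<open>Edges of a loop are simple, so exchanging the matchings on loops is the same
      as taking symmetric differences.\<close>
    have one: "\<not> (g \<in> D \<and> g \<in> E)" if gF: "g \<in> ?F" for g
    proof
      assume "g \<in> D \<and> g \<in> E"
      then have "count M g = 2" using fin by (simp add: M_def)
      moreover obtain C where "C \<in> loops G M" "g \<in> C" using gF L by blast
      moreover obtain v where "v \<in> ends G g" using ne[of g] gF FDE by blast
      ultimately show False using loop_closed(2)[OF _ deg2] by fastforce
    qed
    have FDE': "g \<in> D \<union> E" if "g \<in> ?F" for g using FDE that by blast
    have "g \<in> flip G ?C D E \<longleftrightarrow> g \<in> sym_diff D ?F" "g \<in> flip G ?C E D \<longleftrightarrow> g \<in> sym_diff E ?F" for g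
      using sub[of g] one[of g] FDE'[of g] unfolding flip_def
      by (cases "g \<in> D \<union> E"; cases "g \<in> ?F"; simp; blast)+
    then show "flip G ?C D E = sym_diff D ?F" "flip G ?C E D = sym_diff E ?F" by blast+
    have "v \<in> covered G D \<and> v \<in> covered G E" if vC: "v \<in> ?C" for v
    proof -
      obtain C e where e: "C \<in> loops G M" "e \<in> C" "v \<in> ends G e" using vC L unfolding covered_def by blast
      obtain e' where e': "e' \<in> C" "e' \<noteq> e" "v \<in> ends G e'" using loop_closed(3)[OF e(1) deg2 e(2,3)] by blast
      have "e \<in> D \<union> E" "e' \<in> D \<union> E" using loopsD e e' by auto
      then show ?thesis using e(3) e'(2,3) matching_unique[OF D] matching_unique[OF E]
        unfolding covered_def by blast
    qed
    then show "?C \<subseteq> covered G D" "?C \<subseteq> covered G E" by auto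
  qed
  have "bij_betw f (Pow (loops G M)) ?P"
    unfolding bij_betw_def
  proof (intro conjI)
    show "inj_on f (Pow (loops G M))"
    proof (rule inj_onI)
      fix L L' assume LL: "L \<in> Pow (loops G M)" "L' \<in> Pow (loops G M)" "f L = f L'"
      then have u: "\<Union>L = \<Union>L'" unfolding f_def by blast
      have "X \<subseteq> Y" if XY: "X \<subseteq> loops G M" "Y \<subseteq> loops G M" "\<Union>X = \<Union>Y" for X Y
      proof
        fix C assume C: "C \<in> X"
        then obtain e where e: "e \<in> C" using XY(1) loop_nonempty by blast
        then obtain C' where C': "C' \<in> Y" "e \<in> C'" using XY(3) C by blast
        then have "C = C'" using loop_eq[OF _ _ deg2 e C'(2)] XY C by blast
        then show "C \<in> Y" using C' by simp
      qed
      then show "L = L'" using LL u by (metis PowD subset_antisym)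
    qed
    show "f ` Pow (loops G M) = ?P"
    proof (intro equalityI subsetI)
      fix x assume "x \<in> f ` Pow (loops G M)"
      then obtain L where L: "L \<subseteq> loops G M" "x = f L" by blast
      note fl = flips[OF L(1)]
      have ec: "edge_closed (E \<union> D) (covered G (\<Union>L))" using fl(3) by (simp add: Un_commute)
      show "x \<in> ?P"
        using matching_flip[OF D E fl(3)] matching_flip[OF E D ec] covered_flip[OF D E fl(3)]
          covered_flip[OF E D ec] mset_flip[OF D E fl(3)] fl(4,5)
        unfolding L(2) f_def fl(1,2) M_def by blast
    next
      fix x assume "x \<in> ?P"
      then obtain D' E' where x: "x = (D', E')" "matching G D'" "matching G E'" "covered G D' = covered G D"
          "covered G E' = covered G E" "mset_set D' + mset_set E' = M" by blast
      define F where "F = sym_diff D D'"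
      have mA: "matching G (D - D')" "matching G (D' - D)" using matching_subset D x(2) by blast+
      have cA: "covered G (D - D') = covered G (D' - D)"
      proof -
        have "covered G (A - B) \<subseteq> covered G (B - A)"
          if "matching G A" "matching G B" "covered G A = covered G B" for A B
        proof
          fix v assume "v \<in> covered G (A - B)"
          then obtain e where e: "e \<in> A" "e \<notin> B" "v \<in> ends G e" by (auto simp: covered_def)
          then have "v \<in> covered G B" using that(3) by (auto simp: covered_def)
          then obtain f where f: "f \<in> B" "v \<in> ends G f" by (auto simp: covered_def)
          then have "f \<notin> A" using matching_unique[OF that(1) e(1) _ e(3) f(2)] e(2) by auto
          then show "v \<in> covered G (B - A)" using f by (auto simp: covered_def)
        qed
        then show ?thesis using D x(2,4) by (metis subset_antisym)
      qed
      have DM': "D' \<subseteq> set_mset M" using x(6) mset_matchings_mem[OF x(2,3)] by auto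
      have FM: "F \<subseteq> set_mset M" using DM' memM unfolding F_def by auto
      define L where "L = {C \<in> loops G M. C \<subseteq> F}"
      have UL: "\<Union>L = F"
      proof (intro equalityI subsetI)
        fix e assume "e \<in> F"
        then obtain C where "is_cycle G C" "e \<in> C" "C \<subseteq> F"
          using alternating_cycle[OF mA _ cA, of e] unfolding F_def by blast
        then show "e \<in> \<Union>L" using FM unfolding L_def loops_def by blast
      qed (auto simp: L_def)
      have L: "L \<subseteq> loops G M" by (auto simp: L_def)
      have fD: "sym_diff D (\<Union>L) = D'" unfolding UL F_def by blast
      note fl = flips[OF L]
      have "mset_set D' + mset_set (sym_diff E (\<Union>L)) = M"
        using mset_flip[OF D E fl(3)] unfolding fl(1,2) fD M_def .
      then have "mset_set (sym_diff E (\<Union>L)) = mset_set E'" using x(6) by (metis add_left_cancel)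
      moreover have "finite (sym_diff E (\<Union>L))"
        using fin FM finite_subset[OF _ finite_set_mset] unfolding UL by blast
      ultimately have "sym_diff E (\<Union>L) = E'"
        using finite_matching[OF x(3)] by (metis finite_set_mset_mset_set)
      then have "x = f L" unfolding f_def fD x(1) by simp
      then show "x \<in> f ` Pow (loops G M)" using L by blast
    qed
  qed
  then have "card ?P = card (Pow (loops G M))" by (simp add: bij_betw_same_card)
  then show ?thesis by (simp add: card_Pow finite_loops)
qed

end


section \<open>Products of dimer partition functions\<close>

text \<open>Only the sum of the two indicators enters, so different pairs \<open>U\<close>,
  \<open>V\<close> can share their configurations; what distinguishes them is left to
  \<open>compatible\<close>.\<close>

definition configs :: "('v, 'e) noded_graph \<Rightarrow> 'v set \<Rightarrow> 'v set \<Rightarrow> 'e multiset set" where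
  "configs G U V = {M. set_mset M \<subseteq> edges G \<and>
     (\<forall>v\<in>verts G. deg G M v = of_bool (v \<in> U) + of_bool (v \<in> V))}"

text \<open>In a decomposition covering \<open>U\<close> and \<open>V\<close>, a path end
  \<open>u\<close> is a source of the alternating orientation iff
  \<open>black G u \<longleftrightarrow> u \<in> U\<close>. So the condition asks each path to have
  one source and one sink.\<close>

definition compatible :: "('v, 'e) noded_graph \<Rightarrow> 'v set \<Rightarrow> 'v set \<Rightarrow> 'e multiset \<Rightarrow> bool" where
  "compatible G U V M \<longleftrightarrow> (\<forall>u\<in>sym_diff U V. \<forall>v\<in>sym_diff U V. u \<noteq> v \<longrightarrow> joined G M u v \<longrightarrow>
     (black G u \<longleftrightarrow> u \<in> U) \<noteq> (black G v \<longleftrightarrow> v \<in> U))"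

context bipartite_graph begin

lemma edge_ends_verts: "e \<in> edges G \<Longrightarrow> ends G e \<subseteq> verts G"
  by (elim edgeE) auto

lemma deg_outside: "set_mset M \<subseteq> edges G \<Longrightarrow> v \<notin> verts G \<Longrightarrow> deg G M v = 0"
  using edge_ends_verts unfolding deg_def by (fastforce simp: filter_mset_eq_conv)

lemma configs_decomposition:
  assumes "M \<in> configs G U V" "U \<subseteq> verts G" "V \<subseteq> verts G"
  obtains D E where "matching G D" "matching G E" "mset_set D + mset_set E = M"
    "\<And>v. of_bool (v \<in> covered G D) + of_bool (v \<in> covered G E) = (of_bool (v \<in> U) + of_bool (v \<in> V) :: nat)"
proof -
  have ME: "set_mset M \<subseteq> edges G" using assms(1) by (simp add: configs_def)
  have dg: "deg G M v = of_bool (v \<in> U) + of_bool (v \<in> V)" for v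
  proof (cases "v \<in> verts G")
    case True
    then show ?thesis using assms(1) by (simp add: configs_def)
  next
    case False
    then have "v \<notin> U" "v \<notin> V" using assms(2,3) by auto
    then show ?thesis using deg_outside[OF ME False] by simp
  qed
  then have "deg G M v \<le> 2" for v by simp
  then obtain D E where DE: "matching G D" "matching G E" "mset_set D + mset_set E = M"
    using two_edge_colouring[OF ME] by blast
  show ?thesis
    by (rule that[OF DE]) (use deg_two_matchings[OF DE(1,2)] DE(3) dg in metis)
qed

lemma configs_partner:
  assumes "M \<in> configs G U V" "U \<subseteq> verts G" "V \<subseteq> verts G" and t: "t \<in> sym_diff U V"
  shows "\<exists>!u. u \<in> sym_diff U V \<and> u \<noteq> t \<and> joined G M t u"
proof -
  obtain D E where DE: "matching G D" "matching G E" "mset_set D + mset_set E = M"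
    "\<And>v. of_bool (v \<in> covered G D) + of_bool (v \<in> covered G E) = (of_bool (v \<in> U) + of_bool (v \<in> V) :: nat)"
    using configs_decomposition[OF assms(1-3)] by blast
  have T: "v \<in> sym_diff U V \<longleftrightarrow> (v \<in> covered G D) \<noteq> (v \<in> covered G E)" for v
    using DE(4)[of v] by (auto simp: of_bool_def split: if_splits)
  have "(t \<in> covered G D) \<noteq> (t \<in> covered G E)" using t T by blast
  from terminal_partner[OF DE(1,2) this] show ?thesis
    unfolding T DE(3) by blast
qed

lemma compatible_if_decomposition:
  assumes "matching G D" "matching G E"
  shows "compatible G (covered G D) (covered G E) (mset_set D + mset_set E)"
  unfolding compatible_def
proof (intro ballI impI)
  fix u v assume u: "u \<in> sym_diff (covered G D) (covered G E)" and v: "v \<in> sym_diff (covered G D) (covered G E)"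
    and uv: "u \<noteq> v" "joined G (mset_set D + mset_set E) u v"
  have "(u \<in> covered G D) \<noteq> (u \<in> covered G E)" using u by blast
  from terminal_partner[OF assms this] obtain w where
    w: "(black G w \<longleftrightarrow> w \<in> covered G D) \<noteq> (black G u \<longleftrightarrow> u \<in> covered G D)"
      "\<And>x. joined G (mset_set D + mset_set E) u x \<Longrightarrow> x \<noteq> u \<Longrightarrow> (x \<in> covered G D) \<noteq> (x \<in> covered G E) \<Longrightarrow> x = w"
    by blast
  have "v = w" using w(2)[OF uv(2)] uv(1) v by blast
  then show "(black G u \<longleftrightarrow> u \<in> covered G D) \<noteq> (black G v \<longleftrightarrow> v \<in> covered G D)" using w(1) by blast
qed

text \<open>Start from any decomposition. Both it and the target are compatible with the paths, so
  the two ends of a path are either both covered as wanted or both wrongly; exchanging the matchings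
  on the components with wrong ends repairs everything at once.\<close>

lemma decomposition_if_compatible:
  assumes M: "M \<in> configs G U V" and U: "U \<subseteq> verts G" and V: "V \<subseteq> verts G" and comp: "compatible G U V M"
  shows "\<exists>D E. matching G D \<and> matching G E \<and> covered G D = U \<and> covered G E = V \<and> mset_set D + mset_set E = M"
proof -
  obtain D E where DE: "matching G D" "matching G E" "mset_set D + mset_set E = M"
    and cov: "\<And>v. of_bool (v \<in> covered G D) + of_bool (v \<in> covered G E) = (of_bool (v \<in> U) + of_bool (v \<in> V) :: nat)"
    using configs_decomposition[OF M U V] by blast
  have T: "v \<in> sym_diff U V \<longleftrightarrow> (v \<in> covered G D) \<noteq> (v \<in> covered G E)" for v
    using cov[of v] by (auto simp: of_bool_def split: if_splits)
  have nT: "(v \<in> covered G D \<longleftrightarrow> v \<in> U) \<and> (v \<in> covered G E \<longleftrightarrow> v \<in> V) \<and> (v \<in> U \<longleftrightarrow> v \<in> V)"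
    if "v \<notin> sym_diff U V" for v
    using cov[of v] that by (auto simp: of_bool_def split: if_splits)
  have comp0: "compatible G (covered G D) (covered G E) M"
    using compatible_if_decomposition[OF DE(1,2)] DE(3) by simp
  \<comment> \<open>The path ends at which the decomposition is wrong; \<open>C\<close> collects
    their components.\<close>
  define B where "B = {v \<in> sym_diff U V. (v \<in> covered G D) \<noteq> (v \<in> U)}"
  define C where "C = {x. \<exists>v\<in>B. joined G M v x}"
  have CB: "v \<in> B" if v: "v \<in> sym_diff U V" "v \<in> C" for v
  proof -
    obtain u where u: "u \<in> B" "joined G M u v" using v(2) C_def by blast
    have uT: "u \<in> sym_diff U V" using u B_def by blast
    show ?thesis
    proof (cases "u = v")
      case False
      have "(black G u \<longleftrightarrow> u \<in> U) \<noteq> (black G v \<longleftrightarrow> v \<in> U)"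
        using comp uT v(1) False u(2) unfolding compatible_def by blast
      moreover have "(black G u \<longleftrightarrow> u \<in> covered G D) \<noteq> (black G v \<longleftrightarrow> v \<in> covered G D)"
      proof -
        have "u \<in> sym_diff (covered G D) (covered G E)" "v \<in> sym_diff (covered G D) (covered G E)"
          using T uT v(1) by blast+
        then show ?thesis using comp0 False u(2) unfolding compatible_def by blast
      qed
      moreover have "(u \<in> covered G D) \<noteq> (u \<in> U)" using u(1) B_def by blast
      ultimately show ?thesis using v(1) unfolding B_def by blast
    qed (use u in simp)
  qed
  have BC: "v \<in> C" if "v \<in> B" for v using that unfolding C_def by (auto intro: joined_refl)
  have ec: "edge_closed (D \<union> E) C"
    unfolding edge_closed_def
  proof
    fix e assume e: "e \<in> D \<union> E"
    then have eM: "e \<in># M" using mset_matchings_mem[OF DE(1,2)] DE(3) by auto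
    have "e \<in> edges G" using e DE matching_edges by blast
    then obtain b w where bw: "ends G e = {b, w}" by (elim edgeE)
    have "joined G M b w" unfolding joined_def using eM bw by auto
    then have "b \<in> C \<longleftrightarrow> w \<in> C" unfolding C_def mem_Collect_eq by (metis joined_trans joined_sym)
    then show "ends G e \<subseteq> C \<or> ends G e \<inter> C = {}" using bw by auto
  qed
  then have ec': "edge_closed (E \<union> D) C" by (simp add: Un_commute)
  have "v \<in> covered G D - C \<union> covered G E \<inter> C \<longleftrightarrow> v \<in> U" "v \<in> covered G E - C \<union> covered G D \<inter> C \<longleftrightarrow> v \<in> V" for v
  proof -
    consider "v \<notin> sym_diff U V" | "v \<in> sym_diff U V" "v \<in> B" | "v \<in> sym_diff U V" "v \<notin> B" by blast
    then have "(v \<in> covered G D - C \<union> covered G E \<inter> C \<longleftrightarrow> v \<in> U) \<and> (v \<in> covered G E - C \<union> covered G D \<inter> C \<longleftrightarrow> v \<in> V)"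
    proof cases
      case 1
      then show ?thesis using nT by blast
    next
      case 2
      then have "v \<in> C" "(v \<in> covered G D) \<noteq> (v \<in> U)" "(v \<in> covered G D) \<noteq> (v \<in> covered G E)" "(v \<in> U) \<noteq> (v \<in> V)"
        using BC B_def T by blast+
      then show ?thesis by blast
    next
      case 3
      then have "v \<notin> C" "(v \<in> covered G D) = (v \<in> U)" "(v \<in> covered G D) \<noteq> (v \<in> covered G E)" "(v \<in> U) \<noteq> (v \<in> V)"
        using CB B_def T by blast+
      then show ?thesis by blast
    qed
    then show "v \<in> covered G D - C \<union> covered G E \<inter> C \<longleftrightarrow> v \<in> U" "v \<in> covered G E - C \<union> covered G D \<inter> C \<longleftrightarrow> v \<in> V" by auto
  qed
  then have "covered G (flip G C D E) = U" "covered G (flip G C E D) = V"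
    unfolding covered_flip[OF DE(1,2) ec] covered_flip[OF DE(2,1) ec'] by blast+
  then show ?thesis
    using matching_flip[OF DE(1,2) ec] matching_flip[OF DE(2,1) ec'] mset_flip[OF DE(1,2) ec] DE(3) by blast
qed

lemma card_cover_pairs:
  assumes M: "M \<in> configs G U V" and U: "U \<subseteq> verts G" and V: "V \<subseteq> verts G"
  shows "card {x \<in> dimer_covers G U \<times> dimer_covers G V. mset_set (fst x) + mset_set (snd x) = M} =
    (if compatible G U V M then 2 ^ card (loops G M) else 0)"
proof (cases "compatible G U V M")
  case True
  then obtain D E where DE: "matching G D" "matching G E" "covered G D = U" "covered G E = V" "mset_set D + mset_set E = M"
    using decomposition_if_compatible[OF M U V] by blast
  have "{x \<in> dimer_covers G U \<times> dimer_covers G V. mset_set (fst x) + mset_set (snd x) = M} =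
    {(D', E'). matching G D' \<and> matching G E' \<and> covered G D' = covered G D \<and>
      covered G E' = covered G E \<and> mset_set D' + mset_set E' = mset_set D + mset_set E}"
    unfolding dimer_covers_eq DE(3-5) by auto
  then show ?thesis using True card_decompositions[OF DE(1,2)] DE(5) by simp
next
  case False
  then have "{x \<in> dimer_covers G U \<times> dimer_covers G V. mset_set (fst x) + mset_set (snd x) = M} = {}"
    unfolding dimer_covers_eq using compatible_if_decomposition by fastforce
  then show ?thesis using False by (metis card.empty)
qed

lemma finite_configs:
  assumes "U \<subseteq> verts G" "V \<subseteq> verts G"
  shows "finite (configs G U V)"
proof (rule finite_subset)
  show "configs G U V \<subseteq> (\<lambda>(D, E). mset_set D + mset_set E) ` (Pow (edges G) \<times> Pow (edges G))"
  proof
    fix M assume "M \<in> configs G U V"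
    then obtain D E where "matching G D" "matching G E" "mset_set D + mset_set E = M"
      using configs_decomposition[OF _ assms] by metis
    then show "M \<in> (\<lambda>(D, E). mset_set D + mset_set E) ` (Pow (edges G) \<times> Pow (edges G))"
      unfolding matching_def by force
  qed
qed (use finE in auto)

lemma finite_dimer_covers: "finite (dimer_covers G U)"
  by (rule finite_subset[of _ "Pow (edges G)"]) (use finE in \<open>auto simp: dimer_covers_def\<close>)

text \<open>Pairs of covers are grouped by their superposition. The size of a group is the factor
  \<open>2 ^ card (loops G M)\<close> of the configuration weight, or 0.\<close>

lemma Z_mult:
  assumes U: "U \<subseteq> verts G" and V: "V \<subseteq> verts G"
  shows "Z G U * Z G V = (\<Sum>M | M \<in> configs G U V \<and> compatible G U V M. config_weight G M)"
proof -
  let ?S = "dimer_covers G U \<times> dimer_covers G V"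
  let ?g = "\<lambda>x. mset_set (fst x) + mset_set (snd x) :: 'e multiset"
  have gc: "?g ` ?S \<subseteq> configs G U V"
  proof
    fix M assume "M \<in> ?g ` ?S"
    then obtain D E where DE: "matching G D" "matching G E" "covered G D = U" "covered G E = V" "M = mset_set D + mset_set E"
      unfolding dimer_covers_eq by auto
    then show "M \<in> configs G U V"
      using deg_two_matchings[OF DE(1,2)] mset_matchings_mem[OF DE(1,2)] matching_edges unfolding configs_def by auto
  qed
  have w: "prod (wt G) (fst x) * prod (wt G) (snd x) = prod_mset (image_mset (wt G) (?g x))" if "x \<in> ?S" for x
    by (simp add: prod_unfold_prod_mset)
  have "Z G U * Z G V = (\<Sum>x\<in>?S. prod (wt G) (fst x) * prod (wt G) (snd x))"
    unfolding Z_def sum_product by (simp add: sum.cartesian_product case_prod_unfold)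
  also have "\<dots> = (\<Sum>M\<in>configs G U V. \<Sum>x | x \<in> ?S \<and> ?g x = M. prod (wt G) (fst x) * prod (wt G) (snd x))"
    by (rule sum.group[symmetric]) (use finite_dimer_covers finite_configs[OF U V] gc in auto)
  also have "\<dots> = (\<Sum>M\<in>configs G U V. \<Sum>x | x \<in> ?S \<and> ?g x = M. prod_mset (image_mset (wt G) M))"
    by (intro sum.cong refl) (use w in auto)
  also have "\<dots> = (\<Sum>M\<in>configs G U V. if compatible G U V M then config_weight G M else 0)"
    using card_cover_pairs[OF _ U V] by (intro sum.cong refl) (auto simp: config_weight_def)
  also have "\<dots> = (\<Sum>M | M \<in> configs G U V \<and> compatible G U V M. config_weight G M)"
    by (simp add: sum.inter_filter[OF finite_configs[OF U V]])
  finally show ?thesis .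
qed

end


section \<open>Noncrossing pairings and condensation\<close>

definition noncrossing_pairing :: "nat set \<Rightarrow> (nat \<Rightarrow> nat) \<Rightarrow> bool" where
  "noncrossing_pairing S \<tau> \<longleftrightarrow> (\<forall>i\<in>S. \<tau> i \<in> S \<and> \<tau> i \<noteq> i \<and> \<tau> (\<tau> i) = i) \<and>
     (\<forall>a\<in>S. \<forall>b\<in>S. a < b \<longrightarrow> b < \<tau> a \<longrightarrow> \<tau> b < \<tau> a)"

text \<open>Symmetric in \<open>i\<close> and \<open>j\<close>; a product over \<open>k\<close> is
  the parity of the number of nodes strictly between them.\<close>

definition between_sign :: "nat \<Rightarrow> nat \<Rightarrow> nat \<Rightarrow> real" where
  "between_sign i j k = (if i < k \<and> k < j \<or> j < k \<and> k < i then -1 else 1)"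

text \<open>The form that \<open>compatible\<close> takes after toggling \<open>A\<close> in
  \<open>BW\<close>: whether a node is a source no longer depends on its being black or white, only
  on \<open>odd i \<longleftrightarrow> i \<notin> A\<close>.\<close>

definition alternates :: "nat set \<Rightarrow> nat set \<Rightarrow> (nat \<Rightarrow> nat) \<Rightarrow> bool" where
  "alternates A S \<tau> \<longleftrightarrow> (\<forall>i\<in>S. (odd i \<longleftrightarrow> i \<notin> A) \<noteq> (odd (\<tau> i) \<longleftrightarrow> \<tau> i \<notin> A))"

lemma noncrossing_pairingD:
  assumes "noncrossing_pairing S \<tau>" "i \<in> S"
  shows "\<tau> i \<in> S" "\<tau> i \<noteq> i" "\<tau> (\<tau> i) = i"
  using assms by (auto simp: noncrossing_pairing_def)

text \<open>The lower bound is the upper bound applied at \<open>\<tau> b\<close>: if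
  \<open>\<tau> b < a\<close>, then \<open>a\<close> would lie inside the chord from
  \<open>\<tau> b\<close> to \<open>b\<close> while \<open>\<tau> a\<close> lies outside.\<close>

lemma noncrossing_pairing_cross:
  assumes "noncrossing_pairing S \<tau>" "a \<in> S" "b \<in> S" "a < b" "b < \<tau> a"
  shows "a < \<tau> b" "\<tau> b < \<tau> a"
proof -
  show *: "\<tau> b < \<tau> a" using assms by (auto simp: noncrossing_pairing_def)
  show "a < \<tau> b"
  proof (rule ccontr)
    assume "\<not> a < \<tau> b"
    moreover have "\<tau> b \<noteq> a" using noncrossing_pairingD(3)[OF assms(1,3)] assms by auto
    ultimately have "\<tau> b < a" by simp
    moreover have "\<tau> b \<in> S" "\<tau> (\<tau> b) = b" using noncrossing_pairingD[OF assms(1,3)] by auto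
    ultimately have "\<tau> a < \<tau> (\<tau> b)" using assms unfolding noncrossing_pairing_def by metis
    then show False using \<open>\<tau> (\<tau> b) = b\<close> assms(5) by simp
  qed
qed

lemma prod_involution:
  fixes f :: "'a \<Rightarrow> 'b :: comm_monoid_mult"
  assumes "finite T" "\<And>k. k \<in> T \<Longrightarrow> \<tau> k \<in> T \<and> \<tau> k \<noteq> k \<and> \<tau> (\<tau> k) = k \<and> f k * f (\<tau> k) = 1"
  shows "prod f T = 1"
  using assms
proof (induction "card T" arbitrary: T rule: less_induct)
  case less
  show ?case
  proof (cases "T = {}")
    case False
    then obtain k where k: "k \<in> T" by blast
    note k' = less.prems(2)[OF k]
    let ?U = "T - {k} - {\<tau> k}"
    have "prod f ?U = 1"
    proof (rule less.hyps)
      show "card ?U < card T" using k less.prems(1) by (meson Diff_subset card_Diff1_less card_mono finite_Diff le_less_trans)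
      fix l assume "l \<in> ?U"
      then have l: "l \<in> T" "l \<noteq> k" "l \<noteq> \<tau> k" by auto
      have "\<tau> l \<noteq> k" "\<tau> l \<noteq> \<tau> k" using less.prems(2)[OF l(1)] k' l by metis+
      then show "\<tau> l \<in> ?U \<and> \<tau> l \<noteq> l \<and> \<tau> (\<tau> l) = l \<and> f l * f (\<tau> l) = 1" using less.prems(2)[OF l(1)] by auto
    qed (use less.prems in auto)
    then show ?thesis
      using k k' less.prems(1) prod.remove[of T k f] prod.remove[of "T - {k}" "\<tau> k" f] by (simp add: mult.assoc[symmetric])
  qed simp
qed

lemma noncrossing_between_sign:
  assumes "noncrossing_pairing S \<tau>" "i \<in> S" "k \<in> S" "k \<noteq> i" "k \<noteq> \<tau> i"
  shows "between_sign i (\<tau> i) (\<tau> k) = between_sign i (\<tau> i) k"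
proof -
  note nc = noncrossing_pairing_cross[OF assms(1)]
  note D = noncrossing_pairingD[OF assms(1)]
  have sub: "(a < \<tau> k \<and> \<tau> k < b)" if "a < k \<and> k < b" "{a, b} = {i, \<tau> i}" "k \<in> S" for a b k
  proof -
    have "a \<in> S" "\<tau> a = b" using that(2) D assms(2) by (auto simp: doubleton_eq_iff)
    then show ?thesis using nc[of a k] that by auto
  qed
  have imp: "i < \<tau> k \<and> \<tau> k < \<tau> i \<or> \<tau> i < \<tau> k \<and> \<tau> k < i"
    if "i < k \<and> k < \<tau> i \<or> \<tau> i < k \<and> k < i" "k \<in> S" for k
    using that(1)
  proof
    assume "i < k \<and> k < \<tau> i"
    then show ?thesis using sub[of i k "\<tau> i"] that(2) by blast
  next
    assume "\<tau> i < k \<and> k < i"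
    then show ?thesis using sub[of "\<tau> i" k i] that(2) by (simp add: insert_commute)
  qed
  have "(i < k \<and> k < \<tau> i \<or> \<tau> i < k \<and> k < i) \<longleftrightarrow> (i < \<tau> k \<and> \<tau> k < \<tau> i \<or> \<tau> i < \<tau> k \<and> \<tau> k < i)"
    using imp[OF _ assms(3)] imp[OF _ D(1)[OF assms(3)]] D(3)[OF assms(3)] by metis
  then show ?thesis unfolding between_sign_def by simp
qed

text \<open>Each other chord lies on one side of the chord at \<open>i\<close>, so its two ends
  contribute equal signs, which cancel.\<close>

lemma noncrossing_prod_between_sign:
  assumes nc: "noncrossing_pairing S \<tau>" and "finite S" and i: "i \<in> S"
  shows "(\<Prod>k\<in>S - {i, \<tau> i}. between_sign i (\<tau> i) k) = 1"
proof (rule prod_involution[where \<tau> = \<tau>])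
  fix k assume k: "k \<in> S - {i, \<tau> i}"
  note D = noncrossing_pairingD[OF nc]
  have "between_sign i (\<tau> i) (\<tau> k) = between_sign i (\<tau> i) k"
    using noncrossing_between_sign[OF nc i] k by auto
  moreover have "\<tau> k \<noteq> i" "\<tau> k \<noteq> \<tau> i" using D[OF i] D[of k] k by auto
  ultimately show "\<tau> k \<in> S - {i, \<tau> i} \<and> \<tau> k \<noteq> k \<and> \<tau> (\<tau> k) = k \<and> between_sign i (\<tau> i) k * between_sign i (\<tau> i) (\<tau> k) = 1"
    using D[of k] k by (auto simp: between_sign_def)
qed (use assms in simp)

text \<open>A further point lies in none or in exactly two of the three intervals spanned by
  \<open>i\<close>, \<open>j\<close>, \<open>\<tau> j\<close>, so its three signs multiply to 1.
  Among the three points themselves only the middle one counts, and this is the \<open>-1\<close>.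
  The third interval belongs to a chord and contributes 1 by
  \<open>noncrossing_prod_between_sign\<close>.\<close>

lemma between_sign_partners:
  assumes nc: "noncrossing_pairing S \<tau>" and fin: "finite S" and i: "i \<in> S" and j: "j \<in> S" "j \<noteq> i" "\<tau> j \<noteq> i"
  shows "(\<Prod>k\<in>S - {i, j}. between_sign i j k) = - (\<Prod>k\<in>S - {i, \<tau> j}. between_sign i (\<tau> j) k)"
proof -
  note D = noncrossing_pairingD[OF nc j(1)]
  let ?T = "S - {i, j, \<tau> j}"
  have T1: "S - {i, j} = insert (\<tau> j) ?T" "S - {i, \<tau> j} = insert j ?T" "S - {j, \<tau> j} = insert i ?T"
    using D i j by auto
  have three: "between_sign i j (\<tau> j) * between_sign i (\<tau> j) j * between_sign j (\<tau> j) i = -1"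
    using D(2) j(2,3) by (cases "i < j"; cases "i < \<tau> j"; cases "j < \<tau> j"; simp add: between_sign_def)
  have pt: "between_sign i j k * between_sign i (\<tau> j) k = between_sign j (\<tau> j) k" if "k \<in> ?T" for k
    using that by (auto simp: between_sign_def)
  have one: "between_sign j (\<tau> j) i * (\<Prod>k\<in>?T. between_sign j (\<tau> j) k) = 1"
    using noncrossing_prod_between_sign[OF nc fin j(1)] unfolding T1(3) using fin by simp
  define p where "p = (\<Prod>k\<in>S - {i, j}. between_sign i j k)"
  define q where "q = (\<Prod>k\<in>S - {i, \<tau> j}. between_sign i (\<tau> j) k)"
  have "p * q = between_sign i j (\<tau> j) * between_sign i (\<tau> j) j * (\<Prod>k\<in>?T. between_sign i j k * between_sign i (\<tau> j) k)"
    unfolding p_def q_def T1 using fin by (simp add: prod.distrib mult_ac)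
  also have "\<dots> = between_sign i j (\<tau> j) * between_sign i (\<tau> j) j * (\<Prod>k\<in>?T. between_sign j (\<tau> j) k)"
    by (simp only: prod.cong[OF refl pt])
  also have "\<dots> = between_sign i j (\<tau> j) * between_sign i (\<tau> j) j * between_sign j (\<tau> j) i"
  proof -
    have "(\<Prod>k\<in>?T. between_sign j (\<tau> j) k) = between_sign j (\<tau> j) i"
    proof -
      have "x = y" if "y * x = 1" "y = 1 \<or> y = -1" for x y :: real using that by auto
      from this[OF one] show ?thesis by (simp add: between_sign_def)
    qed
    then show ?thesis by (simp only:)
  qed
  finally have pq: "p * q = -1" using three by simp
  have "q * q = 1" unfolding q_def prod.distrib[symmetric] by (rule prod.neutral) (auto simp: between_sign_def)
  then have "p = - q" using pq by (metis mult.assoc mult.right_neutral mult_minus_left mult_1)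
  then show ?thesis by (simp add: p_def q_def)
qed

text \<open>Condensation for a single planar pairing. If \<tau> joins odd to even nodes, only
  \<open>j = \<tau> i\<close> survives, with sign 1. Otherwise either no \<open>j\<close> survives
  or exactly the two ends of one chord do, and their terms cancel by
  \<open>between_sign_partners\<close>.\<close>

lemma alternates_expand:
  assumes nc: "noncrossing_pairing S \<tau>" and fin: "finite S" and i: "i \<in> S" "odd i"
  shows "(of_bool (alternates {} S \<tau>) :: real) =
    (\<Sum>j\<in>{j \<in> S. even j}. (\<Prod>k\<in>S - {i, j}. between_sign i j k) * of_bool (alternates {i, j} S \<tau>))"
    (is "_ = (\<Sum>j\<in>?J. ?p j * _)")
proof -
  note D = noncrossing_pairingD[OF nc]
  have finJ: "finite ?J" using fin by simp
  show ?thesis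
  proof (cases "alternates {} S \<tau>")
    case True
    then have alt: "odd k \<noteq> odd (\<tau> k)" if "k \<in> S" for k using that by (auto simp: alternates_def)
    have ti: "\<tau> i \<in> ?J" using alt[OF i(1)] D[OF i(1)] i by auto
    have "alternates {i, j} S \<tau> \<longleftrightarrow> j = \<tau> i" if j: "j \<in> ?J" for j
    proof
      assume a: "alternates {i, j} S \<tau>"
      then have "(odd i \<longleftrightarrow> i \<notin> {i, j}) \<noteq> (odd (\<tau> i) \<longleftrightarrow> \<tau> i \<notin> {i, j})" using i(1) unfolding alternates_def by blast
      then show "j = \<tau> i" using alt[OF i(1)] D(2)[OF i(1)] by auto
    next
      assume j: "j = \<tau> i"
      show "alternates {i, j} S \<tau>"
        unfolding alternates_def
      proof
        fix k assume k: "k \<in> S"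
        have "k \<in> {i, j} \<longleftrightarrow> \<tau> k \<in> {i, j}"
          unfolding j insert_iff empty_iff using D(3)[OF i(1)] D(3)[OF k] by metis
        then show "(odd k \<longleftrightarrow> k \<notin> {i, j}) \<noteq> (odd (\<tau> k) \<longleftrightarrow> \<tau> k \<notin> {i, j})" using alt[OF k] by blast
      qed
    qed
    then have "(\<Sum>j\<in>?J. ?p j * of_bool (alternates {i, j} S \<tau>)) = (\<Sum>j\<in>?J. if j = \<tau> i then ?p j else 0)"
      by (intro sum.cong) auto
    also have "\<dots> = ?p (\<tau> i)" using ti finJ by simp
    also have "\<dots> = 1" by (rule noncrossing_prod_between_sign[OF nc fin i(1)])
    finally show ?thesis using True by simp
  next
    case False
    show ?thesis
    proof (cases "\<exists>j\<in>?J. alternates {i, j} S \<tau>")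
      case ex: True
      then obtain j where j: "j \<in> S" "even j" "alternates {i, j} S \<tau>" by blast
      have altD: "(odd k \<longleftrightarrow> k \<notin> {i, j}) \<noteq> (odd (\<tau> k) \<longleftrightarrow> \<tau> k \<notin> {i, j})" if "k \<in> S" for k
        using j(3) that unfolding alternates_def by blast
      have ji: "j \<noteq> i" using i j by auto
      have jt: "\<tau> j \<noteq> i"
      proof
        assume ti: "\<tau> j = i"
        then have ti': "\<tau> i = j" using D[OF j(1)] by auto
        have "odd k \<noteq> odd (\<tau> k)" if k: "k \<in> S" for k
        proof -
          have "k \<in> {i, j} \<longleftrightarrow> \<tau> k \<in> {i, j}" using ti ti' D[OF k] by auto
          then show ?thesis using altD[OF k] by blast
        qed
        then show False using False by (auto simp: alternates_def)
      qed
      have "\<tau> j \<notin> {i, j}" using jt D(2)[OF j(1)] by simp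
      then have "even (\<tau> j)" using altD[OF j(1)] j(2) by blast
      then have tj: "even (\<tau> j)" "\<tau> j \<in> S" "\<tau> j \<noteq> j" "\<tau> (\<tau> j) = j" using D[OF j(1)] by blast+
      have iff: "alternates {i, l} S \<tau> \<longleftrightarrow> l \<in> {j, \<tau> j}" if l: "l \<in> ?J" for l
      proof
        assume "alternates {i, l} S \<tau>"
        then have "(odd j \<longleftrightarrow> j \<notin> {i, l}) \<noteq> (odd (\<tau> j) \<longleftrightarrow> \<tau> j \<notin> {i, l})" using j(1) unfolding alternates_def by blast
        then show "l \<in> {j, \<tau> j}" using tj j ji jt by auto
      next
        assume "l \<in> {j, \<tau> j}"
        then consider "l = j" | "l = \<tau> j" by blast
        then show "alternates {i, l} S \<tau>"
        proof cases
          case 2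
          show ?thesis
            unfolding alternates_def
          proof
            fix k assume k: "k \<in> S"
            show "(odd k \<longleftrightarrow> k \<notin> {i, l}) \<noteq> (odd (\<tau> k) \<longleftrightarrow> \<tau> k \<notin> {i, l})"
            proof (cases "k \<in> {j, \<tau> j}")
              case True
              then show ?thesis using 2 tj ji jt j(2) by auto
            next
              case kn: False
              then have "\<tau> k \<notin> {j, \<tau> j}" using D[OF k] tj by auto
              then show ?thesis using altD[OF k] kn 2 by auto
            qed
          qed
        qed (use j(3) in simp)
      qed
      have "(\<Sum>l\<in>?J. ?p l * of_bool (alternates {i, l} S \<tau>)) = (\<Sum>l\<in>?J. if l \<in> {j, \<tau> j} then ?p l else 0)"
        using iff by (intro sum.cong) auto
      also have "\<dots> = (\<Sum>l\<in>{l \<in> ?J. l \<in> {j, \<tau> j}}. ?p l)" by (rule sum.inter_filter[OF finJ, symmetric])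
      also have "{l \<in> ?J. l \<in> {j, \<tau> j}} = {j, \<tau> j}" using j tj by auto
      also have "(\<Sum>l\<in>{j, \<tau> j}. ?p l) = ?p j + ?p (\<tau> j)" using tj(3) by auto
      also have "\<dots> = 0" using between_sign_partners[OF nc fin i(1) j(1) ji jt] by simp
      finally show ?thesis using False by simp
    qed (use False in \<open>auto intro!: sum.neutral\<close>)
  qed
qed

text \<open>All the geometry is packed into \<open>uncrossed\<close>, so that the combinatorial part
  never mentions the drawing.\<close>

locale disc_graph = bipartite_graph G for G :: "('v, 'e) noded_graph" +
  fixes n :: nat
  assumes nodesV: "i \<in> {1..2*n} \<Longrightarrow> node G i \<in> verts G"
    and inj_node: "inj_on (node G) {1..2*n}"
    and uncrossed: "\<lbrakk>set_mset M \<subseteq> edges G; 1 \<le> a; a < b; b < c; c < d; d \<le> 2*n;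
      joined G M (node G a) (node G c); joined G M (node G b) (node G d)\<rbrakk>
      \<Longrightarrow> joined G M (node G a) (node G b)"
begin

definition toggled :: "nat set \<Rightarrow> 'v set" where
  "toggled A = sym_diff (BW n G) (node G ` A)"

definition zt :: "nat set \<Rightarrow> real" where
  "zt A = Z G (toggled A)"

definition conf :: "nat set \<Rightarrow> 'e multiset set" where
  "conf S = configs G (toggled {}) (toggled S)"

definition mate :: "'e multiset \<Rightarrow> nat set \<Rightarrow> nat \<Rightarrow> nat" where
  "mate M S i = (THE j. j \<in> S \<and> j \<noteq> i \<and> joined G M (node G i) (node G j))"

section \<open>Toggled node sets and the pairing induced by a configuration\<close>

lemma node_eq_iff: "i \<in> {1..2*n} \<Longrightarrow> j \<in> {1..2*n} \<Longrightarrow> node G i = node G j \<longleftrightarrow> i = j"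
  using inj_node by (auto dest: inj_onD)

lemma node_image_iff: "i \<in> {1..2*n} \<Longrightarrow> A \<subseteq> {1..2*n} \<Longrightarrow> node G i \<in> node G ` A \<longleftrightarrow> i \<in> A"
  using inj_node inj_on_image_mem_iff by metis

lemma node_BW: "i \<in> {1..2*n} \<Longrightarrow> node G i \<in> BW n G \<longleftrightarrow> (black G (node G i) \<longleftrightarrow> odd i)"
proof -
  assume i: "i \<in> {1..2*n}"
  let ?B = "{i \<in> {1..2*n}. \<not> (black G (node G i) \<and> odd i \<or> \<not> black G (node G i) \<and> even i)}"
  have "node G i \<in> node G ` ?B \<longleftrightarrow> i \<in> ?B" by (rule node_image_iff[OF i]) blast
  then show ?thesis unfolding BW_def using nodesV[OF i] i by blast
qed

lemma node_toggled:
  "i \<in> {1..2*n} \<Longrightarrow> A \<subseteq> {1..2*n} \<Longrightarrow> node G i \<in> toggled A \<longleftrightarrow> (black G (node G i) \<longleftrightarrow> odd i) \<noteq> (i \<in> A)"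
  unfolding toggled_def using node_BW[of i] node_image_iff[of i A] by auto

lemma toggled_verts: "A \<subseteq> {1..2*n} \<Longrightarrow> toggled A \<subseteq> verts G"
  unfolding toggled_def BW_def using nodesV by auto

lemma sym_diff_toggled:
  assumes "A \<subseteq> {1..2*n}" "B \<subseteq> {1..2*n}"
  shows "sym_diff (toggled A) (toggled B) = node G ` sym_diff A B"
proof -
  have "sym_diff (toggled A) (toggled B) = sym_diff (node G ` A) (node G ` B)"
    unfolding toggled_def by blast
  also have "\<dots> = node G ` sym_diff A B"
  proof -
    have "node G ` (A - B) = node G ` A - node G ` B" "node G ` (B - A) = node G ` B - node G ` A"
      using inj_on_image_set_diff[OF inj_node _ assms(2), of A] inj_on_image_set_diff[OF inj_node _ assms(1), of B] assms
      by blast+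
    then show ?thesis by (simp add: image_Un)
  qed
  finally show ?thesis .
qed

text \<open>Exactly one of \<open>A\<close> and \<open>S - A\<close> toggles a given node of
  \<open>S\<close>, so the node is covered once in total; no other vertex is toggled at all. Hence
  the configurations do not depend on \<open>A\<close>.\<close>

lemma configs_toggled:
  assumes S: "S \<subseteq> {1..2*n}" and A: "A \<subseteq> S"
  shows "configs G (toggled A) (toggled (S - A)) = conf S"
proof -
  have "of_bool (v \<in> toggled A) + of_bool (v \<in> toggled (S - A)) =
      (of_bool (v \<in> toggled {}) + of_bool (v \<in> toggled S) :: nat)" for v
  proof (cases "v \<in> node G ` S")
    case True
    then obtain i where i: "i \<in> S" "v = node G i" by blast
    have i': "i \<in> {1..2*n}" using i S by auto
    have sub: "A \<subseteq> {1..2*n}" "S - A \<subseteq> {1..2*n}" using S A by auto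
    show ?thesis
      unfolding i(2) node_toggled[OF i' sub(1)] node_toggled[OF i' sub(2)] node_toggled[OF i' S] node_toggled[OF i' empty_subsetI]
      using i(1) by auto
  next
    case False
    then have "v \<notin> node G ` A" "v \<notin> node G ` (S - A)" using A by auto
    then show ?thesis using False by (auto simp: toggled_def)
  qed
  then show ?thesis unfolding conf_def configs_def by simp
qed

lemma mate_exists:
  assumes S: "S \<subseteq> {1..2*n}" and M: "M \<in> conf S" and i: "i \<in> S"
  shows "\<exists>!j. j \<in> S \<and> j \<noteq> i \<and> joined G M (node G i) (node G j)"
proof -
  have T: "sym_diff (toggled {}) (toggled S) = node G ` S" using sym_diff_toggled[of "{}" S] S by simp
  have "\<exists>!u. u \<in> node G ` S \<and> u \<noteq> node G i \<and> joined G M (node G i) u"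
    using configs_partner[OF M[unfolded conf_def] toggled_verts toggled_verts[OF S], of "node G i"] i unfolding T by simp
  then obtain u where u: "u \<in> node G ` S" "u \<noteq> node G i" "joined G M (node G i) u"
     "\<And>v. v \<in> node G ` S \<Longrightarrow> v \<noteq> node G i \<Longrightarrow> joined G M (node G i) v \<Longrightarrow> v = u" by metis
  then obtain j where j: "j \<in> S" "u = node G j" by blast
  show ?thesis
  proof (rule ex1I[of _ j])
    show "j \<in> S \<and> j \<noteq> i \<and> joined G M (node G i) (node G j)" using u j by auto
    fix k assume k: "k \<in> S \<and> k \<noteq> i \<and> joined G M (node G i) (node G k)"
    then have "node G k \<noteq> node G i" using node_eq_iff[of k i] S i by blast
    then have "node G k = node G j" using u(4)[of "node G k"] k j by auto
    then show "k = j" using node_eq_iff[of k j] S k j by blast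
  qed
qed

lemma mate:
  assumes "S \<subseteq> {1..2*n}" "M \<in> conf S" "i \<in> S"
  shows "mate M S i \<in> S" "mate M S i \<noteq> i" "joined G M (node G i) (node G (mate M S i))"
  using theI'[OF mate_exists[OF assms]] unfolding mate_def by auto

lemma mate_unique:
  assumes "S \<subseteq> {1..2*n}" "M \<in> conf S" "i \<in> S" "j \<in> S" "j \<noteq> i" "joined G M (node G i) (node G j)"
  shows "mate M S i = j"
  using mate_exists[OF assms(1-3)] mate[OF assms(1-3)] assms(4-6) by blast

text \<open>Interlaced chords would be merged by \<open>uncrossed\<close>, giving node
  \<open>i\<close> a second partner.\<close>

lemma mate_noncrossing:
  assumes S: "S \<subseteq> {1..2*n}" and M: "M \<in> conf S"
  shows "noncrossing_pairing S (mate M S)"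
  unfolding noncrossing_pairing_def
proof (intro conjI ballI impI)
  note m = mate[OF S M]
  have ME: "set_mset M \<subseteq> edges G" using M by (simp add: conf_def configs_def)
  fix i assume i: "i \<in> S"
  show "mate M S i \<in> S" "mate M S i \<noteq> i" using m[OF i] by auto
  show mm: "mate M S (mate M S i) = i"
    using mate_unique[OF S M _ i] m[OF i] joined_sym by metis
  fix b assume b: "b \<in> S" "i < b" "b < mate M S i"
  show "mate M S b < mate M S i"
  proof (rule ccontr)
    assume "\<not> ?thesis"
    moreover have "mate M S b \<noteq> mate M S i"
    proof
      assume "mate M S b = mate M S i"
      then have "b = i" using mm mate_unique[OF S M _ b(1)] m[OF b(1)] joined_sym by metis
      then show False using b by simp
    qed
    ultimately have lt: "mate M S i < mate M S b" by simp
    have "joined G M (node G i) (node G b)"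
      by (rule uncrossed[OF ME, of i b "mate M S i" "mate M S b"])
        (use m[OF i] m[OF b(1)] i b lt S in auto)
    then have "mate M S i = b" using mate_unique[OF S M i b(1)] b by simp
    then show False using b by simp
  qed
qed

text \<open>The dependence on \<open>A\<close> is confined to an indicator. So a linear relation
  among these indicators that holds for each planar pairing becomes a quadratic relation among the
  values of \<open>zt\<close>.\<close>

lemma zt_mult:
  assumes S: "S \<subseteq> {1..2*n}" and A: "A \<subseteq> S"
  shows "zt A * zt (S - A) = (\<Sum>M\<in>conf S. config_weight G M * of_bool (alternates A S (mate M S)))"
proof -
  have sub: "A \<subseteq> {1..2*n}" "S - A \<subseteq> {1..2*n}" using S A by auto
  have fin: "finite (conf S)" unfolding conf_def by (intro finite_configs toggled_verts S empty_subsetI)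
  have T: "sym_diff (toggled A) (toggled (S - A)) = node G ` S"
    using sym_diff_toggled[OF sub] A by (simp add: Un_absorb1 Diff_Diff_Int Int_absorb1) 
  have "compatible G (toggled A) (toggled (S - A)) M \<longleftrightarrow> alternates A S (mate M S)" if M: "M \<in> conf S" for M
  proof -
    note m = mate[OF S M]
    have src: "(black G (node G i) \<longleftrightarrow> node G i \<in> toggled A) \<longleftrightarrow> (odd i \<longleftrightarrow> i \<notin> A)" if "i \<in> S" for i
      using node_toggled[OF _ sub(1), of i] S that by blast
    show ?thesis
    proof
      assume "compatible G (toggled A) (toggled (S - A)) M"
      then have c: "(black G u \<longleftrightarrow> u \<in> toggled A) \<noteq> (black G v \<longleftrightarrow> v \<in> toggled A)"
        if "u \<in> node G ` S" "v \<in> node G ` S" "u \<noteq> v" "joined G M u v" for u v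
        using that unfolding compatible_def T by blast
      show "alternates A S (mate M S)" unfolding alternates_def
      proof
        fix i assume i: "i \<in> S"
        have "node G i \<noteq> node G (mate M S i)"
          using node_eq_iff[OF subsetD[OF S i] subsetD[OF S m(1)[OF i]]] m(2)[OF i] by simp
        then show "(odd i \<longleftrightarrow> i \<notin> A) \<noteq> (odd (mate M S i) \<longleftrightarrow> mate M S i \<notin> A)"
          using c[OF imageI[OF i] imageI[OF m(1)[OF i]] _ m(3)[OF i]] src[OF i] src[OF m(1)[OF i]] by blast
      qed
    next
      assume a: "alternates A S (mate M S)"
      show "compatible G (toggled A) (toggled (S - A)) M" unfolding compatible_def T
      proof (intro ballI impI)
        fix u v assume uv: "u \<in> node G ` S" "v \<in> node G ` S" "u \<noteq> v" "joined G M u v"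
        then obtain i j where ij: "u = node G i" "v = node G j" "i \<in> S" "j \<in> S" by blast
        then have "mate M S i = j" using uv mate_unique[OF S M] by metis
        then show "(black G u \<longleftrightarrow> u \<in> toggled A) \<noteq> (black G v \<longleftrightarrow> v \<in> toggled A)"
          using a ij src unfolding alternates_def by metis
      qed
    qed
  qed
  then have "{M. M \<in> configs G (toggled A) (toggled (S - A)) \<and> compatible G (toggled A) (toggled (S - A)) M} =
      {M \<in> conf S. alternates A S (mate M S)}"
    unfolding configs_toggled[OF S A] by blast
  then show ?thesis
    unfolding zt_def Z_mult[OF toggled_verts[OF sub(1)] toggled_verts[OF sub(2)]]
    using fin by (simp add: sum.inter_filter of_bool_def if_distrib cong: if_cong)
qed

text \<open>This is \<open>alternates_expand\<close> summed over all configurations with node set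
  \<open>S\<close>.\<close>

lemma condensation:
  assumes S: "S \<subseteq> {1..2*n}" and i: "i \<in> S" "odd i"
  shows "zt S * zt {} = (\<Sum>j\<in>{j \<in> S. even j}. (\<Prod>k\<in>S - {i, j}. between_sign i j k) * (zt {i, j} * zt (S - {i, j})))"
proof -
  have fin: "finite S" using S finite_subset by blast
  have "zt S * zt {} = zt {} * zt (S - {})" by simp
  also have "\<dots> = (\<Sum>M\<in>conf S. config_weight G M * of_bool (alternates {} S (mate M S)))"
    by (rule zt_mult[OF S]) simp
  also have "\<dots> = (\<Sum>M\<in>conf S. \<Sum>j\<in>{j \<in> S. even j}. (\<Prod>k\<in>S - {i, j}. between_sign i j k) *
      (config_weight G M * of_bool (alternates {i, j} S (mate M S))))"
    using alternates_expand[OF mate_noncrossing[OF S] fin i]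
    by (intro sum.cong refl) (simp add: sum_distrib_left mult_ac)
  also have "\<dots> = (\<Sum>j\<in>{j \<in> S. even j}. (\<Prod>k\<in>S - {i, j}. between_sign i j k) *
      (\<Sum>M\<in>conf S. config_weight G M * of_bool (alternates {i, j} S (mate M S))))"
    by (subst sum.swap) (simp add: sum_distrib_left)
  also have "\<dots> = (\<Sum>j\<in>{j \<in> S. even j}. (\<Prod>k\<in>S - {i, j}. between_sign i j k) * (zt {i, j} * zt (S - {i, j})))"
    using zt_mult[OF S] i by (intro sum.cong refl) auto
  finally show ?thesis .
qed

end


section \<open>Crossing signs\<close>

lemma prod_sign_card:
  "finite T \<Longrightarrow> (\<Prod>x\<in>T. if P x then - 1 else 1) = (- 1 :: 'a :: comm_ring_1) ^ card {x \<in> T. P x}"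
  by (simp add: prod.inter_filter[symmetric])

text \<open>The larger element comes first, so inserting a new maximum \<open>a\<close> adds just
  the pairs that start with \<open>a\<close>.\<close>

definition desc_pairs :: "nat set \<Rightarrow> (nat \<times> nat) set" where
  "desc_pairs I = {(a, b). a \<in> I \<and> b \<in> I \<and> b < a}"

lemma finite_desc_pairs [simp]: "finite I \<Longrightarrow> finite (desc_pairs I)"
  by (rule finite_subset[of _ "I \<times> I"]) (auto simp: desc_pairs_def)

definition pair_sign :: "(nat \<Rightarrow> nat) \<Rightarrow> nat \<times> nat \<Rightarrow> int" where
  "pair_sign p = (\<lambda>(a, b). if p a < p b \<longleftrightarrow> a < b then 1 else -1)"

lemma sort_pair_bij:
  assumes "inj_on q I" "q ` I = I"
  shows "bij_betw (\<lambda>(a, b). if q b < q a then (q a, q b) else (q b, q a)) (desc_pairs I) (desc_pairs I)"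
    (is "bij_betw ?f _ _")
proof -
  have q: "q a \<in> I" if "a \<in> I" for a using assms that by auto
  have qeq: "q a = q b \<longleftrightarrow> a = b" if "a \<in> I" "b \<in> I" for a b using assms that by (auto dest: inj_onD)
  show ?thesis
    unfolding bij_betw_def
  proof (intro conjI inj_onI equalityI subsetI)
    fix x y assume "x \<in> desc_pairs I" "y \<in> desc_pairs I" "?f x = ?f y"
    then show "x = y" by (auto simp: desc_pairs_def qeq split: if_splits)
  next
    fix x assume "x \<in> ?f ` desc_pairs I"
    then obtain a b where ab: "a \<in> I" "b \<in> I" "b < a" "x = ?f (a, b)" by (auto simp: desc_pairs_def)
    then have "q a \<noteq> q b" using qeq by simp
    then show "x \<in> desc_pairs I" using ab q by (auto simp: desc_pairs_def)
  next
    fix x assume "x \<in> desc_pairs I"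
    then obtain a b where x: "x = (a, b)" "a \<in> I" "b \<in> I" "b < a" by (auto simp: desc_pairs_def)
    obtain c where c: "c \<in> I" "a = q c" using x(2) assms(2) by (metis imageE)
    obtain d where d: "d \<in> I" "b = q d" using x(3) assms(2) by (metis imageE)
    note cd = c(1) d(1) c(2) d(2)
    then have "c \<noteq> d" using x by auto
    then have "(if d < c then (c, d) else (d, c)) \<in> desc_pairs I" using cd by (auto simp: desc_pairs_def)
    moreover have "?f (if d < c then (c, d) else (d, c)) = x" using x cd by auto
    ultimately show "x \<in> ?f ` desc_pairs I" by (intro image_eqI[where f = ?f, OF sym])
  qed
qed

text \<open>The sign of a permutation as a product over pairs, so that it can be multiplied with
  \<open>crossing_sign\<close> pair by pair.\<close>

definition inversion_sign :: "nat set \<Rightarrow> (nat \<Rightarrow> nat) \<Rightarrow> int" where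
  "inversion_sign I p = (\<Prod>x\<in>desc_pairs I. pair_sign p x)"

lemma inversion_sign_compose:
  assumes "p permutes I" "q permutes I"
  shows "inversion_sign I (p \<circ> q) = inversion_sign I p * inversion_sign I q"
proof -
  have pi: "p a = p b \<longleftrightarrow> a = b" for a b using permutes_inj[OF assms(1)] by (auto dest: injD)
  have qi: "q a = q b \<longleftrightarrow> a = b" for a b using permutes_inj[OF assms(2)] by (auto dest: injD)
  let ?f = "\<lambda>(a, b). if q b < q a then (q a, q b) else (q b, q a)"
  have "pair_sign (p \<circ> q) x = pair_sign p (?f x) * pair_sign q x" if x: "x \<in> desc_pairs I" for x
  proof -
    obtain a b where ab: "x = (a, b)" "b < a" using x by (auto simp: desc_pairs_def)
    have "q a \<noteq> q b" "p (q a) \<noteq> p (q b)" using ab pi qi by auto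
    then show ?thesis using ab by (auto simp: pair_sign_def)
  qed
  then have "inversion_sign I (p \<circ> q) = (\<Prod>x\<in>desc_pairs I. pair_sign p (?f x)) * inversion_sign I q"
    unfolding inversion_sign_def by (simp add: prod.distrib)
  also have "(\<Prod>x\<in>desc_pairs I. pair_sign p (?f x)) = inversion_sign I p"
    unfolding inversion_sign_def
    by (rule prod.reindex_bij_betw[OF sort_pair_bij])
      (use permutes_inj_on[OF assms(2)] permutes_image[OF assms(2)] in auto)
  finally show ?thesis .
qed

text \<open>The reversed pairs are the one formed by \<open>a\<close> and \<open>b\<close> and, for
  each \<open>c\<close> strictly between, its pairs with either of them: an odd number.\<close>

lemma inversion_sign_transpose:
  assumes "a < b" "b < n"
  shows "inversion_sign {0..<n} (Transposition.transpose a b) = -1"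
proof -
  let ?t = "Transposition.transpose a b"
  have "inversion_sign {0..<n} ?t = (\<Prod>x\<in>desc_pairs {0..<n}. if pair_sign ?t x = -1 then -1 else 1)"
  proof -
    have "pair_sign ?t x = (if pair_sign ?t x = -1 then -1 else 1)" for x by (cases x) (simp add: pair_sign_def)
    then show ?thesis unfolding inversion_sign_def by (metis (no_types, lifting) prod.cong)
  qed
  also have "\<dots> = (-1) ^ card {x \<in> desc_pairs {0..<n}. pair_sign ?t x = -1}"
    by (intro prod_sign_card) simp
  also have "{x \<in> desc_pairs {0..<n}. pair_sign ?t x = -1} =
      insert (b, a) ((\<lambda>c. (c, a)) ` {a<..<b} \<union> (\<lambda>c. (b, c)) ` {a<..<b})"
  proof (intro equalityI subsetI)
    fix x assume "x \<in> {x \<in> desc_pairs {0..<n}. pair_sign ?t x = -1}"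
    then obtain c d where x: "x = (c, d)" "d < c" "c < n" "?t c < ?t d"
      by (auto simp: desc_pairs_def pair_sign_def split: if_splits)
    then show "x \<in> insert (b, a) ((\<lambda>c. (c, a)) ` {a<..<b} \<union> (\<lambda>c. (b, c)) ` {a<..<b})"
      using assms by (auto simp: Transposition.transpose_def split: if_splits)
  next
    fix x assume "x \<in> insert (b, a) ((\<lambda>c. (c, a)) ` {a<..<b} \<union> (\<lambda>c. (b, c)) ` {a<..<b})"
    then show "x \<in> {x \<in> desc_pairs {0..<n}. pair_sign ?t x = -1}"
      using assms by (auto simp: desc_pairs_def pair_sign_def Transposition.transpose_def)
  qed
  also have "card \<dots> = Suc (card {a<..<b} + card {a<..<b})"
  proof -
    have "card ((\<lambda>c. (c, a)) ` {a<..<b} \<union> (\<lambda>c. (b, c)) ` {a<..<b}) = card {a<..<b} + card {a<..<b}"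
      by (subst card_Un_disjoint) (auto simp: card_image inj_on_def)
    moreover have "(b, a) \<notin> (\<lambda>c. (c, a)) ` {a<..<b} \<union> (\<lambda>c. (b, c)) ` {a<..<b}" by auto
    ultimately show ?thesis by (subst card_insert_disjoint) auto
  qed
  also have "(-1 :: int) ^ Suc (card {a<..<b} + card {a<..<b}) = -1" by (simp add: power_add flip: power_mult_distrib)
  finally show ?thesis .
qed

lemma sign_eq_inversion_sign:
  assumes "p permutes {0..<n}"
  shows "sign p = inversion_sign {0..<n} p"
  using assms finite_atLeastLessThan
proof (induction rule: permutes_induct)
  case id
  show ?case by (auto simp: inversion_sign_def pair_sign_def desc_pairs_def intro!: prod.neutral[symmetric])
next
  case (swap a b p)
  have t: "Transposition.transpose a b permutes {0..<n}" using swap by (simp add: permutes_swap_id)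
  have "inversion_sign {0..<n} (Transposition.transpose a b) = -1"
    using inversion_sign_transpose[of a b n] inversion_sign_transpose[of b a n] swap
    by (cases "a < b") (auto simp: transpose_commute)
  moreover have "sign (Transposition.transpose a b \<circ> p) = - sign p"
    using swap sign_compose[OF permutation_swap_id, of p a b] permutation_permutes[of p]
    by (auto simp: sign_swap_id)
  ultimately show ?case
    using inversion_sign_compose[OF t \<open>p permutes {0..<n}\<close>] \<open>sign p = _\<close>
    by (simp only: mult_minus_left mult_1)
qed

text \<open>Row \<open>r\<close> stands for the odd node \<open>2r+1\<close> and column \<open>s\<close> for the even node \<open>2s+2\<close>.
  \<open>chord_sign r s t u\<close> is \<open>-1\<close> iff the chords \<open>(r, s)\<close> and \<open>(t, u)\<close> cross.\<close>

definition chord_sign :: "nat \<Rightarrow> nat \<Rightarrow> nat \<Rightarrow> nat \<Rightarrow> real" where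
  "chord_sign r s t u = between_sign (2 * r+1) (2 * s+2) (2 * t+1) * between_sign (2 * r+1) (2 * s+2) (2 * u+2)"

definition crossing_sign :: "nat set \<Rightarrow> (nat \<Rightarrow> nat) \<Rightarrow> real" where
  "crossing_sign I f = (\<Prod>(a, b)\<in>desc_pairs I. chord_sign a (f a) b (f b))"

lemma chord_sign_square: "chord_sign r s t u * chord_sign r s t u = 1"
  by (auto simp: chord_sign_def between_sign_def)

text \<open>The gain is a separation of the two chords: the first factor on the right asks whether
  row \<open>a\<close> falls into the span of the chord \<open>(b, t)\<close>, the second whether
  row \<open>b\<close> falls into that of \<open>(a, s)\<close>. Each chord can then be counted by
  itself.\<close>

lemma chord_sign_inversion:
  assumes "b < a" "s \<noteq> t"
  shows "chord_sign a s b t * (if s < t then -1 else 1) =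
    (if a \<le> t then -1 else 1) * (if s < b then -1 else 1)"
proof -
  have "2 * s + 2 < 2 * b + 1 \<longleftrightarrow> s < b" "2 * a + 1 < 2 * t + 2 \<longleftrightarrow> a \<le> t" "2 * t + 2 < 2 * a + 1 \<longleftrightarrow> t < a"
    "2 * a + 1 < 2 * b + 1 \<longleftrightarrow> a < b" "2 * b + 1 < 2 * s + 2 \<longleftrightarrow> b \<le> s" "2 * b + 1 < 2 * a + 1 \<longleftrightarrow> b < a"
    "2 * t + 2 < 2 * s + 2 \<longleftrightarrow> t < s" "2 * s + 2 < 2 * t + 2 \<longleftrightarrow> s < t" by linarith+
  then show ?thesis
    using assms unfolding chord_sign_def between_sign_def
    by (cases "s < t"; cases "a \<le> t"; cases "s < b"; simp; linarith)
qed

lemma chord_sign_sym: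
  assumes "a \<noteq> b" "s \<noteq> t"
  shows "chord_sign a s b t = chord_sign b t a s"
proof -
  have *: "chord_sign a s b t = chord_sign b t a s" if "a < b" "s \<noteq> t" for a b s t
  proof -
    have e: "2 * s + 2 < 2 * b + 1 \<longleftrightarrow> s < b" "2 * a + 1 < 2 * t + 2 \<longleftrightarrow> a \<le> t" "2 * t + 2 < 2 * a + 1 \<longleftrightarrow> t < a"
      "2 * a + 1 < 2 * b + 1 \<longleftrightarrow> a < b" "2 * b + 1 < 2 * s + 2 \<longleftrightarrow> b \<le> s" "2 * b + 1 < 2 * a + 1 \<longleftrightarrow> b < a"
      "2 * t + 2 < 2 * s + 2 \<longleftrightarrow> t < s" "2 * s + 2 < 2 * t + 2 \<longleftrightarrow> s < t"
      "2 * a + 1 < 2 * s + 2 \<longleftrightarrow> a \<le> s" "2 * s + 2 < 2 * a + 1 \<longleftrightarrow> s < a"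
      "2 * b + 1 < 2 * t + 2 \<longleftrightarrow> b \<le> t" "2 * t + 2 < 2 * b + 1 \<longleftrightarrow> t < b" by linarith+
    show ?thesis
      using that unfolding chord_sign_def between_sign_def e
      by (cases "s < t"; cases "a \<le> t"; cases "s < b"; cases "a \<le> s"; cases "b \<le> t"; simp; linarith)
  qed
  show ?thesis using *[of a b s t] *[of b a t s] assms by (cases "a < b") auto
qed

text \<open>Subtraction is truncated, so at most one exponent on the left is nonzero. In the
  application \<open>m\<close> is the column of row \<open>r\<close>.\<close>

lemma minus_one_power_diff:
  "(-1) ^ (m - r) * (-1) ^ (r - Suc m) = ((-1) ^ r * (-1) ^ m) * (if m < r then -1 else 1 :: real)"
proof (cases "m < r")
  case True
  then obtain k where "r = Suc (m + k)" using less_imp_Suc_add by blast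
  then show ?thesis by (simp add: power_add mult_ac flip: power_mult_distrib)
next
  case False
  then obtain k where "m = r + k" using False by (metis le_iff_add not_less)
  then show ?thesis by (simp add: power_add flip: power_mult_distrib)
qed

text \<open>The right side has a \<open>-1\<close> for each chord whose even node precedes its odd
  node. By \<open>chord_sign_inversion\<close> the left side reduces to counting the rows spanned by
  each chord; the parities of \<open>r\<close> and \<open>p r\<close> that arise cancel in total,
  because \<open>p\<close> permutes the rows.\<close>

lemma sign_mult_crossing_sign:
  assumes p: "p permutes {0..<n}"
  shows "of_int (sign p) * crossing_sign {0..<n} p = (\<Prod>r\<in>{0..<n}. if p r < r then -1 else 1)"
proof -
  let ?N = "{0..<n}"
  let ?u = "\<lambda>b a. if b < a \<and> a \<le> p b then -1 else 1 :: real"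
  let ?v = "\<lambda>a b. if p a < b \<and> b < a then -1 else 1 :: real"
  have pi: "p a = p b \<longleftrightarrow> a = b" for a b using permutes_inj[OF p] by (auto dest: injD)
  have pN: "p a < n" if "a < n" for a using permutes_in_image[OF p, of a] that by simp
  have "of_int (sign p) * crossing_sign ?N p = (\<Prod>(a, b)\<in>desc_pairs ?N. of_int (pair_sign p (a, b)) * chord_sign a (p a) b (p b))"
    unfolding sign_eq_inversion_sign[OF p] inversion_sign_def crossing_sign_def of_int_prod
    by (simp add: prod.distrib case_prod_unfold)
  also have "\<dots> = (\<Prod>(a, b)\<in>desc_pairs ?N. ?u b a * ?v a b)"
  proof (rule prod.cong[OF refl], clarify)
    fix a b assume "(a, b) \<in> desc_pairs ?N"
    then have ba: "b < a" by (simp add: desc_pairs_def)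
    then have "p a \<noteq> p b" using pi by simp
    then show "of_int (pair_sign p (a, b)) * chord_sign a (p a) b (p b) = ?u b a * ?v a b"
      using chord_sign_inversion[OF ba, of "p a" "p b"] ba
      by (simp add: pair_sign_def mult.commute split: if_splits)
  qed
  \<comment> \<open>Both factors are 1 unless \<open>b < a\<close>, so the product may run over all
    pairs and then be regrouped chord by chord.\<close>
  also have "\<dots> = (\<Prod>(a, b)\<in>?N \<times> ?N. ?u b a * ?v a b)"
    by (rule prod.mono_neutral_left) (auto simp: desc_pairs_def split: if_splits)
  also have "\<dots> = (\<Prod>a\<in>?N. \<Prod>b\<in>?N. ?u b a) * (\<Prod>a\<in>?N. \<Prod>b\<in>?N. ?v a b)"
    by (simp add: prod.cartesian_product[symmetric] prod.distrib)
  also have "(\<Prod>a\<in>?N. \<Prod>b\<in>?N. ?u b a) = (\<Prod>r\<in>?N. \<Prod>a\<in>?N. ?u r a)" by (rule prod.swap)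
  also have "\<dots> * (\<Prod>a\<in>?N. \<Prod>b\<in>?N. ?v a b) = (\<Prod>r\<in>?N. (\<Prod>a\<in>?N. ?u r a) * (\<Prod>b\<in>?N. ?v r b))"
    by (simp add: prod.distrib)
  also have "\<dots> = (\<Prod>r\<in>?N. ((-1) ^ r * (-1) ^ p r) * (if p r < r then -1 else 1))"
  proof (rule prod.cong[OF refl])
    fix r assume "r \<in> ?N"
    then have r: "r < n" "p r < n" using pN by auto
    have "{a \<in> ?N. r < a \<and> a \<le> p r} = {r<..p r}" using r by auto
    then have u: "(\<Prod>a\<in>?N. ?u r a) = (-1) ^ (p r - r)" by (simp add: prod_sign_card)
    have "{b \<in> ?N. p r < b \<and> b < r} = {p r<..<r}" using r by auto
    then have v: "(\<Prod>b\<in>?N. ?v r b) = (-1) ^ (r - Suc (p r))" by (simp add: prod_sign_card)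
    show "(\<Prod>a\<in>?N. ?u r a) * (\<Prod>b\<in>?N. ?v r b) = ((-1) ^ r * (-1) ^ p r) * (if p r < r then -1 else 1)"
      unfolding u v by (rule minus_one_power_diff)
  qed
  also have "\<dots> = (\<Prod>r\<in>?N. (-1) ^ r) * (\<Prod>r\<in>?N. (-1) ^ p r) * (\<Prod>r\<in>?N. if p r < r then -1 else 1)"
    by (simp add: prod.distrib)
  also have "(\<Prod>r\<in>?N. (-1 :: real) ^ p r) = (\<Prod>r\<in>?N. (-1) ^ r)"
    using prod.permute[OF p, of "\<lambda>r. (-1 :: real) ^ r"] by (simp add: comp_def)
  also have "(\<Prod>r\<in>?N. (-1 :: real) ^ r) * (\<Prod>r\<in>?N. (-1) ^ r) = 1"
    by (simp add: prod.distrib[symmetric] flip: power_mult_distrib)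
  finally show ?thesis by simp
qed

text \<open>A chord from an odd to an even node has an even number of nodes between its ends. Each
  of them is an end of another chord, so the number of crossings is even.\<close>

lemma prod_chord_sign_all:
  assumes p: "p permutes {0..<n}" and a: "a < n"
  shows "(\<Prod>b\<in>{0..<n} - {a}. chord_sign a (p a) b (p b)) = 1"
proof -
  let ?N = "{0..<n}" and ?s = "p a"
  have s: "?s < n" using permutes_in_image[OF p, of a] a by simp
  have "(\<Prod>b\<in>?N - {a}. between_sign (2 * a+1) (2 * ?s+2) (2 * p b+2)) =
      (\<Prod>c\<in>p ` (?N - {a}). between_sign (2 * a+1) (2 * ?s+2) (2 * c+2))"
    by (subst prod.reindex) (use permutes_inj_on[OF p] in auto)
  also have "p ` (?N - {a}) = ?N - {?s}"
    using permutes_image[OF p] permutes_inj[OF p] by (auto simp: image_set_diff)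
  finally have "(\<Prod>b\<in>?N - {a}. chord_sign a ?s b (p b)) =
     (\<Prod>b\<in>?N - {a}. between_sign (2 * a+1) (2 * ?s+2) (2 * b+1)) * (\<Prod>c\<in>?N - {?s}. between_sign (2 * a+1) (2 * ?s+2) (2 * c+2))"
    unfolding chord_sign_def by (simp add: prod.distrib)
  also have "\<dots> = 1"
  proof (cases "a \<le> ?s")
    case True
    have "{x \<in> ?N - {a}. 2 * a+1 < 2 * x+1 \<and> 2 * x+1 < 2 * ?s+2 \<or> 2 * ?s+2 < 2 * x+1 \<and> 2 * x+1 < 2 * a+1} = {a<..?s}"
      using True s by (auto; presburger)
    moreover have "{x \<in> ?N - {?s}. 2 * a+1 < 2 * x+2 \<and> 2 * x+2 < 2 * ?s+2 \<or> 2 * ?s+2 < 2 * x+2 \<and> 2 * x+2 < 2 * a+1} = {a..<?s}"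
      using True s by (auto; presburger)
    ultimately show ?thesis unfolding between_sign_def
      by (subst (1 2) prod_sign_card) (simp_all flip: power_mult_distrib)
  next
    case False
    have "{x \<in> ?N - {a}. 2 * a+1 < 2 * x+1 \<and> 2 * x+1 < 2 * ?s+2 \<or> 2 * ?s+2 < 2 * x+1 \<and> 2 * x+1 < 2 * a+1} = {?s<..<a}"
      using False a by auto
    moreover have "{x \<in> ?N - {?s}. 2 * a+1 < 2 * x+2 \<and> 2 * x+2 < 2 * ?s+2 \<or> 2 * ?s+2 < 2 * x+2 \<and> 2 * x+2 < 2 * a+1} = {?s<..<a}"
      using False a by auto
    ultimately show ?thesis unfolding between_sign_def
      by (subst (1 2) prod_sign_card) (simp_all flip: power_mult_distrib)
  qed
  finally show ?thesis .
qed

text \<open>What has to vanish is the contribution of pairs with one chord in \<open>I\<close> and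
  one outside. By \<open>prod_chord_sign_all\<close> the outside chords met by a chord of
  \<open>I\<close> may be replaced by the other chords of \<open>I\<close>, and then every pair
  within \<open>I\<close> occurs twice.\<close>

lemma crossing_sign_split:
  assumes p: "p permutes {0..<n}" and I: "I \<subseteq> {0..<n}"
  shows "crossing_sign {0..<n} p = crossing_sign I p * crossing_sign ({0..<n} - I) p"
proof -
  let ?N = "{0..<n}" and ?I' = "{0..<n} - I"
  let ?c = "\<lambda>(a, b). chord_sign a (p a) b (p b)"
  have pi: "p a = p b \<longleftrightarrow> a = b" for a b using permutes_inj[OF p] by (auto dest: injD)
  have finI: "finite I" using I finite_subset by blast
  define X where "X = {(a, b) \<in> desc_pairs ?N. (a \<in> I) \<noteq> (b \<in> I)}"
  have N: "desc_pairs ?N = (desc_pairs I \<union> desc_pairs ?I') \<union> X"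
    using I unfolding X_def desc_pairs_def by auto
  have finX: "finite X" unfolding X_def by (rule finite_subset[of _ "desc_pairs ?N"]) auto
  have "prod ?c (desc_pairs I \<union> desc_pairs ?I' \<union> X) = prod ?c (desc_pairs I \<union> desc_pairs ?I') * prod ?c X"
    by (rule prod.union_disjoint[OF _ finX]) (use finI in simp, auto simp: X_def desc_pairs_def)
  also have "prod ?c (desc_pairs I \<union> desc_pairs ?I') = prod ?c (desc_pairs I) * prod ?c (desc_pairs ?I')"
    by (rule prod.union_disjoint) (use finI in simp, simp, auto simp: desc_pairs_def)
  finally have "crossing_sign ?N p = crossing_sign I p * crossing_sign ?I' p * prod ?c X"
    unfolding crossing_sign_def N .
  moreover have "prod ?c X = 1"
  proof -
    have "prod ?c X = prod ?c (I \<times> ?I')"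
    proof (rule prod.reindex_bij_witness[where i = "\<lambda>(a, b). if b < a then (a, b) else (b, a)"
            and j = "\<lambda>(a, b). if a \<in> I then (a, b) else (b, a)"])
      fix x assume "x \<in> X"
      then obtain a b where x: "x = (a, b)" "b < a" "a < n" "(a \<in> I) \<noteq> (b \<in> I)" by (auto simp: X_def desc_pairs_def)
      then have "chord_sign a (p a) b (p b) = chord_sign b (p b) a (p a)" using chord_sign_sym pi by simp
      then show "?c (case x of (a, b) \<Rightarrow> if a \<in> I then (a, b) else (b, a)) = ?c x" using x by simp
    qed (use I in \<open>auto simp: X_def desc_pairs_def not_less order.order_iff_strict split: if_splits\<close>)
    also have "\<dots> = (\<Prod>a\<in>I. \<Prod>b\<in>?I'. ?c (a, b))" by (simp add: prod.cartesian_product)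
    also have "\<dots> = (\<Prod>a\<in>I. \<Prod>b\<in>I - {a}. ?c (a, b))"
    proof (rule prod.cong[OF refl])
      fix a assume a: "a \<in> I"
      have "?N - {a} = (I - {a}) \<union> ?I'" using I a by auto
      then have "(\<Prod>b\<in>I - {a}. ?c (a, b)) * (\<Prod>b\<in>?I'. ?c (a, b)) = (\<Prod>b\<in>?N - {a}. ?c (a, b))"
        by (simp only:) (rule prod.union_disjoint[symmetric]; use finI in auto)
      also have "\<dots> = 1" using prod_chord_sign_all[OF p, of a] I a by auto
      finally have xy: "(\<Prod>b\<in>I - {a}. ?c (a, b)) * (\<Prod>b\<in>?I'. ?c (a, b)) = 1" .
      have eq: "y = x" if "x * y = 1" "x * x = 1" for x y :: real
        using that by (metis mult.assoc mult.right_neutral mult_1)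
      have "(\<Prod>b\<in>I - {a}. ?c (a, b)) * (\<Prod>b\<in>I - {a}. ?c (a, b)) = 1"
        unfolding prod.distrib[symmetric] by (rule prod.neutral) (simp add: chord_sign_square)
      then show "(\<Prod>b\<in>?I'. ?c (a, b)) = (\<Prod>b\<in>I - {a}. ?c (a, b))"
        by (rule eq[OF xy])
    qed
    also have "\<dots> = prod ?c (SIGMA a:I. I - {a})" using finI by (subst prod.Sigma) auto
    also have "\<dots> = 1"
    proof (rule prod_involution[where \<tau> = "\<lambda>(a, b). (b, a)"])
      fix x assume "x \<in> (SIGMA a:I. I - {a})"
      then obtain a b where x: "x = (a, b)" "a \<in> I" "b \<in> I" "a \<noteq> b" by auto
      then have "chord_sign a (p a) b (p b) = chord_sign b (p b) a (p a)" using chord_sign_sym pi by simp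
      then show "(case x of (a, b) \<Rightarrow> (b, a)) \<in> (SIGMA a:I. I - {a}) \<and> (case x of (a, b) \<Rightarrow> (b, a)) \<noteq> x \<and>
          (case (case x of (a, b) \<Rightarrow> (b, a)) of (a, b) \<Rightarrow> (b, a)) = x \<and> ?c x * ?c (case x of (a, b) \<Rightarrow> (b, a)) = 1"
        using x chord_sign_square by auto
    qed (use finI in auto)
    finally show ?thesis .
  qed
  ultimately show ?thesis by simp
qed


section \<open>Pfaffian-like expansion\<close>

text \<open>Extensional functions, so that a sum counts each bijection once, including the single
  one between empty sets.\<close>

definition bijections :: "'a set \<Rightarrow> 'b set \<Rightarrow> ('a \<Rightarrow> 'b) set" where
  "bijections I J = {f \<in> I \<rightarrow>\<^sub>E J. bij_betw f I J}"

lemma finite_bijections: "finite I \<Longrightarrow> finite J \<Longrightarrow> finite (bijections I J)"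
  unfolding bijections_def by (rule finite_subset[OF _ finite_PiE[of I "\<lambda>_. J"]]) auto

lemma bijections_empty: "bijections {} {} = {\<lambda>_. undefined}"
  by (auto simp: bijections_def bij_betw_def)

text \<open>Expansion along the row \<open>r\<close>: its column \<open>s\<close> is chosen
  first.\<close>

lemma sum_bijections_insert:
  fixes g :: "('a \<Rightarrow> 'b) \<Rightarrow> 'c :: comm_monoid_add"
  assumes "finite I" "finite J" "r \<notin> I"
  shows "(\<Sum>f\<in>bijections (insert r I) J. g f) = (\<Sum>s\<in>J. \<Sum>f\<in>bijections I (J - {s}). g (f(r := s)))"
proof -
  have "(\<Sum>s\<in>J. \<Sum>f\<in>bijections I (J - {s}). g (f(r := s))) =
      (\<Sum>(s, f)\<in>(SIGMA s:J. bijections I (J - {s})). g (f(r := s)))"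
    by (rule sum.Sigma) (use assms in \<open>auto intro: finite_bijections\<close>)
  also have "\<dots> = (\<Sum>f\<in>bijections (insert r I) J. g f)"
  proof (rule sum.reindex_bij_witness[where i = "\<lambda>f. (f r, f(r := undefined))" and j = "\<lambda>(s, f). f(r := s)"])
    fix x assume "x \<in> (SIGMA s:J. bijections I (J - {s}))"
    then obtain s f where x: "x = (s, f)" "s \<in> J" "f \<in> I \<rightarrow>\<^sub>E (J - {s})" "bij_betw f I (J - {s})"
      by (auto simp: bijections_def)
    have fr: "f r = undefined" using x(3) assms(3) by (auto simp: PiE_def extensional_def)
    show "((case x of (s, f) \<Rightarrow> f(r := s)) r, (case x of (s, f) \<Rightarrow> f(r := s))(r := undefined)) = x"
      using x(1) fr by (simp add: fun_upd_idem)
    have "f(r := s) \<in> insert r I \<rightarrow>\<^sub>E J" using x(2,3) by (auto simp: PiE_def Pi_def extensional_def)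
    moreover have "bij_betw (f(r := s)) (insert r I) J"
    proof -
      have "bij_betw (f(r := s)) I (J - {s})"
        using x(4) assms(3) by (subst bij_betw_cong[of I _ f]) auto
      then have "bij_betw (f(r := s)) (I \<union> {r}) ((J - {s}) \<union> {s})"
        by (rule bij_betw_combine) auto
      then show ?thesis using x(2) by (simp add: insert_absorb)
    qed
    ultimately show "(case x of (s, f) \<Rightarrow> f(r := s)) \<in> bijections (insert r I) J"
      using x(1) by (simp add: bijections_def)
    show "g (case x of (s, f) \<Rightarrow> f(r := s)) = (case x of (s, f) \<Rightarrow> g (f(r := s)))" using x(1) by simp
  next
    fix f assume "f \<in> bijections (insert r I) J"
    then have f: "f \<in> insert r I \<rightarrow>\<^sub>E J" "bij_betw f (insert r I) J" by (auto simp: bijections_def)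
    show "(case (f r, f(r := undefined)) of (s, f) \<Rightarrow> f(r := s)) = f" by simp
    have fJ: "f r \<in> J" using f(1) by auto
    have inj: "inj_on f (insert r I)" "f ` insert r I = J" using f(2) by (auto simp: bij_betw_def)
    have "f r \<notin> f ` I" using inj(1) assms(3) by simp
    then have im: "f ` I = J - {f r}" using inj(2) by blast
    have "bij_betw f I (J - {f r})" using inj im unfolding bij_betw_def by (auto intro: inj_on_subset)
    then have "bij_betw (f(r := undefined)) I (J - {f r})"
      using assms(3) by (subst bij_betw_cong[of I _ f]) auto
    moreover have "f(r := undefined) \<in> I \<rightarrow>\<^sub>E (J - {f r})"
      using f(1) im by (auto simp: PiE_def Pi_def extensional_def)
    ultimately show "(f r, f(r := undefined)) \<in> (SIGMA s:J. bijections I (J - {s}))"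
      using fJ by (simp add: bijections_def)
  qed
  finally show ?thesis by simp
qed

lemma desc_pairs_insert:
  assumes "\<And>b. b \<in> I \<Longrightarrow> b < a"
  shows "desc_pairs (insert a I) = Pair a ` I \<union> desc_pairs I"
  using assms unfolding desc_pairs_def by fastforce

lemma crossing_sign_insert:
  assumes "finite I" "\<And>b. b \<in> I \<Longrightarrow> b < a"
  shows "crossing_sign (insert a I) f = (\<Prod>b\<in>I. chord_sign a (f a) b (f b)) * crossing_sign I f"
proof -
  have "desc_pairs (insert a I) = Pair a ` I \<union> desc_pairs I"
    by (rule desc_pairs_insert) (rule assms(2))
  moreover have "Pair a ` I \<inter> desc_pairs I = {}" using assms(2) by (auto simp: desc_pairs_def)
  ultimately show ?thesis
    unfolding crossing_sign_def using assms(1) by (simp add: prod.union_disjoint prod.reindex inj_on_def)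
qed

lemma crossing_sign_cong:
  "(\<And>a. a \<in> I \<Longrightarrow> f a = g a) \<Longrightarrow> crossing_sign I f = crossing_sign I g"
  unfolding crossing_sign_def by (intro prod.cong) (auto simp: desc_pairs_def)

section \<open>Node sets split into odd rows and even columns\<close>

definition nodeset :: "nat set \<Rightarrow> nat set \<Rightarrow> nat set" where
  "nodeset I J = (\<lambda>r. 2 * r + 1) ` I \<union> (\<lambda>s. 2 * s + 2) ` J"

lemma nodeset_mem:
  "2 * r + 1 \<in> nodeset I J \<longleftrightarrow> r \<in> I" "2 * s + 2 \<in> nodeset I J \<longleftrightarrow> s \<in> J"
  unfolding nodeset_def by (auto; presburger)+

lemma nodeset_diff:
  "nodeset I J - nodeset K L = nodeset (I - K) (J - L)"
  unfolding nodeset_def by (auto; presburger)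

lemma nodeset_all: "nodeset {0..<n} {0..<n} = {1..2*n}"
proof (intro equalityI subsetI)
  fix k assume "k \<in> {1..2*n}"
  then have k: "1 \<le> k" "k \<le> 2 * n" by auto
  show "k \<in> nodeset {0..<n} {0..<n}"
  proof (cases "odd k")
    case True
    then obtain r where "k = 2 * r + 1" by (elim oddE)
    then show ?thesis using k by (simp only: nodeset_mem) simp
  next
    case False
    then have "even k" by simp
    then obtain m where "k = 2 * m" by (elim evenE)
    then have "k = 2 * (m - 1) + 2" "m - 1 < n" using k by auto
    then show ?thesis by (metis nodeset_mem(2) atLeast0LessThan lessThan_iff)
  qed
qed (auto simp: nodeset_def)

lemma nodeset_subset: "I \<subseteq> {0..<n} \<Longrightarrow> J \<subseteq> {0..<n} \<Longrightarrow> nodeset I J \<subseteq> {1..2*n}"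
  unfolding nodeset_all[symmetric] nodeset_def by blast

lemma prod_nodeset:
  "finite I \<Longrightarrow> finite J \<Longrightarrow> prod h (nodeset I J) = (\<Prod>r\<in>I. h (2 * r + 1)) * (\<Prod>s\<in>J. h (2 * s + 2))"
  unfolding nodeset_def by (subst prod.union_disjoint) (auto simp: prod.reindex inj_on_def; presburger)+

context disc_graph begin

definition xr :: "nat \<Rightarrow> nat \<Rightarrow> real" where
  "xr r s = zt {2 * r + 1, 2 * s + 2} / zt {}"

text \<open>Induction on the largest row \<open>r\<close>, by condensation at the node
  \<open>2 * r + 1\<close>. Once \<open>f\<close> pairs the remaining nodes, the between signs of
  the two ends of each old chord combine into its chord sign against the new chord. As
  \<open>r\<close> is maximal, these are exactly the pairs that \<open>crossing_sign\<close>
  gains.\<close>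

lemma zt_eq_pfaffian:
  assumes z: "zt {} \<noteq> 0" and "finite I" "I \<subseteq> {0..<n}" "J \<subseteq> {0..<n}" "card I = card J"
  shows "zt (nodeset I J) / zt {} = (\<Sum>f\<in>bijections I J. crossing_sign I f * (\<Prod>r\<in>I. xr r (f r)))"
  using assms(2-)
proof (induction I arbitrary: J rule: finite_linorder_max_induct)
  case empty
  then have "J = {}" using finite_subset[of J "{0..<n}"] by auto
  then show ?case using z by (simp add: nodeset_def bijections_empty crossing_sign_def desc_pairs_def)
next
  case (insert r I)
  have finJ: "finite J" using insert.prems(2) finite_subset by blast
  have rI: "r \<notin> I" using insert.hyps(2) by blast
  have max: "\<And>b. b \<in> I \<Longrightarrow> b < r" using insert.hyps(2) by blast
  let ?S = "nodeset (insert r I) J"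
  have S: "?S \<subseteq> {1..2*n}" using insert.prems nodeset_subset by blast
  have ev: "{j \<in> ?S. even j} = (\<lambda>s. 2 * s + 2) ` J" unfolding nodeset_def by auto
  have rem: "?S - {2 * r + 1, 2 * s + 2} = nodeset I (J - {s})" for s
  proof -
    have "{2 * r + 1, 2 * s + 2} = nodeset {r} {s}" by (simp add: nodeset_def insert_commute)
    then show ?thesis using nodeset_diff[of "insert r I" J "{r}" "{s}"] rI by simp
  qed
  let ?bs = "\<lambda>s. (\<Prod>k\<in>nodeset I (J - {s}). between_sign (2 * r + 1) (2 * s + 2) k)"
  have "zt ?S * zt {} = (\<Sum>s\<in>J. ?bs s * (zt {2 * r + 1, 2 * s + 2} * zt (nodeset I (J - {s}))))"
    using condensation[OF S, of "2 * r + 1"] unfolding ev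
    by (simp add: sum.reindex inj_on_def rem[simplified] nodeset_mem[simplified])
  then have "zt ?S / zt {} = (\<Sum>s\<in>J. ?bs s * (zt {2 * r + 1, 2 * s + 2} * zt (nodeset I (J - {s})))) / (zt {} * zt {})"
    using z by (simp add: field_simps)
  also have "\<dots> = (\<Sum>s\<in>J. ?bs s * (xr r s * (zt (nodeset I (J - {s})) / zt {})))"
    unfolding xr_def sum_divide_distrib by (intro sum.cong refl) simp
  also have "\<dots> = (\<Sum>s\<in>J. \<Sum>f\<in>bijections I (J - {s}).
      crossing_sign (insert r I) (f(r := s)) * (\<Prod>q\<in>insert r I. xr q ((f(r := s)) q)))"
  proof (rule sum.cong[OF refl])
    fix s assume s: "s \<in> J"
    have IH: "zt (nodeset I (J - {s})) / zt {} = (\<Sum>f\<in>bijections I (J - {s}). crossing_sign I f * (\<Prod>r\<in>I. xr r (f r)))"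
      by (rule insert.IH) (use insert.prems insert.hyps(1) rI s finJ in auto)
    have "?bs s * (xr r s * (crossing_sign I f * (\<Prod>r\<in>I. xr r (f r)))) =
      crossing_sign (insert r I) (f(r := s)) * (\<Prod>q\<in>insert r I. xr q ((f(r := s)) q))"
      if f: "f \<in> bijections I (J - {s})" for f
    proof -
      have bij: "bij_betw f I (J - {s})" using f by (simp add: bijections_def)
      have "(\<Prod>c\<in>J - {s}. between_sign (2 * r + 1) (2 * s + 2) (2 * c + 2)) =
          (\<Prod>b\<in>I. between_sign (2 * r + 1) (2 * s + 2) (2 * f b + 2))"
        using prod.reindex_bij_betw[OF bij, of "\<lambda>c. between_sign (2 * r + 1) (2 * s + 2) (2 * c + 2)"] by simp
      then have "?bs s = (\<Prod>b\<in>I. chord_sign r s b (f b))"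
        using insert.hyps(1) finJ unfolding chord_sign_def by (simp add: prod_nodeset prod.distrib)
      also have "\<dots> = (\<Prod>b\<in>I. chord_sign r ((f(r := s)) r) b ((f(r := s)) b))"
        using rI by (intro prod.cong) auto
      finally have bs: "?bs s = (\<Prod>b\<in>I. chord_sign r ((f(r := s)) r) b ((f(r := s)) b))" .
      have cs: "crossing_sign I f = crossing_sign I (f(r := s))"
        by (rule crossing_sign_cong) (use rI in auto)
      have "?bs s * crossing_sign I f = crossing_sign (insert r I) (f(r := s))"
        unfolding bs cs by (rule crossing_sign_insert[OF insert.hyps(1) max, symmetric])
      moreover have "xr r s * (\<Prod>q\<in>I. xr q (f q)) = (\<Prod>q\<in>insert r I. xr q ((f(r := s)) q))"
      proof -
        have "(\<Prod>q\<in>I. xr q (f q)) = (\<Prod>q\<in>I. xr q ((f(r := s)) q))" using rI by (intro prod.cong) auto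
        then show ?thesis using rI insert.hyps(1) by simp
      qed
      moreover have "?bs s * (xr r s * (crossing_sign I f * (\<Prod>r\<in>I. xr r (f r)))) =
          (?bs s * crossing_sign I f) * (xr r s * (\<Prod>q\<in>I. xr q (f q)))" by (simp only: mult_ac)
      ultimately show ?thesis by (simp only:)
    qed
    then show "?bs s * (xr r s * (zt (nodeset I (J - {s})) / zt {})) =
      (\<Sum>f\<in>bijections I (J - {s}). crossing_sign (insert r I) (f(r := s)) * (\<Prod>q\<in>insert r I. xr q ((f(r := s)) q)))"
      unfolding IH sum_distrib_left by (intro sum.cong refl)
  qed
  also have "\<dots> = (\<Sum>f\<in>bijections (insert r I) J. crossing_sign (insert r I) f * (\<Prod>q\<in>insert r I. xr q (f q)))"
    by (rule sum_bijections_insert[symmetric]) (use insert.hyps(1) finJ rI in auto)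
  finally show ?case .
qed

end

lemma sum_permutations_split:
  fixes N :: "'a set"
  assumes I: "I \<subseteq> N" and J: "J \<subseteq> N" and fin: "finite N"
    and h: "\<And>p. p permutes N \<Longrightarrow> p ` I = J \<Longrightarrow> h p = g (restrict p I) * k (restrict p (N - I))"
  shows "(\<Sum>p | p permutes N \<and> p ` I = J. h p) =
    (\<Sum>f\<in>bijections I J. g f) * (\<Sum>f\<in>bijections (N - I) (N - J). k f :: 'b :: comm_semiring_0)"
proof -
  have "(\<Sum>f\<in>bijections I J. g f) * (\<Sum>f\<in>bijections (N - I) (N - J). k f) =
     (\<Sum>x\<in>bijections I J \<times> bijections (N - I) (N - J). g (fst x) * k (snd x))"
    unfolding sum_product by (simp add: sum.cartesian_product case_prod_unfold)
  also have "\<dots> = (\<Sum>p | p permutes N \<and> p ` I = J. h p)"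
  proof (rule sum.reindex_bij_witness[where i = "\<lambda>p. (restrict p I, restrict p (N - I))"
        and j = "\<lambda>(f1, f2) x. if x \<in> I then f1 x else if x \<in> N then f2 x else x"])
    fix x assume "x \<in> bijections I J \<times> bijections (N - I) (N - J)"
    then obtain f1 f2 where x: "x = (f1, f2)" "f1 \<in> I \<rightarrow>\<^sub>E J" "bij_betw f1 I J"
      "f2 \<in> (N - I) \<rightarrow>\<^sub>E (N - J)" "bij_betw f2 (N - I) (N - J)" by (auto simp: bijections_def)
    define p where "p x = (if x \<in> I then f1 x else if x \<in> N then f2 x else x)" for x
    have jx: "(case x of (f1, f2) \<Rightarrow> \<lambda>x. if x \<in> I then f1 x else if x \<in> N then f2 x else x) = p"
      using x(1) by (auto simp: p_def)
    have b1: "bij_betw p I J" using x(3) by (subst bij_betw_cong[of I _ f1]) (auto simp: p_def)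
    have b2: "bij_betw p (N - I) (N - J)" using x(5) by (subst bij_betw_cong[of "N - I" _ f2]) (auto simp: p_def)
    have "bij_betw p (I \<union> (N - I)) (J \<union> (N - J))" by (rule bij_betw_combine[OF b1 b2]) auto
    then have "bij_betw p N N" using I J by (simp add: Un_absorb1)
    then have "p permutes N" by (rule bij_imp_permutes) (use I in \<open>auto simp: p_def\<close>)
    moreover have "p ` I = J" using b1 by (simp add: bij_betw_def)
    ultimately show "(case x of (f1, f2) \<Rightarrow> \<lambda>x. if x \<in> I then f1 x else if x \<in> N then f2 x else x) \<in> {p. p permutes N \<and> p ` I = J}"
      unfolding jx by simp
    have r: "restrict p I = f1" "restrict p (N - I) = f2"
      using x(2,4) by (auto simp: fun_eq_iff p_def PiE_def extensional_def restrict_def)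
    then show "(restrict (case x of (f1, f2) \<Rightarrow> \<lambda>x. if x \<in> I then f1 x else if x \<in> N then f2 x else x) I,
        restrict (case x of (f1, f2) \<Rightarrow> \<lambda>x. if x \<in> I then f1 x else if x \<in> N then f2 x else x) (N - I)) = x"
      unfolding jx using x(1) by simp
    show "h (case x of (f1, f2) \<Rightarrow> \<lambda>x. if x \<in> I then f1 x else if x \<in> N then f2 x else x) = g (fst x) * k (snd x)"
      unfolding jx using h[OF \<open>p permutes N\<close> \<open>p ` I = J\<close>] r x(1) by simp
  next
    fix p assume "p \<in> {p. p permutes N \<and> p ` I = J}"
    then have p: "p permutes N" "p ` I = J" by auto
    have inj: "inj_on p A" for A using permutes_inj_on[OF p(1)] .
    have im: "p ` (N - I) = N - J"
      using inj_on_image_set_diff[OF inj[of N], of N I] permutes_image[OF p(1)] p(2) I by auto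
    show "(case (restrict p I, restrict p (N - I)) of (f1, f2) \<Rightarrow> \<lambda>x. if x \<in> I then f1 x else if x \<in> N then f2 x else x) = p"
      using permutes_not_in[OF p(1)] by (auto simp: fun_eq_iff)
    have "bij_betw (restrict p I) I J" using inj p(2) by (simp add: bij_betw_def)
    moreover have "bij_betw (restrict p (N - I)) (N - I) (N - J)" using inj im by (simp add: bij_betw_def)
    ultimately show "(restrict p I, restrict p (N - I)) \<in> bijections I J \<times> bijections (N - I) (N - J)"
      using p(2) im by (auto simp: bijections_def)
  qed
  finally show ?thesis by simp
qed

context disc_graph begin

text \<open>The two expansions run over independent bijections; \<open>crossing_sign_split\<close>
  is what merges their signs into that of one permutation of all rows.\<close>

lemma zt_product_eq_permutation_sum:
  assumes z: "zt {} \<noteq> 0" and I: "I \<subseteq> {0..<n}" and J: "J \<subseteq> {0..<n}" and c: "card I = card J"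
  shows "zt (nodeset I J) * zt ({1..2*n} - nodeset I J) / (zt {} * zt {}) =
    (\<Sum>p | p permutes {0..<n} \<and> p ` I = J. crossing_sign {0..<n} p * (\<Prod>r\<in>{0..<n}. xr r (p r)))"
proof -
  let ?N = "{0..<n}"
  have fin: "finite I" "finite J" using I J finite_subset by blast+
  have c': "card (?N - I) = card (?N - J)" using c fin I J by (simp add: card_Diff_subset)
  have "{1..2*n} - nodeset I J = nodeset (?N - I) (?N - J)"
    unfolding nodeset_all[symmetric] nodeset_diff ..
  then have "zt (nodeset I J) * zt ({1..2*n} - nodeset I J) / (zt {} * zt {}) =
      (zt (nodeset I J) / zt {}) * (zt (nodeset (?N - I) (?N - J)) / zt {})"
    by simp
  also have "\<dots> = (\<Sum>f\<in>bijections I J. crossing_sign I f * (\<Prod>r\<in>I. xr r (f r))) *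
      (\<Sum>f\<in>bijections (?N - I) (?N - J). crossing_sign (?N - I) f * (\<Prod>r\<in>?N - I. xr r (f r)))"
    by (subst (1 2) zt_eq_pfaffian[OF z]) (use fin I J c c' in auto)
  also have "\<dots> = (\<Sum>p | p permutes ?N \<and> p ` I = J. crossing_sign ?N p * (\<Prod>r\<in>?N. xr r (p r)))"
  proof (rule sum_permutations_split[OF I J, symmetric])
    fix p assume p: "p permutes ?N"
    have "(\<Prod>r\<in>?N. xr r (p r)) = (\<Prod>r\<in>I. xr r (p r)) * (\<Prod>r\<in>?N - I. xr r (p r))"
      using prod.subset_diff[OF I, of "\<lambda>r. xr r (p r)"] by (simp add: mult.commute)
    moreover have "crossing_sign I (restrict p I) = crossing_sign I p"
      "crossing_sign (?N - I) (restrict p (?N - I)) = crossing_sign (?N - I) p"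
      by (rule crossing_sign_cong; simp)+
    ultimately show "crossing_sign ?N p * (\<Prod>r\<in>?N. xr r (p r)) =
        (crossing_sign I (restrict p I) * (\<Prod>r\<in>I. xr r (restrict p I r))) *
        (crossing_sign (?N - I) (restrict p (?N - I)) * (\<Prod>r\<in>?N - I. xr r (restrict p (?N - I) r)))"
      using crossing_sign_split[OF p I] by simp
  qed simp
  finally show ?thesis .
qed

end


section \<open>Pairings as permutations of rows\<close>

text \<open>Undoes \<open>s \<mapsto> 2 * s + 2\<close> on the partner of the odd node; being the
  identity from \<open>n\<close> on makes it a permutation in the sense of
  \<open>permutes\<close>.\<close>

definition row_perm :: "nat \<Rightarrow> (nat \<Rightarrow> nat) \<Rightarrow> nat \<Rightarrow> nat" where
  "row_perm n \<tau> r = (if r < n then \<tau> (2 * r + 1) div 2 - 1 else r)"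

text \<open>The nodes strictly between the ends of a chord are paired among themselves, so their
  number is even.\<close>

lemma noncrossing_parity:
  assumes nc: "noncrossing_pairing {1..2*n} \<tau>" and i: "i \<in> {1..2*n}"
  shows "odd (\<tau> i) \<longleftrightarrow> even i"
proof -
  note D = noncrossing_pairingD[OF nc]
  have *: "odd (\<tau> i) \<longleftrightarrow> even i" if i: "i \<in> {1..2*n}" "i < \<tau> i" for i
  proof -
    have "{k \<in> {1..2*n} - {i, \<tau> i}. i < k \<and> k < \<tau> i \<or> \<tau> i < k \<and> k < i} = {i<..<\<tau> i}"
      using i D(1)[OF i(1)] by auto
    then have "(- 1 :: real) ^ (\<tau> i - Suc i) = 1"
      using noncrossing_prod_between_sign[OF nc _ i(1)] unfolding between_sign_def
      by (simp add: prod_sign_card)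
    then have "even (\<tau> i - Suc i)" by (cases "even (\<tau> i - Suc i)") auto
    then show ?thesis using i(2) by auto
  qed
  show ?thesis
    using *[OF i] *[OF D(1)[OF i]] D(2,3)[OF i] by (cases "i < \<tau> i") auto
qed

lemma row_perm_eq:
  assumes nc: "noncrossing_pairing {1..2*n} \<tau>" and r: "r < n"
  shows "\<tau> (2 * r + 1) = 2 * row_perm n \<tau> r + 2" "row_perm n \<tau> r < n"
proof -
  have i: "2 * r + 1 \<in> {1..2*n}" using r by auto
  have "even (\<tau> (2 * r + 1))" "\<tau> (2 * r + 1) \<in> {1..2*n}"
    using noncrossing_parity[OF nc i] noncrossing_pairingD(1)[OF nc i] by auto
  then obtain m where "\<tau> (2 * r + 1) = 2 * m" "1 \<le> m" "m \<le> n" by (elim evenE) auto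
  then show "\<tau> (2 * r + 1) = 2 * row_perm n \<tau> r + 2" "row_perm n \<tau> r < n"
    using r by (auto simp: row_perm_def)
qed

lemma row_perm_permutes:
  assumes nc: "noncrossing_pairing {1..2*n} \<tau>"
  shows "row_perm n \<tau> permutes {0..<n}"
proof (rule bij_imp_permutes)
  have inj: "inj_on (row_perm n \<tau>) {0..<n}"
  proof (rule inj_onI)
    fix r s assume rs: "r \<in> {0..<n}" "s \<in> {0..<n}" "row_perm n \<tau> r = row_perm n \<tau> s"
    then have "\<tau> (2 * r + 1) = \<tau> (2 * s + 1)" using row_perm_eq(1)[OF nc] by simp
    moreover have "2 * r + 1 \<in> {1..2*n}" "2 * s + 1 \<in> {1..2*n}" using rs by auto
    ultimately have "2 * r + 1 = 2 * s + 1" using noncrossing_pairingD(3)[OF nc] by metis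
    then show "r = s" by simp
  qed
  moreover have "row_perm n \<tau> ` {0..<n} \<subseteq> {0..<n}" using row_perm_eq(2)[OF nc] by auto
  ultimately show "bij_betw (row_perm n \<tau>) {0..<n} {0..<n}"
    using endo_inj_surj[of "{0..<n}"] by (simp add: bij_betw_def)
qed (simp add: row_perm_def)

lemma crossing_sign_row_perm:
  assumes nc: "noncrossing_pairing {1..2*n} \<tau>"
  shows "crossing_sign {0..<n} (row_perm n \<tau>) = 1"
  unfolding crossing_sign_def
proof (rule prod.neutral, clarify)
  fix a b assume "(a, b) \<in> desc_pairs {0..<n}"
  then have ab: "a < n" "b < n" "b < a" by (auto simp: desc_pairs_def)
  have S: "2 * a + 1 \<in> {1..2*n}" "2 * b + 1 \<in> {1..2*n}" using ab by auto
  have "2 * b + 1 \<noteq> \<tau> (2 * a + 1)" using row_perm_eq(1)[OF nc ab(1)] by presburger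
  then have "between_sign (2 * a + 1) (\<tau> (2 * a + 1)) (\<tau> (2 * b + 1)) = between_sign (2 * a + 1) (\<tau> (2 * a + 1)) (2 * b + 1)"
    using noncrossing_between_sign[OF nc S] ab by simp
  then show "chord_sign a (row_perm n \<tau> a) b (row_perm n \<tau> b) = 1"
    unfolding chord_sign_def row_perm_eq(1)[OF nc ab(1), symmetric] row_perm_eq(1)[OF nc ab(2), symmetric]
    by (simp add: between_sign_def)
qed

text \<open>As planar chords join odd to even nodes, alternation just says that a chord has both
  ends or neither end in the set. Read off at the rows, this is
  \<open>r \<in> I \<longleftrightarrow> row_perm n \<tau> r \<in> J\<close>.\<close>

lemma alternates_iff_row_perm:
  assumes nc: "noncrossing_pairing {1..2*n} \<tau>" and I: "I \<subseteq> {0..<n}" and J: "J \<subseteq> {0..<n}"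
  shows "alternates (nodeset I J) {1..2*n} \<tau> \<longleftrightarrow> row_perm n \<tau> ` I = J"
proof -
  let ?p = "row_perm n \<tau>" and ?A = "nodeset I J"
  note D = noncrossing_pairingD[OF nc]
  have "alternates ?A {1..2*n} \<tau> \<longleftrightarrow> (\<forall>i\<in>{1..2*n}. i \<in> ?A \<longleftrightarrow> \<tau> i \<in> ?A)"
    unfolding alternates_def using noncrossing_parity[OF nc] by (intro ball_cong refl) auto
  also have "\<dots> \<longleftrightarrow> (\<forall>r<n. r \<in> I \<longleftrightarrow> ?p r \<in> J)"
  proof
    assume a: "\<forall>i\<in>{1..2*n}. i \<in> ?A \<longleftrightarrow> \<tau> i \<in> ?A"
    show "\<forall>r<n. r \<in> I \<longleftrightarrow> ?p r \<in> J"
    proof (intro allI impI)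
      fix r assume r: "r < n"
      have "2 * r + 1 \<in> ?A \<longleftrightarrow> \<tau> (2 * r + 1) \<in> ?A" using a r by auto
      then show "r \<in> I \<longleftrightarrow> ?p r \<in> J" unfolding row_perm_eq(1)[OF nc r] nodeset_mem .
    qed
  next
    assume a: "\<forall>r<n. r \<in> I \<longleftrightarrow> ?p r \<in> J"
    have odd: "2 * r + 1 \<in> ?A \<longleftrightarrow> \<tau> (2 * r + 1) \<in> ?A" if "r < n" for r
      unfolding row_perm_eq(1)[OF nc that] nodeset_mem using a that by simp
    show "\<forall>i\<in>{1..2*n}. i \<in> ?A \<longleftrightarrow> \<tau> i \<in> ?A"
    proof
      fix i assume i: "i \<in> {1..2*n}"
      show "i \<in> ?A \<longleftrightarrow> \<tau> i \<in> ?A"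
      proof (cases "odd i")
        case True
        then obtain r where "i = 2 * r + 1" by (elim oddE)
        then show ?thesis using odd[of r] i by auto
      next
        case False
        then have "odd (\<tau> i)" using noncrossing_parity[OF nc i] by simp
        then obtain r where r: "\<tau> i = 2 * r + 1" by (elim oddE)
        then have "r < n" using D(1)[OF i] by auto
        then show ?thesis using odd[of r] r D(3)[OF i] by simp
      qed
    qed
  qed
  also have "\<dots> \<longleftrightarrow> ?p ` I = J"
  proof
    assume a: "\<forall>r<n. r \<in> I \<longleftrightarrow> ?p r \<in> J"
    show "?p ` I = J"
    proof (intro equalityI subsetI)
      fix s assume s: "s \<in> J"
      then have "s \<in> ?p ` {0..<n}" using J permutes_image[OF row_perm_permutes[OF nc]] by auto
      then show "s \<in> ?p ` I" using a s by auto
    qed (use a I in auto)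
  next
    assume "?p ` I = J"
    then show "\<forall>r<n. r \<in> I \<longleftrightarrow> ?p r \<in> J"
      using permutes_inj[OF row_perm_permutes[OF nc]] by (auto dest: injD)
  qed
  finally show ?thesis .
qed

text \<open>In the expanded product, \<open>I\<close> is the set of rows that take the summand with
  \<open>a\<close> and \<open>b\<close>. The coefficient of \<open>w m\<close> depends on
  \<open>m\<close> only through the image of \<open>I\<close>, so the sum is determined by the
  partial sums of \<open>w\<close> over all \<open>m\<close> with a prescribed image.\<close>

lemma sum_weighted_products:
  fixes P :: "'i \<Rightarrow> nat \<Rightarrow> nat" and w :: "'i \<Rightarrow> real"
  assumes fin: "finite L" "finite N" and P: "\<And>m. m \<in> L \<Longrightarrow> P m permutes N"
  shows "(\<Sum>m\<in>L. w m * (\<Prod>r\<in>N. a r * b (P m r) + c r * d (P m r))) =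
    (\<Sum>I\<in>Pow N. \<Sum>J\<in>Pow N. (prod a I * prod b J * prod c (N - I) * prod d (N - J)) *
      (\<Sum>m | m \<in> L \<and> P m ` I = J. w m))"
proof -
  let ?K = "\<lambda>I J. prod a I * prod b J * prod c (N - I) * prod d (N - J)"
  have ex: "(\<Prod>r\<in>N. a r * b (P m r) + c r * d (P m r)) = (\<Sum>I\<in>Pow N. ?K I (P m ` I))" if l: "m \<in> L" for m
    unfolding prod_add[OF fin(2)]
  proof (rule sum.cong[OF refl])
    fix I assume I: "I \<in> Pow N"
    have inj: "inj_on (P m) A" for A using permutes_inj_on[OF P[OF l]] .
    have im: "N - P m ` I = P m ` (N - I)"
      using inj_on_image_set_diff[OF inj[of N], of N I] permutes_image[OF P[OF l]] I by auto
    show "(\<Prod>r\<in>I. a r * b (P m r)) * (\<Prod>r\<in>N - I. c r * d (P m r)) = ?K I (P m ` I)"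
      unfolding im prod.reindex[OF inj] by (simp add: prod.distrib mult_ac)
  qed
  have "(\<Sum>m\<in>L. w m * (\<Prod>r\<in>N. a r * b (P m r) + c r * d (P m r))) =
      (\<Sum>I\<in>Pow N. \<Sum>m\<in>L. w m * ?K I (P m ` I))"
    by (subst sum.swap) (simp add: ex sum_distrib_left)
  also have "\<dots> = (\<Sum>I\<in>Pow N. \<Sum>J\<in>Pow N. ?K I J * (\<Sum>m | m \<in> L \<and> P m ` I = J. w m))"
  proof (rule sum.cong[OF refl])
    fix I assume I: "I \<in> Pow N"
    have "(\<Sum>m\<in>L. w m * ?K I (P m ` I)) =
        (\<Sum>J\<in>Pow N. \<Sum>m | m \<in> L \<and> P m ` I = J. w m * ?K I (P m ` I))"
    proof (rule sum.group[symmetric])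
      show "(\<lambda>m. P m ` I) ` L \<subseteq> Pow N" using permutes_image[OF P] I by blast
    qed (use fin in auto)
    also have "\<dots> = (\<Sum>J\<in>Pow N. ?K I J * (\<Sum>m | m \<in> L \<and> P m ` I = J. w m))"
      unfolding sum_distrib_left by (intro sum.cong refl) (simp add: mult.commute)
    finally show "(\<Sum>m\<in>L. w m * ?K I (P m ` I)) = (\<Sum>J\<in>Pow N. ?K I J * (\<Sum>m | m \<in> L \<and> P m ` I = J. w m))" .
  qed
  finally show ?thesis .
qed

section \<open>Tripartite colourings\<close>

text \<open>A cyclic interval that wraps around is the complement of an ordinary one; this reduces
  questions about it to inequalities.\<close>

lemma cyclic_interval_cases:
  assumes "cyclic_interval N S" "N > 0"
  obtains l u where "S = {l..u}" | l u where "S = {1..N} - {l..u}"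
proof -
  obtain a0 len where S0: "S = (\<lambda>k. (a0 + k) mod N + 1) ` {..<len}"
    using assms(1) by (auto simp: cyclic_interval_def)
  define a where "a = a0 mod N"
  have a: "a < N" using assms(2) by (simp add: a_def)
  have S: "S = (\<lambda>k. (a + k) mod N + 1) ` {..<len}"
    unfolding S0 a_def by (simp add: mod_add_left_eq)
  have val: "(a + k) mod N = (if a + k < N then a + k else a + k - N)" if "k < N" for k
    using that a by (simp add: mod_if)
  consider "len \<ge> N" | "len < N" "a + len \<le> N" | "len < N" "a + len > N" by linarith
  then show ?thesis
  proof cases
    case 1
    have "S = {1..N}"
    proof (intro equalityI subsetI)
      fix x assume "x \<in> {1..N}"
      then have x: "1 \<le> x" "x \<le> N" by auto
      \<comment> \<open>The offset from the zero-based position \<open>a\<close> to the position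
        \<open>x - 1\<close>, with a full turn added when the latter comes first.\<close>
      define k where "k = (if a < x then x - 1 - a else x - 1 + N - a)"
      have "k < N" "(a + k) mod N + 1 = x" using x a val[of k] by (auto simp: k_def)
      then show "x \<in> S" unfolding S using 1 by (intro image_eqI[of _ _ k]) auto
    qed (use assms(2) in \<open>auto simp: S Suc_le_eq\<close>)
    then show ?thesis using that(1) by blast
  next
    case 2
    have "S = {a + 1..a + len}"
    proof (intro equalityI subsetI)
      fix x assume "x \<in> S"
      then obtain k where k: "k < len" "x = (a + k) mod N + 1" unfolding S by auto
      then show "x \<in> {a + 1..a + len}" using val[of k] 2 by auto
    next
      fix x assume x: "x \<in> {a + 1..a + len}"
      define k where "k = x - 1 - a"
      have "k < len" "(a + k) mod N + 1 = x" using x 2 val[of k] by (auto simp: k_def)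
      then show "x \<in> S" unfolding S by (intro image_eqI[of _ _ k]) auto
    qed
    then show ?thesis using that(1) by blast
  next
    case 3
    have "S = {1..N} - {a + len - N + 1..a}"
    proof (intro equalityI subsetI)
      fix x assume "x \<in> S"
      then obtain k where k: "k < len" "x = (a + k) mod N + 1" unfolding S by auto
      then show "x \<in> {1..N} - {a + len - N + 1..a}" using val[of k] 3 a by auto
    next
      fix x assume x: "x \<in> {1..N} - {a + len - N + 1..a}"
      define k where "k = (if a < x then x - 1 - a else x - 1 + N - a)"
      have "k < len" "(a + k) mod N + 1 = x" using x 3 a val[of k] by (auto simp: k_def)
      then show "x \<in> S" unfolding S by (intro image_eqI[of _ _ k]) auto
    qed
    then show ?thesis using that(2) by blast
  qed
qed

text \<open>A cyclic interval and its complement cannot interlace, so four nodes in order never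
  alternate between having colour \<open>x\<close> and not having it. The two forms differ in where
  the pattern starts.\<close>

lemma contiguous_no_alternation:
  assumes "contiguously_colored n color" "1 \<le> a" "a < b" "b < c" "c < d" "d \<le> 2*n"
  shows "color a = x \<Longrightarrow> color c = x \<Longrightarrow> color b \<noteq> x \<Longrightarrow> color d = x"
    and "color b = x \<Longrightarrow> color d = x \<Longrightarrow> color a \<noteq> x \<Longrightarrow> color c = x"
proof -
  let ?S = "{i \<in> {1..2*n}. color i = x}"
  have ci: "cyclic_interval (2*n) ?S" using assms(1) by (simp add: contiguously_colored_def)
  have n: "2 * n > 0" using assms by simp
  have mem: "i \<in> ?S \<longleftrightarrow> color i = x" if "i \<in> {a, b, c, d}" for i using assms that by auto
  have "(a \<in> ?S \<longrightarrow> c \<in> ?S \<longrightarrow> b \<notin> ?S \<longrightarrow> d \<in> ?S) \<and> (b \<in> ?S \<longrightarrow> d \<in> ?S \<longrightarrow> a \<notin> ?S \<longrightarrow> c \<in> ?S)"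
    using ci n
  proof (cases rule: cyclic_interval_cases)
    case (1 l u)
    show ?thesis unfolding 1 using assms by auto
  next
    case (2 l u)
    show ?thesis unfolding 2 using assms by auto
  qed
  then show "color a = x \<Longrightarrow> color c = x \<Longrightarrow> color b \<noteq> x \<Longrightarrow> color d = x"
    "color b = x \<Longrightarrow> color d = x \<Longrightarrow> color a \<noteq> x \<Longrightarrow> color c = x"
    using mem by auto
qed

text \<open>In cyclic order the colours form blocks. Their vectors are \<open>(1, 0)\<close>, \<open>(0, 1)\<close> and \<open>(-1, 1)\<close>,
  and the colour of node 1 gets \<open>(-1, 0)\<close> where it reappears at the end.\<close>

lemma colour_vectors:
  assumes cc: "contiguously_colored n color"
  shows "\<exists>u w :: nat \<Rightarrow> real. \<forall>i j. 1 \<le> i \<longrightarrow> i < j \<longrightarrow> j \<le> 2*n \<longrightarrow>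
    u i * w j - w i * u j = of_bool (color i \<noteq> color j)"
proof -
  define x where "x = color 1"
  define early where "early i \<longleftrightarrow> (\<forall>k. 1 \<le> k \<longrightarrow> k \<le> i \<longrightarrow> color k = x)" for i
  define m where "m = (LEAST k. 1 \<le> k \<and> color k \<noteq> x)"
  define u :: "nat \<Rightarrow> real" where
    "u i = (if color i = x then (if early i then 1 else -1) else if color i = color m then 0 else -1)" for i
  define w :: "nat \<Rightarrow> real" where "w i = (if color i = x then 0 else 1)" for i
  have "u i * w j - w i * u j = of_bool (color i \<noteq> color j)" if ij: "1 \<le> i" "i < j" "j \<le> 2*n" for i j
  proof (cases "color i = x")
    case True
    have "color j = x" if ne: "\<not> early i"
    proof -
      obtain k where k: "1 \<le> k" "k \<le> i" "color k \<noteq> x" using ne early_def by blast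
      then have "1 < k" "k < i" using True x_def by (auto simp: order.order_iff_strict)
      then show ?thesis using contiguous_no_alternation(1)[OF cc, of 1 k i j x] ij True k x_def by auto
    qed
    then show ?thesis using True by (auto simp: u_def w_def)
  next
    case False
    then have ej: "\<not> early j" using ij unfolding early_def by (meson less_imp_le_nat)
    have m: "1 \<le> m" "color m \<noteq> x" "m \<le> i"
      using LeastI[of "\<lambda>k. 1 \<le> k \<and> color k \<noteq> x" i] Least_le[of "\<lambda>k. 1 \<le> k \<and> color k \<noteq> x" i] False ij
      unfolding m_def by auto
    \<comment> \<open>A node of the second colour cannot follow one of the third: nodes
      \<open>1\<close>, \<open>m\<close>, \<open>i\<close>, \<open>j\<close> would
      alternate.\<close>
    have third: "color i = color m" if cj: "color j = color m"
    proof (rule ccontr)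
      assume ci: "color i \<noteq> color m"
      have "1 < m" "m < i" using m ci x_def by (auto simp: order.order_iff_strict)
      then show False
        using contiguous_no_alternation(2)[OF cc, of 1 m i j "color m"] ij cj ci m x_def by auto
    qed
    have rgb: "color i = color j" if "color i \<noteq> color m" "color j \<noteq> color m" "color j \<noteq> x"
      using that False m(2) by (cases "color i"; cases "color j"; cases "color m"; cases x) auto
    show ?thesis
      using False ej third rgb m(2) by (auto simp: u_def w_def)
  qed
  then show ?thesis by blast
qed

text \<open>The surplus of nodes not coloured \<open>x\<close> over those coloured \<open>x\<close>.
  On a set closed under a pairing of unlike colours it is nonnegative, as no chord has both ends
  coloured \<open>x\<close>.\<close>

definition colour_balance :: "(nat \<Rightarrow> rgb) \<Rightarrow> rgb \<Rightarrow> nat set \<Rightarrow> int" where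
  "colour_balance color x U = (\<Sum>i\<in>U. if color i = x then -1 else 1)"

lemma colour_balance_nonneg:
  assumes "finite U" and \<tau>: "\<And>i. i \<in> U \<Longrightarrow> \<tau> i \<in> U \<and> \<tau> (\<tau> i) = i \<and> color i \<noteq> color (\<tau> i)"
  shows "colour_balance color x U \<ge> 0"
proof -
  let ?g = "\<lambda>i. if color i = x then -1 else 1 :: int"
  have "(\<Sum>i\<in>U. ?g i) = (\<Sum>i\<in>U. ?g (\<tau> i))"
    by (rule sum.reindex_bij_witness[where i = \<tau> and j = \<tau>]) (use \<tau> in auto)
  then have "2 * (\<Sum>i\<in>U. ?g i) = (\<Sum>i\<in>U. ?g i + ?g (\<tau> i))" by (simp add: sum.distrib)
  also have "\<dots> \<ge> 0"
  proof (rule sum_nonneg)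
    fix i assume "i \<in> U"
    then have "color i \<noteq> color (\<tau> i)" using \<tau> by blast
    then show "0 \<le> ?g i + ?g (\<tau> i)" by auto
  qed
  finally show ?thesis by (simp add: colour_balance_def)
qed

lemma colour_balance_two:
  assumes "\<And>i. i \<in> U \<Longrightarrow> color i = x \<or> color i = y" "x \<noteq> y"
  shows "colour_balance color y U = - colour_balance color x U"
  unfolding colour_balance_def sum_negf[symmetric] by (rule sum.cong) (use assms in auto)

lemma colour_balance_Un:
  "finite U \<Longrightarrow> finite V \<Longrightarrow> U \<inter> V = {} \<Longrightarrow>
    colour_balance color x (U \<union> V) = colour_balance color x U + colour_balance color x V"
  unfolding colour_balance_def by (rule sum.union_disjoint)

lemma noncrossing_interval_closed:
  assumes nc: "noncrossing_pairing {1..2*n} \<sigma>" and i: "i \<in> {1..2*n}" "i < \<sigma> i"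
  shows "k \<in> {i<..<\<sigma> i} \<Longrightarrow> \<sigma> k \<in> {i<..<\<sigma> i}"
    and "k \<in> {1..2*n} - {i..\<sigma> i} \<Longrightarrow> \<sigma> k \<in> {1..2*n} - {i..\<sigma> i}"
proof -
  note D = noncrossing_pairingD[OF nc]
  have *: "\<sigma> k \<in> {i<..<\<sigma> i}" if k: "k \<in> {i<..<\<sigma> i}" for k
  proof -
    have "k \<in> {1..2*n}" using k i D(1)[OF i(1)] by auto
    then show ?thesis using noncrossing_pairing_cross[OF nc i(1), of k] k by auto
  qed
  then show "k \<in> {i<..<\<sigma> i} \<Longrightarrow> \<sigma> k \<in> {i<..<\<sigma> i}" .
  assume k: "k \<in> {1..2*n} - {i..\<sigma> i}"
  then have kS: "k \<in> {1..2*n}" by blast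
  have "\<sigma> k \<notin> {i<..<\<sigma> i}" using *[of "\<sigma> k"] D(3)[OF kS] k by auto
  moreover have "\<sigma> k \<noteq> i" "\<sigma> k \<noteq> \<sigma> i" using D(3)[OF kS] D(3)[OF i(1)] k i by auto
  ultimately show "\<sigma> k \<in> {1..2*n} - {i..\<sigma> i}" using D(1)[OF kS] by auto
qed

text \<open>The nodes \<open>i\<close>, \<open>\<sigma> i\<close>, \<open>\<tau> i\<close> cut the
  circle into three open arcs, and the pieces closed under \<sigma> or \<tau> have nonnegative
  balance for every colour. Contiguity restricts the colours on the arcs, and on an arc with only
  two colours their balances are opposite. Together with the contributions of the nodes
  \<open>j\<close> and \<open>k\<close> this forces some balance to be negative.\<close>

lemma tripartite_pairing_arcs:
  assumes cc: "contiguously_colored n color"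
    and \<sigma>: "noncrossing_pairing {1..2*n} \<sigma>" "\<And>i. i \<in> {1..2*n} \<Longrightarrow> color i \<noteq> color (\<sigma> i)"
    and \<tau>: "noncrossing_pairing {1..2*n} \<tau>" "\<And>i. i \<in> {1..2*n} \<Longrightarrow> color i \<noteq> color (\<tau> i)"
    and i: "i \<in> {1..2*n}" "i < \<sigma> i" "\<sigma> i < \<tau> i"
  shows False
proof -
  define j k where "j = \<sigma> i" and "k = \<tau> i"
  define x y z where "x = color i" and "y = color j" and "z = color k"
  have xy: "x \<noteq> y" "x \<noteq> z" using \<sigma>(2)[OF i(1)] \<tau>(2)[OF i(1)] by (auto simp: x_def y_def z_def j_def k_def)
  have ij: "1 \<le> i" "i < j" "j < k" "k \<le> 2*n"
    using i noncrossing_pairingD(1)[OF \<tau>(1) i(1)] by (auto simp: j_def k_def)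
  have ci: "color i = x" "color j = y" "color k = z" by (simp_all add: x_def y_def z_def)
  note alt = contiguous_no_alternation[OF cc]
  define U where "U = {i<..<j}"
  define W where "W = {j<..<k}"
  define V' where "V' = {1..2*n} - {i..k}"
  have fin: "finite U" "finite W" "finite V'" by (auto simp: U_def W_def V'_def)
  have kS: "k \<in> {1..2*n}" using ij by auto
  have ik: "i < \<tau> i" using i by simp
  let ?B = "colour_balance color"
  have pos: "?B c U \<ge> 0" "?B c (U \<union> {j} \<union> W) \<ge> 0" "?B c V' \<ge> 0" "?B c (W \<union> {k} \<union> V') \<ge> 0" for c
  proof -
    have "U = {i<..<\<sigma> i}" by (simp add: U_def j_def)
    then show "?B c U \<ge> 0"
      using noncrossing_interval_closed(1)[OF \<sigma>(1) i(1,2)] noncrossing_pairingD(3)[OF \<sigma>(1)] \<sigma>(2) ij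
      by (intro colour_balance_nonneg[where \<tau> = \<sigma>]) (auto simp: j_def)
    have "U \<union> {j} \<union> W = {i<..<\<tau> i}" using ij by (auto simp: U_def W_def k_def)
    then show "?B c (U \<union> {j} \<union> W) \<ge> 0"
      using noncrossing_interval_closed(1)[OF \<tau>(1) i(1) ik] noncrossing_pairingD(3)[OF \<tau>(1)] \<tau>(2) ij
      by (intro colour_balance_nonneg[where \<tau> = \<tau>]) (auto simp: k_def)
    have "V' = {1..2*n} - {i..\<tau> i}" by (simp add: V'_def k_def)
    then show "?B c V' \<ge> 0"
      using noncrossing_interval_closed(2)[OF \<tau>(1) i(1) ik] noncrossing_pairingD(3)[OF \<tau>(1)] \<tau>(2)
      by (intro colour_balance_nonneg[where \<tau> = \<tau>]) auto
    have "W \<union> {k} \<union> V' = {1..2*n} - {i..\<sigma> i}" using ij by (auto simp: V'_def W_def j_def)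
    then show "?B c (W \<union> {k} \<union> V') \<ge> 0"
      using noncrossing_interval_closed(2)[OF \<sigma>(1) i(1,2)] noncrossing_pairingD(3)[OF \<sigma>(1)] \<sigma>(2)
      by (intro colour_balance_nonneg[where \<tau> = \<sigma>]) auto
  qed
  have dis: "U \<inter> {j} = {}" "(U \<union> {j}) \<inter> W = {}" "W \<inter> {k} = {}" "(W \<union> {k}) \<inter> V' = {}"
    using ij by (auto simp: U_def W_def V'_def)
  have add: "?B c (U \<union> {j} \<union> W) = ?B c U + ?B c {j} + ?B c W"
    "?B c (W \<union> {k} \<union> V') = ?B c W + ?B c {k} + ?B c V'" for c
    using fin dis by (simp_all only: colour_balance_Un finite_Un finite.emptyI finite_insert)
  have single: "?B c {j} = (if y = c then -1 else 1)" "?B c {k} = (if z = c then -1 else 1)" for c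
    by (simp_all add: colour_balance_def y_def z_def)
  show False
  proof (cases "z = y")
    case True
    have Wy: "color m = y" if m: "m \<in> W" for m
    proof (rule ccontr)
      assume "color m \<noteq> y"
      then show False using alt(2)[of i j m k y] ij m xy True by (auto simp: W_def x_def y_def z_def)
    qed
    then have W: "?B y W = - int (card W)" "?B x W = int (card W)"
      using xy by (auto simp: colour_balance_def)
    \<comment> \<open>A third colour may occur in \<open>U\<close> or in \<open>V'\<close> but not
      in both, since it would alternate with the colours of \<open>i\<close> and \<open>j\<close>.
      The arc without it gives the contradiction.\<close>
    show False
    proof (cases "\<forall>m\<in>U. color m = x \<or> color m = y")
      case True
      then have "?B y U = - ?B x U" using xy by (intro colour_balance_two) auto
      then show False using pos(1)[of x] pos(2)[of y] add(1)[of y] single[of y] W by simp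
    next
      case False
      then obtain q where q: "q \<in> U" "color q \<noteq> x" "color q \<noteq> y" by blast
      have c3: "color m = x \<or> color m = y" if "color m \<noteq> color q" for m
        using q xy that by (cases "color m"; cases "color q"; cases x; cases y) auto
      have V': "color m = x \<or> color m = y" if m: "m \<in> V'" for m
      proof (rule c3, rule notI)
        assume mq: "color m = color q"
        consider "1 \<le> m" "m < i" | "k < m" "m \<le> 2*n" using m by (auto simp: V'_def)
        then show False
        proof cases
          case 1
          then show False using alt(1)[of m i q j "color q"] q mq ij by (auto simp: U_def x_def y_def)
        next
          case 2
          then show False using alt(2)[of i q j m "color q"] q mq ij by (auto simp: U_def x_def y_def)
        qed
      qed
      then have "?B y V' = - ?B x V'" using xy by (intro colour_balance_two) auto
      then show False using pos(3)[of x] pos(4)[of y] add(2)[of y] single[of y] W True by simp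
    qed
  next
    case False
    \<comment> \<open>Now the three colours occur at \<open>i\<close>, \<open>j\<close>,
      \<open>k\<close>, and contiguity confines each arc to the colours of its two ends.\<close>
    have c3: "color m = x \<or> color m = y \<or> color m = z" for m
      using xy False by (cases "color m"; cases z; cases x; cases y) auto
    have "color m = x \<or> color m = y" if m: "m \<in> U" for m
    proof (rule ccontr)
      assume "\<not> ?thesis"
      then have "color m = z" using c3 by blast
      then show False using alt(2)[of i m j k z] ij m xy False ci by (simp add: U_def)
    qed
    then have U: "?B y U = - ?B x U" using xy by (intro colour_balance_two) auto
    have "color m = y \<or> color m = z" if m: "m \<in> W" for m
    proof (rule ccontr)
      assume "\<not> ?thesis"
      then have "color m = x" using c3 by blast
      then show False using alt(1)[of i j m k x] ij m xy False ci by (simp add: W_def)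
    qed
    then have W: "?B z W = - ?B y W" using False by (intro colour_balance_two) auto
    have "color m = x \<or> color m = z" if m: "m \<in> V'" for m
    proof (rule ccontr)
      assume "\<not> ?thesis"
      then have my: "color m = y" using c3 by blast
      consider "1 \<le> m" "m < i" | "k < m" "m \<le> 2*n" using m by (auto simp: V'_def)
      then show False
      proof cases
        case 1
        then show False using alt(1)[of m i j k y] my xy False ij ci by simp
      next
        case 2
        then show False using alt(2)[of i j k m y] my xy False ij ci by simp
      qed
    qed
    then have V': "?B z V' = - ?B x V'" using xy by (intro colour_balance_two) auto
    show False
      using pos(1)[of x] pos(2)[of y] pos(3)[of x] pos(4)[of z] add(1)[of y] add(2)[of z]
        single(1)[of y] single(2)[of z] U W V' by simp
  qed
qed

text \<open>At the least node where the pairings differ, both partners lie above it, since a smaller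
  partner would already be settled. Then \<open>tripartite_pairing_arcs\<close> excludes either
  order of the partners.\<close>

lemma tripartite_pairing_unique:
  assumes cc: "contiguously_colored n color"
    and \<sigma>: "noncrossing_pairing {1..2*n} \<sigma>" "\<And>i. i \<in> {1..2*n} \<Longrightarrow> color i \<noteq> color (\<sigma> i)"
    and \<tau>: "noncrossing_pairing {1..2*n} \<tau>" "\<And>i. i \<in> {1..2*n} \<Longrightarrow> color i \<noteq> color (\<tau> i)"
    and i: "i \<in> {1..2*n}"
  shows "\<sigma> i = \<tau> i"
  using i
proof (induction i rule: less_induct)
  case (less i)
  note D\<sigma> = noncrossing_pairingD[OF \<sigma>(1) less.prems] and D\<tau> = noncrossing_pairingD[OF \<tau>(1) less.prems]
  show ?case
  proof (rule ccontr)
    assume ne: "\<sigma> i \<noteq> \<tau> i"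
    have "\<not> \<sigma> i < i"
    proof
      assume "\<sigma> i < i"
      then have "\<tau> (\<sigma> i) = i" using less.IH[OF _ D\<sigma>(1)] D\<sigma>(3) by simp
      then show False using noncrossing_pairingD(3)[OF \<tau>(1) D\<sigma>(1)] ne by simp
    qed
    moreover have "\<not> \<tau> i < i"
    proof
      assume "\<tau> i < i"
      then have "\<sigma> (\<tau> i) = i" using less.IH[OF _ D\<tau>(1)] D\<tau>(3) by simp
      then show False using noncrossing_pairingD(3)[OF \<sigma>(1) D\<tau>(1)] ne by simp
    qed
    ultimately have "i < \<sigma> i" "i < \<tau> i" using D\<sigma>(2) D\<tau>(2) by auto
    then show False
      using tripartite_pairing_arcs[OF cc \<sigma> \<tau> less.prems] tripartite_pairing_arcs[OF cc \<tau> \<sigma> less.prems] ne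
      by (metis linorder_neqE_nat)
  qed
qed


section \<open>The determinant formula\<close>

lemma disc_graphI:
  assumes "noded_bipartite_graph n G" "plane_embedding G pos crv" "nodes_counterclockwise n G pos crv"
  shows "disc_graph G n"
proof -
  interpret bipartite_graph G using assms(1) by (rule noded_bipartite_graph_imp)
  show ?thesis
  proof
    show "i \<in> {1..2*n} \<Longrightarrow> node G i \<in> verts G" for i
      using assms(1) by (auto simp: noded_bipartite_graph_def nodes_def)
    show "inj_on (node G) {1..2*n}" using assms(1) by (simp add: noded_bipartite_graph_def)
  qed (rule joined_noncrossing[OF assms])
qed

lemma planar_pairing_noncrossing:
  assumes "planar_pairing n \<sigma>"
  shows "noncrossing_pairing {1..2*n} \<sigma>"
  unfolding noncrossing_pairing_def
proof (intro conjI ballI impI)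
  have p: "\<sigma> i \<in> {1..2*n}" "\<sigma> i \<noteq> i" "\<sigma> (\<sigma> i) = i" if "i \<in> {1..2*n}" for i
    using assms that by (auto simp: planar_pairing_def is_pairing_def)
  fix a assume a: "a \<in> {1..2*n}"
  show "\<sigma> a \<in> {1..2*n}" "\<sigma> a \<noteq> a" "\<sigma> (\<sigma> a) = a" using p[OF a] by auto
  fix b assume b: "b \<in> {1..2*n}" "a < b" "b < \<sigma> a"
  show "\<sigma> b < \<sigma> a"
  proof (rule ccontr)
    assume "\<not> \<sigma> b < \<sigma> a"
    moreover have "\<sigma> b \<noteq> \<sigma> a" using p(3)[OF a] p(3)[OF b(1)] b(2) by auto
    ultimately have "\<sigma> a < \<sigma> b" by simp
    then show False
      using assms a b p(1)[OF a] p(1)[OF b(1)] unfolding planar_pairing_def by blast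
  qed
qed

context disc_graph begin

section \<open>The case of all nodes\<close>

lemma conf_all: "conf {1..2*n} = double_dimer_configs n G"
proof -
  have "of_bool (v \<in> toggled {}) + of_bool (v \<in> toggled {1..2*n}) = (if v \<in> nodes n G then 1 else 2 :: nat)"
    if v: "v \<in> verts G" for v
  proof (cases "v \<in> nodes n G")
    case True
    then obtain i where i: "i \<in> {1..2*n}" "v = node G i" by (auto simp: nodes_def)
    then show ?thesis using True unfolding i(2) node_toggled[OF i(1) empty_subsetI] node_toggled[OF i(1) subset_refl] by auto
  next
    case False
    then have "v \<in> BW n G" using v unfolding BW_def nodes_def by blast
    then show ?thesis using False by (auto simp: toggled_def nodes_def)
  qed
  then show ?thesis unfolding conf_def configs_def double_dimer_configs_def deg_def by auto
qed

lemma toggled_all: "toggled {1..2*n} = WB n G"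
proof (rule Set.set_eqI)
  fix v
  show "v \<in> toggled {1..2*n} \<longleftrightarrow> v \<in> WB n G"
  proof (cases "v \<in> node G ` {1..2*n}")
    case True
    then obtain i where i: "i \<in> {1..2*n}" "v = node G i" by blast
    let ?W = "{i \<in> {1..2*n}. \<not> (\<not> black G (node G i) \<and> odd i \<or> black G (node G i) \<and> even i)}"
    have "node G i \<in> node G ` ?W \<longleftrightarrow> i \<in> ?W" by (rule node_image_iff[OF i(1)]) blast
    then have "v \<in> WB n G \<longleftrightarrow> (black G (node G i) \<longleftrightarrow> even i)"
      unfolding WB_def i(2) using nodesV[OF i(1)] i(1) by blast
    then show ?thesis unfolding i(2) node_toggled[OF i(1) subset_refl] using i(1) by auto
  next
    case False
    then have "v \<in> WB n G \<longleftrightarrow> v \<in> verts G" "v \<in> BW n G \<longleftrightarrow> v \<in> verts G" unfolding WB_def BW_def by blast+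
    then show ?thesis using False by (auto simp: toggled_def)
  qed
qed

lemma zt_empty: "zt {} = Z G (BW n G)" and zt_all: "zt {1..2*n} = Z G (WB n G)"
  by (simp_all only: zt_def toggled_all) (simp add: toggled_def)

lemma X_eq_xr: "X n G (2 * r + 1) (2 * s + 2) = xr r s"
  unfolding X_def xr_def zt_empty by (simp add: zt_def toggled_def BW_toggle_def)

text \<open>Both sides are expanded by \<open>sum_weighted_products\<close>, and the partial sums at
  each \<open>(I, J)\<close> agree: for equal cardinalities they are two evaluations of the same
  normalized product of \<open>zt\<close> at a node set and at its complement, and otherwise both
  are empty.\<close>

lemma config_sum_eq_permutation_sum:
  assumes z: "zt {} \<noteq> 0"
  shows "(\<Sum>M\<in>double_dimer_configs n G. config_weight G M / (zt {} * zt {}) *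
      (\<Prod>r\<in>{0..<n}. a r * b (row_perm n (mate M {1..2*n}) r) + c r * d (row_perm n (mate M {1..2*n}) r))) =
    (\<Sum>p | p permutes {0..<n}. crossing_sign {0..<n} p * (\<Prod>r\<in>{0..<n}. xr r (p r)) *
      (\<Prod>r\<in>{0..<n}. a r * b (p r) + c r * d (p r)))"
proof -
  let ?N = "{0..<n}" and ?S = "{1..2*n}"
  let ?P = "\<lambda>M. row_perm n (mate M ?S)"
  have fin: "finite (conf ?S)" unfolding conf_def by (intro finite_configs toggled_verts subset_refl empty_subsetI)
  have nc: "noncrossing_pairing ?S (mate M ?S)" if "M \<in> conf ?S" for M
    by (rule mate_noncrossing[OF subset_refl that])
  have eq: "(\<Sum>M | M \<in> conf ?S \<and> ?P M ` I = J. config_weight G M / (zt {} * zt {})) =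
      (\<Sum>p | p permutes ?N \<and> p ` I = J. crossing_sign ?N p * (\<Prod>r\<in>?N. xr r (p r)))"
    if I: "I \<subseteq> ?N" and J: "J \<subseteq> ?N" for I J
  proof (cases "card I = card J")
    case True
    have "(\<Sum>M | M \<in> conf ?S \<and> ?P M ` I = J. config_weight G M / (zt {} * zt {})) =
        (\<Sum>M\<in>conf ?S. if ?P M ` I = J then config_weight G M / (zt {} * zt {}) else 0)"
      by (rule sum.inter_filter[OF fin])
    also have "\<dots> = (\<Sum>M\<in>conf ?S. config_weight G M * of_bool (alternates (nodeset I J) ?S (mate M ?S))) / (zt {} * zt {})"
      unfolding sum_divide_distrib using alternates_iff_row_perm[OF nc I J] by (intro sum.cong refl) auto
    also have "\<dots> = zt (nodeset I J) * zt (?S - nodeset I J) / (zt {} * zt {})"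
      using zt_mult[OF subset_refl nodeset_subset[OF I J]] by simp
    finally show ?thesis using zt_product_eq_permutation_sum[OF z I J True] by simp
  next
    case False
    have no: "p ` I \<noteq> J" if "p permutes ?N" for p
      using False card_image[OF permutes_inj_on[OF that], of I] by auto
    have "{M. M \<in> conf ?S \<and> ?P M ` I = J} = {}" "{p. p permutes ?N \<and> p ` I = J} = {}"
      using no no[OF row_perm_permutes[OF nc]] by auto
    then show ?thesis by (simp only: sum.empty)
  qed
  have "(\<Sum>M\<in>conf ?S. config_weight G M / (zt {} * zt {}) * (\<Prod>r\<in>?N. a r * b (?P M r) + c r * d (?P M r))) =
    (\<Sum>I\<in>Pow ?N. \<Sum>J\<in>Pow ?N. (prod a I * prod b J * prod c (?N - I) * prod d (?N - J)) *
      (\<Sum>M | M \<in> conf ?S \<and> ?P M ` I = J. config_weight G M / (zt {} * zt {})))"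
    by (rule sum_weighted_products[OF fin finite_atLeastLessThan row_perm_permutes[OF nc]])
  also have "\<dots> = (\<Sum>I\<in>Pow ?N. \<Sum>J\<in>Pow ?N. (prod a I * prod b J * prod c (?N - I) * prod d (?N - J)) *
      (\<Sum>p | p \<in> {p. p permutes ?N} \<and> p ` I = J. crossing_sign ?N p * (\<Prod>r\<in>?N. xr r (p r))))"
    using eq by (intro sum.cong refl) auto
  also have "\<dots> = (\<Sum>p\<in>{p. p permutes ?N}. crossing_sign ?N p * (\<Prod>r\<in>?N. xr r (p r)) *
      (\<Prod>r\<in>?N. a r * b (p r) + c r * d (p r)))"
    by (rule sum_weighted_products[symmetric]) (auto simp: finite_permutations)
  finally show ?thesis unfolding conf_all .
qed

end

text \<open>Composing the summation variable with \<open>q\<close> restores the natural column order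
  at the cost of \<open>sign q\<close>.\<close>

lemma det_permuted_columns:
  fixes Y :: "nat \<Rightarrow> nat \<Rightarrow> 'a :: comm_ring_1"
  assumes q: "q permutes {0..<n}"
  shows "Determinant.det (Matrix.mat n n (\<lambda>(r, s). Y r (q s))) =
    of_int (sign q) * (\<Sum>p | p permutes {0..<n}. of_int (sign p) * (\<Prod>r\<in>{0..<n}. Y r (p r)))"
proof -
  let ?N = "{0..<n}"
  have perm: "permutation p" if "p permutes ?N" for p using that permutation_permutes by blast
  have "Determinant.det (Matrix.mat n n (\<lambda>(r, s). Y r (q s))) =
      (\<Sum>p | p permutes ?N. of_int (sign p) * (\<Prod>r\<in>?N. Y r (q (p r))))"
    by (subst det_def'[of _ n]) (auto intro!: sum.cong prod.cong simp: permutes_in_image)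
  also have "\<dots> = (\<Sum>p | p permutes ?N. of_int (sign q) * (of_int (sign (q \<circ> p)) * (\<Prod>r\<in>?N. Y r ((q \<circ> p) r))))"
  proof (rule sum.cong[OF refl])
    fix p assume "p \<in> {p. p permutes ?N}"
    then have "sign (q \<circ> p) = sign q * sign p" using sign_compose perm q by blast
    moreover have "sign q * (sign q * sign p) = sign p" using sign_idempotent[of q] by (simp add: mult.assoc[symmetric])
    ultimately have "sign p = sign q * sign (q \<circ> p)" by simp
    then have "of_int (sign p) = (of_int (sign q) * of_int (sign (q \<circ> p)) :: 'a)" by (metis of_int_mult)
    then show "of_int (sign p) * (\<Prod>r\<in>?N. Y r (q (p r))) =
        of_int (sign q) * (of_int (sign (q \<circ> p)) * (\<Prod>r\<in>?N. Y r ((q \<circ> p) r)))"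
      by (simp add: mult.assoc)
  qed
  also have "\<dots> = of_int (sign q) * (\<Sum>p | p permutes ?N. of_int (sign (q \<circ> p)) * (\<Prod>r\<in>?N. Y r ((q \<circ> p) r)))"
    by (simp only: sum_distrib_left)
  also have "(\<Sum>p | p permutes ?N. of_int (sign (q \<circ> p)) * (\<Prod>r\<in>?N. Y r ((q \<circ> p) r))) =
      (\<Sum>p | p permutes ?N. of_int (sign p) * (\<Prod>r\<in>?N. Y r (p r)))"
    by (rule setum_permutations_compose_left[OF q, symmetric])
  finally show ?thesis .
qed

theorem theorem6p1:
  fixes n :: nat
    and G :: "('v, 'e) noded_graph"
    and pos :: "'v \<Rightarrow> complex"
    and crv :: "'e \<Rightarrow> real \<Rightarrow> complex"
    and color :: "nat \<Rightarrow> rgb"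
    and \<sigma> :: "nat \<Rightarrow> nat"
  assumes "noded_bipartite_graph n G"
    and "plane_embedding G pos crv"
    and "nodes_on_outer_face n G pos crv"
    and "nodes_counterclockwise n G pos crv"
    and "double_dimer_configs n G \<noteq> {}"
    and "contiguously_colored n color"
    and "planar_pairing n \<sigma>"
    and "\<forall>i\<in>{1..2*n}. color i \<noteq> color (\<sigma> i)"
  shows "Pr_hat n G \<sigma> =
    Determinant.det (Matrix.mat n n (\<lambda>(r, s).
      let i = 2 * r + 1; j = \<sigma> (2 * s + 1)
      in if color i \<noteq> color j then X n G i j else 0))"
proof -
  interpret disc_graph G n using assms(1,2,4) by (rule disc_graphI)
  let ?N = "{0..<n}" and ?S = "{1..2*n}"
  define DD where "DD = double_dimer_configs n G"
  define z where "z = zt {}"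
  have DD: "DD = conf ?S" unfolding DD_def by (simp only: conf_all)
  have finDD: "finite DD" unfolding DD conf_def by (intro finite_configs toggled_verts subset_refl empty_subsetI)
  have nc\<sigma>: "noncrossing_pairing ?S \<sigma>" using assms(7) by (rule planar_pairing_noncrossing)
  have ncM: "noncrossing_pairing ?S (mate M ?S)" if "M \<in> DD" for M
    using mate_noncrossing[OF subset_refl] that unfolding DD .
  define q where "q = row_perm n \<sigma>"
  have q: "q permutes ?N" unfolding q_def by (rule row_perm_permutes[OF nc\<sigma>])
  have cw: "config_weight G M > 0" if "M \<in> DD" for M
  proof -
    have "set_mset M \<subseteq> edges G" using that unfolding DD conf_def configs_def by blast
    then have "wt G e > 0" if "e \<in># M" for e using assms(1) that by (auto simp: noded_bipartite_graph_def)
    then have "prod_mset (image_mset (wt G) M) > 0" by (induction M) auto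
    then show ?thesis by (simp add: config_weight_def)
  qed
  \<comment> \<open>Every planar pairing joins odd to even nodes, so for the empty set the indicator
    in \<open>zt_mult\<close> is always 1.\<close>
  have total: "(\<Sum>M\<in>DD. config_weight G M) = z * zt ?S"
  proof -
    have "alternates {} ?S (mate M ?S)" if "M \<in> DD" for M
      using noncrossing_parity[OF ncM[OF that]] by (auto simp: alternates_def)
    then have "(\<Sum>M\<in>DD. config_weight G M) = (\<Sum>M\<in>DD. config_weight G M * of_bool (alternates {} ?S (mate M ?S)))"
      by (intro sum.cong refl) auto
    then show ?thesis using zt_mult[of ?S "{}"] unfolding DD z_def by simp
  qed
  \<comment> \<open>The existence of a configuration makes both partition functions nonzero, so the
    quotients below are genuine.\<close>
  have "(\<Sum>M\<in>DD. config_weight G M) > 0" using cw finDD assms(5) by (intro sum_pos) (auto simp: DD_def)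
  then have nz: "z \<noteq> 0" "zt ?S \<noteq> 0" unfolding total by auto
  have conn: "connects_as n G \<sigma> M \<longleftrightarrow> (\<forall>i\<in>?S. mate M ?S i = \<sigma> i)" if M: "M \<in> DD" for M
  proof -
    have "joined G M (node G i) (node G (\<sigma> i)) \<longleftrightarrow> mate M ?S i = \<sigma> i" if i: "i \<in> ?S" for i
      using mate_unique[OF subset_refl M[unfolded DD] i] mate(3)[OF subset_refl M[unfolded DD] i]
        noncrossing_pairingD[OF nc\<sigma> i] by metis
    then show ?thesis unfolding connects_as_def by simp
  qed
  obtain u w :: "nat \<Rightarrow> real" where uw: "\<And>i j. 1 \<le> i \<Longrightarrow> i < j \<Longrightarrow> j \<le> 2*n \<Longrightarrow>
      u i * w j - w i * u j = of_bool (color i \<noteq> color j)"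
    using colour_vectors[OF assms(6)] by blast
  \<comment> \<open>The bracket of the colour vectors of an odd and an even node, in the shape
    required by \<open>config_sum_eq_permutation_sum\<close>. For different colours it is
    \<open>-1\<close> instead of 1 when the even node comes first, that is when
    \<open>s < r\<close>; \<open>sign_mult_crossing_sign\<close> accounts for these signs.\<close>
  define B where "B r s = u (2 * r + 1) * w (2 * s + 2) + (- w (2 * r + 1)) * u (2 * s + 2)" for r s
  have B: "B r s = (if s < r then -1 else 1) * of_bool (color (2 * r + 1) \<noteq> color (2 * s + 2))" if "r < n" "s < n" for r s
    using uw[of "2 * r + 1" "2 * s + 2"] uw[of "2 * s + 2" "2 * r + 1"] that unfolding B_def
    by (cases "s < r") (simp_all add: mult.commute algebra_simps eq_commute[of "color (2 * s + 2)"])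
  have prodB: "(\<Prod>r\<in>?N. B r (p r)) = of_int (sign p) * crossing_sign ?N p *
      (\<Prod>r\<in>?N. of_bool (color (2 * r + 1) \<noteq> color (2 * p r + 2)))" if p: "p permutes ?N" for p
  proof -
    have "p r < n" if "r < n" for r using permutes_in_image[OF p, of r] that by simp
    then show ?thesis unfolding sign_mult_crossing_sign[OF p] prod.distrib[symmetric]
      by (intro prod.cong refl B) auto
  qed
  have cs: "crossing_sign ?N p * crossing_sign ?N p = 1" for p
    unfolding crossing_sign_def prod.distrib[symmetric] by (rule prod.neutral) (auto simp: chord_sign_square)
  define Y where "Y r s = of_bool (color (2 * r + 1) \<noteq> color (2 * s + 2)) * xr r s" for r s
  have "Matrix.mat n n (\<lambda>(r, s). let i = 2 * r + 1; j = \<sigma> (2 * s + 1)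
      in if color i \<noteq> color j then X n G i j else 0) = Matrix.mat n n (\<lambda>(r, s). Y r (q s))"
    by (rule eq_matI) (auto simp only: index_mat row_perm_eq(1)[OF nc\<sigma>] X_eq_xr Let_def Y_def q_def of_bool_def dim_row_mat dim_col_mat split: if_splits prod.splits)
  then have "Determinant.det (Matrix.mat n n (\<lambda>(r, s). let i = 2 * r + 1; j = \<sigma> (2 * s + 1)
      in if color i \<noteq> color j then X n G i j else 0)) =
    of_int (sign q) * (\<Sum>p | p permutes ?N. of_int (sign p) * (\<Prod>r\<in>?N. Y r (p r)))"
    by (simp only: det_permuted_columns[OF q])
  also have "(\<Sum>p | p permutes ?N. of_int (sign p) * (\<Prod>r\<in>?N. Y r (p r))) =
      (\<Sum>p | p permutes ?N. crossing_sign ?N p * (\<Prod>r\<in>?N. xr r (p r)) * (\<Prod>r\<in>?N. B r (p r)))"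
  proof (rule sum.cong[OF refl])
    fix p assume "p \<in> {p. p permutes ?N}"
    then have p: "p permutes ?N" by blast
    \<comment> \<open>The crossing sign occurs twice, once from the expansion and once from the
      brackets, and so disappears.\<close>
    have "crossing_sign ?N p * (\<Prod>r\<in>?N. xr r (p r)) * (\<Prod>r\<in>?N. B r (p r)) =
      (crossing_sign ?N p * crossing_sign ?N p) * (of_int (sign p) *
        ((\<Prod>r\<in>?N. of_bool (color (2 * r + 1) \<noteq> color (2 * p r + 2))) * (\<Prod>r\<in>?N. xr r (p r))))"
      unfolding prodB[OF p] by (simp only: mult_ac)
    then show "of_int (sign p) * (\<Prod>r\<in>?N. Y r (p r)) =
        crossing_sign ?N p * (\<Prod>r\<in>?N. xr r (p r)) * (\<Prod>r\<in>?N. B r (p r))"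
      unfolding cs Y_def prod.distrib mult_1_left by (rule sym)
  qed
  also have "\<dots> = (\<Sum>M\<in>DD. config_weight G M / (z * z) * (\<Prod>r\<in>?N. B r (row_perm n (mate M ?S) r)))"
    unfolding B_def DD_def z_def
    by (rule config_sum_eq_permutation_sum[symmetric]) (use nz z_def in simp)
  also have "\<dots> = (\<Sum>M\<in>DD. config_weight G M / (z * z) * (of_int (sign q) * of_bool (connects_as n G \<sigma> M)))"
  proof (rule sum.cong[OF refl])
    fix M assume M: "M \<in> DD"
    let ?\<tau> = "mate M ?S"
    let ?p = "row_perm n ?\<tau>"
    have p: "?p permutes ?N" by (rule row_perm_permutes[OF ncM[OF M]])
    \<comment> \<open>The crossing sign of a planar pairing is 1, so only the sign of its
      permutation and the colour test remain.\<close>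
    have "(\<Prod>r\<in>?N. B r (?p r)) = of_int (sign ?p) * (\<Prod>r\<in>?N. of_bool (color (2 * r + 1) \<noteq> color (?\<tau> (2 * r + 1))))"
      unfolding prodB[OF p] crossing_sign_row_perm[OF ncM[OF M]]
      by (simp add: row_perm_eq(1)[OF ncM[OF M], simplified])
    also have "\<dots> = of_int (sign q) * of_bool (connects_as n G \<sigma> M)"
    proof (cases "connects_as n G \<sigma> M")
      case True
      then have eq: "?\<tau> i = \<sigma> i" if "i \<in> ?S" for i using conn[OF M] that by blast
      then have "?p = q" unfolding q_def row_perm_def by (auto simp: fun_eq_iff)
      moreover have "(\<Prod>r\<in>?N. of_bool (color (2 * r + 1) \<noteq> color (?\<tau> (2 * r + 1))) :: real) = 1"
      proof (rule prod.neutral, rule ballI)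
        fix r assume "r \<in> ?N"
        then have "2 * r + 1 \<in> ?S" by auto
        then show "(of_bool (color (2 * r + 1) \<noteq> color (?\<tau> (2 * r + 1))) :: real) = 1"
          using eq assms(8) by simp
      qed
      ultimately show ?thesis using True by simp
    next
      case False
      \<comment> \<open>A planar pairing that passes the colour test at every row would be \<sigma>
        itself.\<close>
      have "\<exists>r\<in>?N. color (2 * r + 1) = color (?\<tau> (2 * r + 1))"
      proof (rule ccontr)
        assume no: "\<not> ?thesis"
        have diff: "color i \<noteq> color (?\<tau> i)" if i: "i \<in> ?S" for i
        proof (cases "odd i")
          case True
          then obtain r where r: "i = 2 * r + 1" by (elim oddE)
          then have "r \<in> ?N" using i by auto
          then show ?thesis using no r by blast
        next
          case False
          then have "odd (?\<tau> i)" using noncrossing_parity[OF ncM[OF M] i] by simp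
          then obtain r where r: "?\<tau> i = 2 * r + 1" by (elim oddE)
          then have "r \<in> ?N" using noncrossing_pairingD(1)[OF ncM[OF M] i] by auto
          then have "color (?\<tau> i) \<noteq> color (?\<tau> (?\<tau> i))" using no r by metis
          then show ?thesis using noncrossing_pairingD(3)[OF ncM[OF M] i] by metis
        qed
        have "?\<tau> i = \<sigma> i" if "i \<in> ?S" for i
          by (rule tripartite_pairing_unique[OF assms(6) ncM[OF M] diff nc\<sigma> _ that]) (use assms(8) in blast)+
        then show False using False conn[OF M] by blast
      qed
      then have "(\<Prod>r\<in>?N. of_bool (color (2 * r + 1) \<noteq> color (?\<tau> (2 * r + 1))) :: real) = 0"
        by (intro prod_zero) auto
      then show ?thesis using False by simp
    qed
    finally show "config_weight G M / (z * z) * (\<Prod>r\<in>?N. B r (?p r)) =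
        config_weight G M / (z * z) * (of_int (sign q) * of_bool (connects_as n G \<sigma> M))" by simp
  qed
  also have "\<dots> = of_int (sign q) * (\<Sum>M\<in>DD. config_weight G M * of_bool (connects_as n G \<sigma> M)) / (z * z)"
    unfolding sum_distrib_left sum_divide_distrib by (intro sum.cong refl) simp
  \<comment> \<open>The sign from the column order equals the sign of the surviving pairing, and
    their product is 1.\<close>
  also have "of_int (sign q) * \<dots> = (\<Sum>M\<in>DD. config_weight G M * of_bool (connects_as n G \<sigma> M)) / (z * z)"
  proof -
    have "(of_int (sign q) * of_int (sign q) :: real) = 1" by (metis of_int_mult of_int_1 sign_idempotent)
    then show ?thesis by (simp add: mult.assoc[symmetric])
  qed
  also have "(\<Sum>M\<in>DD. config_weight G M * of_bool (connects_as n G \<sigma> M)) =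
      (\<Sum>M\<in>{M \<in> DD. connects_as n G \<sigma> M}. config_weight G M)"
    using finDD by (simp add: sum.inter_filter of_bool_def if_distrib cong: if_cong)
  also have "\<dots> / (z * z) = Pr_hat n G \<sigma>"
    using nz unfolding Pr_hat_def Pr_def zt_empty[symmetric] zt_all[symmetric] DD_def[symmetric] total z_def
    by (simp add: field_simps)
  finally show ?thesis by (rule sym)
qed

end
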